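(* For every prime $p$ there exist positive constants $c_p$ and $X_0$ such that for all $X \ge X_0$, the number of positive integers $n \le X$ that are $p$-practical but not $\lambda$-practical is at least $c_p \frac{X}{\log X}$.
   Context: For a prime $p$, a positive integer $n$ is $p$-practical if the polynomial $x^n-1$ has a divisor in $\mathbb{F}_p[x]$ of every degree $1,2,\dots,n$. A positive integer $n$ is $\lambda$-practical if it is $p$-practical for every prime $p$. *)

theory Defs
  imports Complex_Main "HOL-Algebra.Polynomial_Divisibility" "HOL-Number_Theory.Residues"
begin

text \<open>
  The ring \<open>\<F>\<^sub>p[x]\<close> is \<open>poly_ring (residue_ring p)\<close>, since \<open>residue_ring p\<close> is the field
  \<open>\<int>/p\<int>\<close> for prime \<open>p\<close>.  Its elements are coefficient lists with nonzero head, so a nonzero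
  polynomial has degree one less than its length.
\<close>

definition p_practical :: "nat \<Rightarrow> nat \<Rightarrow> bool" where
  "p_practical p n \<longleftrightarrow>
     (let F = residue_ring (int p); P = poly_ring F in
      0 < n \<and>
      (\<forall>d\<in>{1..n}. \<exists>f\<in>carrier P.
          f divides\<^bsub>P\<^esub> (X\<^bsub>F\<^esub> [^]\<^bsub>P\<^esub> n \<ominus>\<^bsub>P\<^esub> \<one>\<^bsub>P\<^esub>) \<and> Polynomials.degree f = d))"

definition lambda_practical :: "nat \<Rightarrow> bool" where
  "lambda_practical n \<longleftrightarrow> 0 < n \<and> (\<forall>p::nat. Factorial_Ring.prime p \<longrightarrow> p_practical p n)"

end

theory Submission
  imports Defs "Berlekamp_Zassenhaus.Distinct_Degree_Factorization" "HOL-Number_Theory.Prime_Powers"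
    "HOL-Number_Theory.Totient" "HOL-Computational_Algebra.Squarefree"
begin

text \<open>
  We count integers \<open>n = a q\<^sub>1 \<dots> q\<^sub>k\<close> with a fixed \<open>a\<close> and primes \<open>t < q\<^sub>1 < \<dots> < q\<^sub>k\<close> such that
  \<open>2 q\<^sub>i \<le> a q\<^sub>1 \<dots> q\<^bsub>i-1\<^esub>\<close> for all \<open>i\<close>.

  \<^emph>\<open>Practicality.\<close> Take \<open>a = p\<^sup>j\<close> if \<open>p\<close> is odd and \<open>a = 28 \<cdot> 11\<^sup>j\<close> if \<open>p = 2\<close>. A degree \<open>m \<le> nq\<close> is
  written as \<open>(q - 1) A + B\<close>, where \<open>A \<le> n\<close> is a degree attained by a product of cyclotomic factors
  \<open>\<Phi>\<^sub>d\<close> of \<open>x\<^sup>n - 1\<close> (replaced by the \<open>\<Phi>\<^bsub>dq\<^esub>\<close>) and \<open>B \<le> n\<close> is attained by any divisor of \<open>x\<^sup>n - 1\<close>.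
  On the other hand, an irreducible factor of degree \<open>e\<close> of \<open>x\<^sup>n - 1\<close> over \<open>\<F>\<^sub>r\<close> divides
  \<open>x\<^sup>g - 1\<close> with \<open>g = gcd(n, r\<^sup>e - 1)\<close>. If \<open>t\<close> is large, \<open>g\<close> depends on \<open>a\<close> only, and for \<open>r = 2\<close>
  (\<open>p\<close> odd) or \<open>r = 17\<close> (\<open>p = 2\<close>) this excludes divisors of degree 2, 4 or 5.

  \<^emph>\<open>Counting.\<close> Reveal the primes \<open>q\<close> in increasing order, including \<open>q\<close> with probability
  \<open>q\<^bsup>-s\<^esup> / (1 + q\<^bsup>-s\<^esup>)\<close>, \<open>s = 1 + 1/L\<close>, and stop when the next prime exceeds \<open>T\<close> times the product so far.
  The logarithm of the product minus its mean is a martingale; by Mertens' theorem it is bounded and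
  negative at an early stopping time, so optional stopping gives upper and lower bounds for
  \<open>\<Sum> log a / a\<^sup>s\<close> over the admissible products \<open>a\<close>. Hence \<open>\<Sum> 1/a\<close> over \<open>y\<^sup>\<delta> < a \<le> y\<^sup>K\<close> is bounded
  below, and multiplying such \<open>a\<close> by a bounded number of further primes gives \<open>\<gg> x / log x\<close>
  admissible products up to \<open>x\<close>.
\<close>

text \<open>A power of 2 cannot serve as the base for p = 2: the totients 1, 1, 2, 4, ... of its
  divisors yield every degree over the integers, hence over every field, and extension by admissible
  primes preserves this. The base must contain a cyclotomic factor that splits further over F_2 than
  over F_r. The order of 2 modulo 7 is 3, whereas 17 is the smallest prime that is a primitive root
  both modulo 7 and modulo 11; so over F_17 the factors of order divisible by 7 or 11 contribute
  nothing of degree at most 5. The exponent j resolves a conflict of sizes. The martingale is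
  negative at an early stop only if T exceeds t by a factor e^29, practicality requires 2 T <= a,
  and t itself must exceed a power of r fixed by the excluded degree. Hence a has to grow while its
  gcds with the numbers r^e - 1 stay fixed. Powers of an odd p do this for r = 2, and powers of 11
  for r = 17; higher powers of 2 would create new divisors of small degree over F_17.\<close>

hide_const (open) Divisibility.prime Divisibility.irreducible Coset.order

section \<open>Mertens' first theorem\<close>

lemma prod_dvd_pairwise_coprime:
  fixes x :: "'a :: semiring_gcd"
  assumes "finite A" "\<And>a b. a \<in> A \<Longrightarrow> b \<in> A \<Longrightarrow> a \<noteq> b \<Longrightarrow> Rings.coprime (f a) (f b)"
    "\<And>a. a \<in> A \<Longrightarrow> f a dvd x"
  shows "(\<Prod>a\<in>A. f a) dvd x"
  using assms
proof (induction A rule: finite_induct)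
  case (insert a A)
  have "Rings.coprime (f a) (\<Prod>a\<in>A. f a)"
    using insert by (intro prod_coprime_right) auto
  thus ?case using insert by (simp add: divides_mult)
qed auto

lemma finite_primes_le [simp]: "finite {p :: nat. prime p \<and> p \<le> n}"
  by (rule finite_subset[of _ "{..n}"]) auto

text \<open>A prime in (n, 2n] divides (2n)! but not n!, so it survives in the central binomial
  coefficient, which is at most 4^n.\<close>

lemma prod_primes_le_4_power: "(\<Prod>p | prime p \<and> n < p \<and> p \<le> 2 * n. p) \<le> 4 ^ (n :: nat)"
proof -
  have "(\<Prod>p | prime p \<and> n < p \<and> p \<le> 2 * n. p) dvd (2 * n choose n)"
  proof (rule prod_dvd_pairwise_coprime)
    show "finite {p. prime p \<and> n < p \<and> p \<le> 2 * n}"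
      by (rule finite_subset[of _ "{..2*n}"]) auto
  next
    fix p assume p: "p \<in> {p. prime p \<and> n < p \<and> p \<le> 2 * n}"
    have "fact n * fact n * (2 * n choose n) = fact (2 * n)"
      using binomial_fact_lemma[of n "2 * n"] by (simp add: mult_2)
    moreover have "p dvd fact (2 * n)" "\<not> p dvd fact n"
      using p by (auto simp: prime_dvd_fact_iff)
    ultimately show "p dvd (2 * n choose n)" using p by (metis mem_Collect_eq prime_dvd_mult_iff)
  qed (auto simp: primes_coprime)
  hence "(\<Prod>p | prime p \<and> n < p \<and> p \<le> 2 * n. p) \<le> (2 * n choose n)"
    by (rule dvd_imp_le) simp
  also have "\<dots> \<le> 2 ^ (2 * n)" by (rule binomial_le_pow2)
  finally show ?thesis by (simp add: power_mult)
qed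

lemma theta_double_le:
  "(\<Sum>p | prime p \<and> p \<le> 2 * n. ln (real p)) \<le> (\<Sum>p | prime p \<and> p \<le> n. ln (real p)) + 2 * real n * ln 2"
proof -
  have "{p. prime p \<and> p \<le> 2 * n} = {p. prime p \<and> p \<le> n} \<union> {p. prime p \<and> n < p \<and> p \<le> 2 * n}" by auto
  hence "(\<Sum>p | prime p \<and> p \<le> 2 * n. ln (real p)) = (\<Sum>p | prime p \<and> p \<le> n. ln (real p)) +
      (\<Sum>p | prime p \<and> n < p \<and> p \<le> 2 * n. ln (real p))"
    by (simp only:, subst sum.union_disjoint)
      (auto intro!: finite_subset[of "{p. prime p \<and> n < p \<and> p \<le> 2 * n}" "{..2*n}"])
  also have "(\<Sum>p | prime p \<and> n < p \<and> p \<le> 2 * n. ln (real p)) = ln (\<Prod>p | prime p \<and> n < p \<and> p \<le> 2 * n. real p)"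
    by (rule ln_prod[symmetric])
      (auto intro!: finite_subset[of "{p. prime p \<and> n < p \<and> p \<le> 2 * n}" "{..2*n}"] simp: prime_gt_0_nat)
  also have "(\<Prod>p | prime p \<and> n < p \<and> p \<le> 2 * n. real p) = real (\<Prod>p | prime p \<and> n < p \<and> p \<le> 2 * n. p)"
    by simp
  also have "ln \<dots> \<le> ln (4 ^ n)"
  proof -
    have "0 < (\<Prod>p | prime p \<and> n < p \<and> p \<le> 2 * n. p)" by (auto intro!: prod_pos simp: prime_gt_0_nat)
    moreover have "real (\<Prod>p | prime p \<and> n < p \<and> p \<le> 2 * n. p) \<le> 4 ^ n"
      using prod_primes_le_4_power[of n] by (metis of_nat_le_iff of_nat_numeral of_nat_power)
    ultimately show ?thesis by (subst ln_le_cancel_iff) (simp_all only: of_nat_0_less_iff zero_less_power zero_less_numeral)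
  qed
  also have "ln (4 ^ n :: real) = 2 * real n * ln 2"
    using ln_realpow[of "2 :: real" "2 * n"] by (simp add: power_mult)
  finally show ?thesis by simp
qed

text \<open>Repeated halving. The doubling step alone would give 2 ln 2 per unit on each dyadic
  block; the constant 4 also absorbs odd n = 2m + 1, where rounding up to 2 (m + 1) costs 6 (m + 1)
  <= 4 (2m + 1).\<close>

lemma theta_le: "(\<Sum>p | prime p \<and> p \<le> n. ln (real p)) \<le> 4 * real n * ln 2"
proof (induction n rule: less_induct)
  case (less n)
  consider "n = 0" | "n = 1" | m where "n = 2 * m" "m \<ge> 1" | m where "n = 2 * m + 1" "m \<ge> 1"
    by (cases "even n"; cases "n \<le> 1") (auto elim!: evenE oddE simp: le_Suc_eq)
  thus ?case
  proof cases
    case 1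
    thus ?thesis by (simp cong: conj_cong)
  next
    case 2
    have "{p::nat. prime p \<and> p \<le> n} = {}" using 2 by (auto dest: prime_gt_1_nat)
    thus ?thesis by (simp only:) simp
  next
    case (3 m)
    have "(\<Sum>p | prime p \<and> p \<le> n. ln (real p)) \<le> 4 * real m * ln 2 + 2 * real m * ln 2"
      using theta_double_le[of m] less[of m] 3 by simp
    also have "\<dots> \<le> 4 * real n * ln 2" using 3 by simp
    finally show ?thesis .
  next
    case (4 m)
    have "(\<Sum>p | prime p \<and> p \<le> n. ln (real p)) \<le> (\<Sum>p | prime p \<and> p \<le> 2 * (m + 1). ln (real p))"
      using 4 by (intro sum_mono2) (auto simp: prime_gt_0_nat)
    also have "\<dots> \<le> 4 * real (m + 1) * ln 2 + 2 * real (m + 1) * ln 2"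
      using theta_double_le[of "m + 1"] less[of "m + 1"] 4 by simp
    also have "\<dots> = (6 * real m + 6) * ln 2" by (simp add: algebra_simps)
    also have "\<dots> \<le> (4 * real n) * ln 2" using 4 by (intro mult_right_mono) auto
    finally show ?thesis by simp
  qed
qed

section \<open>Legendre's formula and the two Mertens bounds\<close>

lemma ln_fact_eq_sum_mangoldt: "ln (fact n) = (\<Sum>d=1..n. mangoldt d * real (n div d))"
proof -
  have "ln (fact n :: real) = (\<Sum>m=1..n. ln (real m))"
    by (simp add: fact_prod, subst ln_prod) auto
  also have "\<dots> = (\<Sum>m=1..n. \<Sum>d | d dvd m. mangoldt d)"
    by (intro sum.cong refl) (auto simp: mangoldt_sum)
  also have "\<dots> = (\<Sum>m=1..n. \<Sum>d | d \<in> {1..n} \<and> d dvd m. mangoldt d)"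
    by (intro sum.cong refl) (auto dest: dvd_imp_le intro: Nat.gr0I)
  also have "\<dots> = (\<Sum>d=1..n. \<Sum>m | m \<in> {1..n} \<and> d dvd m. mangoldt d)"
    by (rule sum.swap_restrict) auto
  also have "\<dots> = (\<Sum>d=1..n. mangoldt d * real (n div d))"
  proof (intro sum.cong refl)
    fix d assume d: "d \<in> {1..n}"
    have "{m. m \<in> {1..n} \<and> d dvd m} = (*) d ` {1..n div d}"
      using d by (auto simp: elim!: dvdE)
         (auto simp: image_iff less_eq_div_iff_mult_less_eq mult.commute intro!: bexI)
    moreover have "inj_on ((*) d) {1..n div d}" using d by (auto simp: inj_on_def)
    ultimately have "card {m. m \<in> {1..n} \<and> d dvd m} = n div d" by (simp add: card_image)
    thus "(\<Sum>m | m \<in> {1..n} \<and> d dvd m. mangoldt d) = mangoldt d * real (n div d)" by simp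
  qed
  finally show ?thesis .
qed

lemma ln_fact_le: "ln (fact n) \<le> real n * ln (real n)" if "n > 0"
proof -
  have "ln (fact n :: real) \<le> ln (real (n ^ n))"
    using that by (subst ln_le_cancel_iff) (auto intro: fact_le_power simp del: of_nat_power)
  thus ?thesis using that by (simp add: ln_realpow)
qed

lemma ln_fact_ge: "ln (fact n) \<ge> real n * ln (real n) - real n" if "n > 0"
proof -
  have s: "summable (\<lambda>k. real n ^ k / fact k)"
    using summable_exp[of "real n"] by (simp add: field_simps)
  have "real n ^ n / fact n \<le> (\<Sum>k. real n ^ k / fact k)"
    using sum_le_suminf[OF s, of "{n}"] by simp
  also have "\<dots> = exp (real n)" by (simp add: exp_def field_simps scaleR_conv_of_real)
  finally have "ln (real n ^ n / fact n) \<le> real n"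
    using that by (subst ln_exp[symmetric], subst ln_le_cancel_iff) auto
  thus ?thesis using that by (simp add: ln_div ln_realpow)
qed

lemma of_nat_div_bounds:
  assumes "p > 0"
  shows "real (n div p) \<le> real n / real p" "real n / real p \<le> real (n div p) + 1"
proof -
  have p: "real p > 0" using assms by simp
  have "real (n div p * p) \<le> real n" by (subst of_nat_le_iff) (rule div_times_less_eq_dividend)
  hence "real (n div p) * real p \<le> real n" by (simp only: of_nat_mult)
  thus "real (n div p) \<le> real n / real p" by (subst pos_le_divide_eq[OF p])
  have "real n \<le> real (p + n div p * p)"
    using dividend_less_div_times[OF assms, of n] by (subst of_nat_le_iff) simp
  hence "real n \<le> (real (n div p) + 1) * real p" by (simp only: of_nat_add of_nat_mult distrib_right mult_1_left add.commute)
  thus "real n / real p \<le> real (n div p) + 1" by (subst pos_divide_le_eq[OF p])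
qed

text \<open>Only the primes are kept in Legendre's formula. Replacing floor(n/p) by n/p costs the
  sum of ln p over p <= n, which is linear in n by Chebyshev's bound.\<close>

lemma mertens_upper:
  assumes "n > 0"
  shows "(\<Sum>p | prime p \<and> p \<le> n. ln (real p) / real p) \<le> ln (real n) + 4 * ln 2"
proof -
  let ?P = "{p. prime p \<and> p \<le> n}"
  have "(\<Sum>p\<in>?P. ln (real p) * (real n / real p - 1)) \<le> (\<Sum>p\<in>?P. mangoldt p * real (n div p))"
  proof (intro sum_mono)
    fix p assume p: "p \<in> ?P"
    have "real n / real p - 1 \<le> real (n div p)"
      using of_nat_div_bounds(2)[of p n] p prime_gt_0_nat[of p] by simp
    thus "ln (real p) * (real n / real p - 1) \<le> mangoldt p * real (n div p)"
      using p prime_gt_0_nat[of p] by (auto intro!: mult_left_mono)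
  qed
  also have "\<dots> \<le> (\<Sum>d=1..n. mangoldt d * real (n div d))"
    by (intro sum_mono2) (auto simp: mangoldt_nonneg prime_gt_0_nat Suc_leI)
  also have "\<dots> \<le> real n * ln (real n)"
    using ln_fact_le[OF assms] by (simp add: ln_fact_eq_sum_mangoldt)
  finally have "real n * (\<Sum>p\<in>?P. ln (real p) / real p) - (\<Sum>p\<in>?P. ln (real p)) \<le> real n * ln (real n)"
    by (simp add: algebra_simps sum_subtractf sum_distrib_left)
  with theta_le[of n] have "real n * (\<Sum>p\<in>?P. ln (real p) / real p) \<le> real n * (ln (real n) + 4 * ln 2)"
    by (simp add: algebra_simps)
  thus ?thesis using assms by simp
qed

text \<open>Since ln m <= 2 sqrt m, each term is at most a constant times m^(-3/2), which is bounded
  by a telescoping difference of 8 / sqrt.\<close>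

lemma sum_ln_div_le: "(\<Sum>m=2..n. ln (real m) / (real m * (real m - 1))) \<le> 8"
proof -
  have step: "ln (real m) / (real m * (real m - 1)) \<le> 8 * (1 / sqrt (real m - 1) - 1 / sqrt (real m))" if m: "m \<ge> 2" for m
  proof -
    define s where "s = sqrt (real m)"
    define r where "r = sqrt (real m - 1)"
    have s: "s > 0" "s ^ 2 = real m" "r > 0" "r ^ 2 = real m - 1" "r \<le> s"
      using m by (auto simp: s_def r_def)
    have "ln (real m) = 2 * ln s" using m by (simp add: s_def ln_sqrt)
    also have "\<dots> \<le> 2 * s" using ln_le_minus_one[of s] s by simp
    finally have ln: "ln (real m) \<le> 2 * s" .
    have "(s - r) * (s + r) = 1" using s by (simp add: algebra_simps power2_eq_square)
    hence sr: "s - r = 1 / (s + r)" using s by (simp add: field_simps)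
    have r2: "s ^ 2 \<le> 2 * r ^ 2" using s m by simp
    have "ln (real m) / (real m * (real m - 1)) \<le> 2 * s / (s ^ 2 * r ^ 2)"
      unfolding s(2,4) using ln m by (intro divide_right_mono) auto
    also have "\<dots> = 2 / (s * r ^ 2)" using s(1) by (simp add: power2_eq_square)
    also have "\<dots> \<le> 8 * (1 / (s + r)) / (r * s)"
    proof -
      have "(2 * r) ^ 2 = 4 * r ^ 2" by (simp add: power_mult_distrib)
      hence "s ^ 2 \<le> (2 * r) ^ 2" using r2 zero_le_power2[of r] by linarith
      hence "s \<le> 2 * r" by (rule power2_le_imp_le) (use s(3) in simp)
      hence "s + r \<le> 2 * r + 2 * r" using s(3) by (intro add_mono) auto
      hence "1 / (4 * r) \<le> 1 / (s + r)" using s(1,3) by (intro divide_left_mono) auto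
      hence "8 * (1 / (4 * r)) / (r * s) \<le> 8 * (1 / (s + r)) / (r * s)"
        using s(1,3) by (intro divide_right_mono mult_left_mono) auto
      moreover have "8 * (1 / (4 * r)) / (r * s) = 2 / (s * r ^ 2)"
        using s(1,3) by (simp add: field_simps power2_eq_square)
      ultimately show ?thesis by (simp only:)
    qed
    also have "\<dots> = 8 * (1 / r - 1 / s)" unfolding sr[symmetric] using s by (simp add: field_simps)
    finally show ?thesis by (simp add: s_def r_def)
  qed
  have "(\<Sum>m=2..n. ln (real m) / (real m * (real m - 1))) \<le> 8 - (if n \<ge> 2 then 8 / sqrt (real n) else 0)"
  proof (induction n)
    case (Suc n)
    show ?case
    proof (cases "n \<ge> 2")
      case True
      have "{2..Suc n} = insert (Suc n) {2..n}" using True by auto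
      hence "(\<Sum>m=2..Suc n. ln (real m) / (real m * (real m - 1))) =
         ln (real (Suc n)) / (real (Suc n) * (real (Suc n) - 1)) + (\<Sum>m=2..n. ln (real m) / (real m * (real m - 1)))" by simp
      also have "\<dots> \<le> 8 * (1 / sqrt (real n) - 1 / sqrt (real (Suc n))) + (8 - 8 / sqrt (real n))"
        using step[of "Suc n"] Suc True by (intro add_mono) auto
      finally show ?thesis using True by (simp add: algebra_simps)
    next
      case False
      thus ?thesis
      proof (cases "n = 1")
        case True
        have "{2..Suc n} = {2}" using True by auto
        thus ?thesis using step[of 2] True by simp
      qed simp
    qed
  qed simp
  also have "\<dots> \<le> 8" by simp
  finally show ?thesis .
qed

text \<open>The prime powers up to n lie among the p^k with p, k <= n; the surplus terms are
  nonnegative, and for fixed p the geometric series sums to at most 1 / (p - 1).\<close>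

lemma sum_mangoldt_le:
  "(\<Sum>d=1..n. mangoldt d / real d) \<le> (\<Sum>p | prime p \<and> p \<le> n. ln (real p) / (real p - 1))"
proof -
  let ?P = "{p. prime p \<and> p \<le> n}"
  let ?I = "?P \<times> {1..n}"
  let ?g = "\<lambda>d. mangoldt d / real d :: real"
  have fin: "finite ?I" by simp
  have "(\<Sum>d=1..n. ?g d) = (\<Sum>d | d \<in> {1..n} \<and> primepow d. ?g d)"
    by (intro sum.mono_neutral_right) (auto simp: mangoldt_def)
  also have "\<dots> \<le> (\<Sum>d\<in>(\<lambda>(p,k). p ^ k) ` ?I. ?g d)"
  proof (intro sum_mono2)
    show "finite ((\<lambda>(p,k). p ^ k) ` ?I)" by (rule finite_imageI[OF fin])
    show "{d. d \<in> {1..n} \<and> primepow d} \<subseteq> (\<lambda>(p,k). p ^ k) ` ?I"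
    proof
      fix d assume d: "d \<in> {d. d \<in> {1..n} \<and> primepow d}"
      then obtain p k where pk: "prime p" "k > 0" "d = p ^ k" by (auto simp: primepow_def)
      have "p ^ 1 \<le> p ^ k" using pk prime_ge_1_nat by (intro power_increasing) auto
      moreover have "k \<le> n"
      proof -
        have "k < 2 ^ k" by (rule less_exp)
        also have "(2 :: nat) ^ k \<le> p ^ k" using pk prime_ge_2_nat by (intro power_mono) auto
        finally show ?thesis using d pk by simp
      qed
      ultimately show "d \<in> (\<lambda>(p,k). p ^ k) ` ?I" using d pk
        by (intro image_eqI[of _ _ "(p, k)"]) auto
    qed
  qed (auto simp: mangoldt_nonneg)
  also have "\<dots> \<le> (\<Sum>pk\<in>?I. ?g (case pk of (p,k) \<Rightarrow> p ^ k))"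
    using sum_image_le[OF fin, of ?g "\<lambda>(p,k). p ^ k"] by (simp add: mangoldt_nonneg o_def)
  also have "\<dots> = (\<Sum>(p, k)\<in>?I. ?g (p ^ k))" by (simp add: case_prod_unfold)
  also have "\<dots> = (\<Sum>p\<in>?P. \<Sum>k=1..n. ?g (p ^ k))" by (rule sum.cartesian_product[symmetric])
  also have "\<dots> = (\<Sum>p\<in>?P. \<Sum>k=1..n. ln (real p) / real p ^ k)"
    by (intro sum.cong refl) auto
  also have "\<dots> \<le> (\<Sum>p\<in>?P. ln (real p) / (real p - 1))"
  proof (intro sum_mono)
    fix p assume p: "p \<in> ?P"
    hence p2: "p \<ge> 2" using prime_ge_2_nat by auto
    have "(\<Sum>k=1..n. 1 / real p ^ k) \<le> 1 / (real p - 1)"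
    proof -
      have "(\<Sum>k=1..n. 1 / real p ^ k) * (real p - 1) = 1 - 1 / real p ^ n"
      proof (induction n)
        case (Suc n)
        have "(\<Sum>k=1..Suc n. 1 / real p ^ k) * (real p - 1) =
            (\<Sum>k=1..n. 1 / real p ^ k) * (real p - 1) + 1 / real p ^ Suc n * (real p - 1)"
          by (simp add: distrib_right)
        also have "\<dots> = 1 - 1 / real p ^ Suc n"
          unfolding Suc using p2 by (simp add: field_simps)
        finally show ?case .
      qed simp
      hence "(\<Sum>k=1..n. 1 / real p ^ k) = (1 - 1 / real p ^ n) / (real p - 1)"
        using p2 by (simp add: nonzero_eq_divide_eq)
      also have "\<dots> \<le> 1 / (real p - 1)" using p2 by (intro divide_right_mono) auto
      finally show ?thesis .
    qed
    hence "ln (real p) * (\<Sum>k=1..n. 1 / real p ^ k) \<le> ln (real p) * (1 / (real p - 1))"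
      using p2 by (intro mult_left_mono) auto
    thus "(\<Sum>k=1..n. ln (real p) / real p ^ k) \<le> ln (real p) / (real p - 1)"
      by (simp add: sum_distrib_left)
  qed
  finally show ?thesis .
qed

text \<open>The loss 9 is 1 from Stirling's bound plus 8 from the higher prime powers.\<close>

lemma mertens_lower:
  assumes "n > 0"
  shows "ln (real n) - 9 \<le> (\<Sum>p | prime p \<and> p \<le> n. ln (real p) / real p)"
proof -
  let ?P = "{p. prime p \<and> p \<le> n}"
  have "real n * ln (real n) - real n \<le> (\<Sum>d=1..n. mangoldt d * real (n div d))"
    using ln_fact_ge[OF assms] by (simp add: ln_fact_eq_sum_mangoldt)
  also have "\<dots> \<le> (\<Sum>d=1..n. mangoldt d * (real n / real d))"
    by (intro sum_mono mult_left_mono of_nat_div_bounds(1)) (auto simp: mangoldt_nonneg)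
  also have "\<dots> = real n * (\<Sum>d=1..n. mangoldt d / real d)" by (simp add: sum_distrib_left algebra_simps)
  finally have "real n * (ln (real n) - 1) \<le> real n * (\<Sum>d=1..n. mangoldt d / real d)" by (simp add: algebra_simps)
  hence "ln (real n) - 1 \<le> (\<Sum>d=1..n. mangoldt d / real d)" using assms by simp
  also have "\<dots> \<le> (\<Sum>p\<in>?P. ln (real p) / (real p - 1))" by (rule sum_mangoldt_le)
  also have "\<dots> = (\<Sum>p\<in>?P. ln (real p) / real p + ln (real p) / (real p * (real p - 1)))"
  proof (intro sum.cong refl)
    fix p assume "p \<in> ?P"
    hence "real p > 1" using prime_gt_1_nat by auto
    thus "ln (real p) / (real p - 1) = ln (real p) / real p + ln (real p) / (real p * (real p - 1))"
      by (simp add: field_simps)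
  qed
  also have "\<dots> = (\<Sum>p\<in>?P. ln (real p) / real p) + (\<Sum>p\<in>?P. ln (real p) / (real p * (real p - 1)))"
    by (rule sum.distrib)
  also have "(\<Sum>p\<in>?P. ln (real p) / (real p * (real p - 1))) \<le> (\<Sum>m=2..n. ln (real m) / (real m * (real m - 1)))"
    by (intro sum_mono2) (auto dest: prime_ge_2_nat)
  also have "\<dots> \<le> 8" by (rule sum_ln_div_le)
  finally show ?thesis by simp
qed

lemma finite_primes_real_le [simp]: "finite {p :: nat. prime p \<and> real p \<le> x}"
  by (rule finite_subset[of _ "{..nat \<lfloor>x\<rfloor>}"]) (auto simp: le_nat_iff le_floor_iff)

lemma mertens_first:
  assumes "x \<ge> 1"
  shows "\<bar>(\<Sum>p | prime p \<and> real p \<le> x. ln (real p) / real p) - ln x\<bar> \<le> 10"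
proof -
  define n where "n = nat \<lfloor>x\<rfloor>"
  have n: "n > 0" "real n \<le> x" "x < real n + 1" using assms unfolding n_def by linarith+
  have P: "{p. prime p \<and> real p \<le> x} = {p. prime p \<and> p \<le> n}"
    using n by (auto simp: n_def le_nat_iff le_floor_iff)
  have "ln (real n) \<le> ln x" using n by simp
  have "x \<le> 2 * real n" using n by linarith
  hence "ln x \<le> ln (2 * real n)" using assms n by (subst ln_le_cancel_iff) auto
  also have "\<dots> = ln 2 + ln (real n)" using n by (simp add: ln_mult)
  finally have "ln x \<le> ln 2 + ln (real n)" .
  moreover have "ln 2 \<le> (1 :: real)" using ln_le_minus_one[of "2 :: real"] by simp
  moreover note \<open>ln (real n) \<le> ln x\<close> mertens_upper[OF n(1)] mertens_lower[OF n(1)]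
  ultimately show ?thesis unfolding P by linarith
qed

section \<open>Divisors of cyclic polynomials modulo a prime\<close>

abbreviation unity_poly :: "nat \<Rightarrow> 'a :: comm_ring_1 poly" where
  "unity_poly n \<equiv> Polynomial.monom 1 n - 1"

section \<open>Translation to integer polynomials modulo p\<close>

lemma (in residues) coeff_rev_coeffs:
  "ring.coeff R (rev (coeffs f)) i = Polynomial.coeff (f :: int poly) i"
proof -
  show ?thesis
  proof (cases "i < length (coeffs f)")
    case True
    hence "ring.coeff R (rev (coeffs f)) i = rev (coeffs f) ! (length (coeffs f) - 1 - i)"
      using coeff_nth[of i "rev (coeffs f)"] by simp
    also have "\<dots> = coeffs f ! i"
      using True by (simp add: rev_nth)
    finally show ?thesis
      using True by (auto simp: coeffs_nth nth_default_coeffs_eq[symmetric] nth_default_def)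
  next
    case False
    hence "ring.coeff R (rev (coeffs f)) i = 0"
      using coeff_length[of "rev (coeffs f)" i] by (simp add: res_zero_eq)
    moreover have "Polynomial.coeff f i = 0"
      using False by (simp add: nth_default_coeffs_eq[symmetric] nth_default_def)
    ultimately show ?thesis by simp
  qed
qed

lemma residue_polynomial_eq_iff:
  fixes p :: nat and f g :: "int list"
  assumes p: "prime p" and f: "f \<in> carrier (poly_ring (residue_ring (int p)))"
    and g: "g \<in> carrier (poly_ring (residue_ring (int p)))"
  defines "c \<equiv> ring.coeff (residue_ring (int p))"
  shows "f \<otimes>\<^bsub>poly_ring (residue_ring (int p))\<^esub> g =
           X\<^bsub>residue_ring (int p)\<^esub> [^]\<^bsub>poly_ring (residue_ring (int p))\<^esub> n
             \<ominus>\<^bsub>poly_ring (residue_ring (int p))\<^esub> \<one>\<^bsub>poly_ring (residue_ring (int p))\<^esub> \<longleftrightarrow>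
         (\<forall>i. [(\<Sum>k\<le>i. c f k * c g (i - k)) = Polynomial.coeff (unity_poly n) i] (mod int p))"
proof -
  define R where "R = residue_ring (int p)"
  have loc: "residues_prime p"
    using p by unfold_locales (simp_all add: prime_gt_1_nat)
  interpret R: field R unfolding R_def by (rule residues_prime.is_field[OF loc])
  interpret residues_prime p R by (rule loc) (rule R_def[THEN eq_reflection])
  note sub = R.carrier_is_subring
  interpret P: ring "poly_ring R" by (rule R.univ_poly_is_ring[OF sub])
  note [simp] = R_def[symmetric]
  have fg: "set f \<subseteq> carrier R" "set g \<subseteq> carrier R"
    using f g R.polynomial_in_carrier[OF sub] by (auto simp: univ_poly_carrier[symmetric])
  have cR: "c = R.coeff" by (simp add: c_def)
  have 1: "f \<otimes>\<^bsub>poly_ring R\<^esub> g \<in> carrier (poly_ring R)"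
    using f g by simp
  have vp: "X\<^bsub>R\<^esub> [^]\<^bsub>poly_ring R\<^esub> n = R.monom \<one>\<^bsub>R\<^esub> n"
    by (rule R.unitary_monom_eq_var_pow[OF sub, symmetric])
  have vc: "X\<^bsub>R\<^esub> [^]\<^bsub>poly_ring R\<^esub> n \<in> carrier (poly_ring R)"
    by (rule R.var_pow_closed[OF sub])
  have 2: "X\<^bsub>R\<^esub> [^]\<^bsub>poly_ring R\<^esub> n \<ominus>\<^bsub>poly_ring R\<^esub> \<one>\<^bsub>poly_ring R\<^esub> \<in> carrier (poly_ring R)"
    using vc by simp
  have ci: "\<ominus>\<^bsub>poly_ring R\<^esub> \<one>\<^bsub>poly_ring R\<^esub> = [\<ominus>\<^bsub>R\<^esub> \<one>\<^bsub>R\<^esub>]"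
    using R.univ_poly_a_inv_def'[OF sub P.one_closed] by (simp add: univ_poly_one)
  have coeff1: "R.coeff (f \<otimes>\<^bsub>poly_ring R\<^esub> g) i = (\<Sum>k\<le>i. c f k * c g (i - k)) mod int p" for i
  proof -
    have "R.coeff (f \<otimes>\<^bsub>poly_ring R\<^esub> g) i = (\<Oplus>\<^bsub>R\<^esub> k \<in> {..i}. R.coeff f k \<otimes>\<^bsub>R\<^esub> R.coeff g (i - k))"
      using R.poly_mult_coeff[OF fg] by (simp add: univ_poly_mult)
    also have "\<dots> = (\<Oplus>\<^bsub>R\<^esub> k \<in> {..i}. (R.coeff f k * R.coeff g (i - k)) mod int p)"
      by (simp add: res_mult_eq)
    also have "\<dots> = (\<Sum>k\<le>i. R.coeff f k * R.coeff g (i - k)) mod int p"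
      by (rule sum_cong) simp
    finally show ?thesis by (simp add: cR)
  qed
  have coeff2: "R.coeff (X\<^bsub>R\<^esub> [^]\<^bsub>poly_ring R\<^esub> n \<ominus>\<^bsub>poly_ring R\<^esub> \<one>\<^bsub>poly_ring R\<^esub>) i
      = Polynomial.coeff (unity_poly n) i mod int p" for i
  proof -
    have "R.coeff (X\<^bsub>R\<^esub> [^]\<^bsub>poly_ring R\<^esub> n \<ominus>\<^bsub>poly_ring R\<^esub> \<one>\<^bsub>poly_ring R\<^esub>) i
      = R.coeff (R.poly_add (R.monom \<one>\<^bsub>R\<^esub> n) [\<ominus>\<^bsub>R\<^esub> \<one>\<^bsub>R\<^esub>]) i"
      by (simp add: a_minus_def ci univ_poly_add vp)
    also have "\<dots> = R.coeff (R.monom \<one>\<^bsub>R\<^esub> n) i \<oplus>\<^bsub>R\<^esub> R.coeff [\<ominus>\<^bsub>R\<^esub> \<one>\<^bsub>R\<^esub>] i"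
      using R.monom_in_carrier[OF R.one_closed, of n] by (subst R.poly_add_coeff) auto
    also have "\<dots> = Polynomial.coeff (unity_poly n) i mod int p"
      unfolding R.monom_coeff
      by (auto simp: res_add_eq res_one_eq res_zero_eq res_neg_eq mod_simps)
    finally show ?thesis .
  qed
  have "f \<otimes>\<^bsub>poly_ring R\<^esub> g = X\<^bsub>R\<^esub> [^]\<^bsub>poly_ring R\<^esub> n \<ominus>\<^bsub>poly_ring R\<^esub> \<one>\<^bsub>poly_ring R\<^esub> \<longleftrightarrow>
    R.coeff (f \<otimes>\<^bsub>poly_ring R\<^esub> g) = R.coeff (X\<^bsub>R\<^esub> [^]\<^bsub>poly_ring R\<^esub> n \<ominus>\<^bsub>poly_ring R\<^esub> \<one>\<^bsub>poly_ring R\<^esub>)"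
    using 1 2 by (intro R.coeff_iff_polynomial_cond) (auto simp: univ_poly_carrier)
  thus ?thesis
    unfolding R_def[symmetric] by (simp add: fun_eq_iff coeff1 coeff2 cong_def)
qed

lemma const_dvd_diff_iff_cong:
  "[:c:] dvd f - g \<longleftrightarrow> (\<forall>i. [Polynomial.coeff f i = Polynomial.coeff g i] (mod c))"
  for c :: int
  by (simp add: const_poly_dvd_iff cong_iff_dvd_diff)

text \<open>Integer polynomials let the cyclotomic factorisation be used without passing to the
  residue field, and by reducing coefficients they also connect to polynomials over
  \<open>mod_ring\<close>. The condition on the leading coefficient says that reduction keeps the
  degree.\<close>

lemma p_practical_iff_int_poly:
  fixes p n :: nat
  assumes p: "prime p"
  shows "p_practical p n \<longleftrightarrow> 0 < n \<and> (\<forall>d\<in>{1..n}. \<exists>f g :: int poly.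
           [:int p:] dvd f * g - unity_poly n \<and> Polynomial.degree f = d \<and> \<not> int p dvd Polynomial.lead_coeff f)"
    (is "_ \<longleftrightarrow> 0 < n \<and> (\<forall>d\<in>_. ?Q d)")
proof -
  define R where "R = residue_ring (int p)"
  have loc: "residues_prime p"
    using p by unfold_locales (simp_all add: prime_gt_1_nat)
  interpret R: field R unfolding R_def by (rule residues_prime.is_field[OF loc])
  interpret residues_prime p R by (rule loc) (rule R_def[THEN eq_reflection])
  have car: "f \<in> carrier (poly_ring R) \<longleftrightarrow> f = [] \<or> set f \<subseteq> {0..int p - 1} \<and> hd f \<noteq> 0" for f
    by (auto simp: univ_poly_carrier[symmetric] polynomial_def res_carrier_eq res_zero_eq)
  have eq: "(\<exists>f\<in>carrier (poly_ring R). f divides\<^bsub>poly_ring R\<^esub> (X\<^bsub>R\<^esub> [^]\<^bsub>poly_ring R\<^esub> n \<ominus>\<^bsub>poly_ring R\<^esub> \<one>\<^bsub>poly_ring R\<^esub>)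
               \<and> length f - 1 = d) \<longleftrightarrow> ?Q d" (is "?L \<longleftrightarrow> _") if d: "d \<ge> 1" for d
  proof
    assume ?L
    then obtain f g where f: "f \<in> carrier (poly_ring R)" and g: "g \<in> carrier (poly_ring R)"
      and fg: "f \<otimes>\<^bsub>poly_ring R\<^esub> g = X\<^bsub>R\<^esub> [^]\<^bsub>poly_ring R\<^esub> n \<ominus>\<^bsub>poly_ring R\<^esub> \<one>\<^bsub>poly_ring R\<^esub>"
      and len: "length f - 1 = d"
      by (auto simp: factor_def)
    define F where "F = Poly (rev f)"
    define G where "G = Poly (rev g)"
    have cf: "rev (coeffs F) = f" if "f \<in> carrier (poly_ring R)" "F = Poly (rev f)" for f F
      using that car[of f] by (cases f) auto
    have F: "R.coeff f = Polynomial.coeff F" "R.coeff g = Polynomial.coeff G"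
      using coeff_rev_coeffs[of F] coeff_rev_coeffs[of G] cf[OF f F_def] cf[OF g G_def]
      by (auto simp: fun_eq_iff)
    have ne: "f \<noteq> []" using len d by auto
    have "length (coeffs F) = length f" using cf[OF f F_def] by (metis length_rev)
    moreover have F0: "F \<noteq> 0" using ne cf[OF f F_def] by auto
    ultimately have degF: "Polynomial.degree F = d" using len by (simp add: length_coeffs_degree)
    have "Polynomial.lead_coeff F = hd f"
      using ne F(1) R.lead_coeff_simp[OF ne] degF len by simp
    moreover have "hd f \<in> {0..int p - 1}" "hd f \<noteq> 0"
      using f ne car[of f] hd_in_set[OF ne] by (blast, auto)
    ultimately have lc: "\<not> int p dvd Polynomial.lead_coeff F"
      by (auto dest!: zdvd_imp_le)
    have "[:int p:] dvd F * G - unity_poly n"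
      using fg residue_polynomial_eq_iff[OF p, folded R_def, OF f g, of n]
      by (simp add: const_dvd_diff_iff_cong coeff_mult F)
    thus "?Q d" using degF lc by blast
  next
    assume "?Q d"
    then obtain F G where FG: "[:int p:] dvd F * G - unity_poly n" and dF: "Polynomial.degree F = d"
      and lc: "\<not> int p dvd Polynomial.lead_coeff F" by blast
    define red where "red = (\<lambda>F :: int poly. map_poly (\<lambda>c. c mod int p) F)"
    have cr: "Polynomial.coeff (red F) i = Polynomial.coeff F i mod int p" for F i
      by (simp add: red_def coeff_map_poly)
    define f where "f = rev (coeffs (red F))"
    define g where "g = rev (coeffs (red G))"
    have cc: "rev (coeffs (red F)) \<in> carrier (poly_ring R)" for F
    proof (cases "red F = 0")
      case False
      have "set (coeffs (red F)) \<subseteq> {0..int p - 1}"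
        using m_gt_one by (auto simp: coeffs_def cr)
      moreover have "hd (rev (coeffs (red F))) \<noteq> 0"
        using False by (simp add: hd_rev last_coeffs_eq_coeff_degree)
      ultimately show ?thesis by (simp add: car)
    qed (simp add: car)
    have "Polynomial.degree (red F) = d"
      using lc dF cr[of F] by (intro antisym degree_le le_degree)
        (auto simp: coeff_eq_0 dvd_eq_mod_eq_0)
    moreover have "red F \<noteq> 0" using lc cr[of F d] dF by (auto simp: dvd_eq_mod_eq_0)
    ultimately have "length f - 1 = d" by (simp add: f_def length_coeffs_degree)
    moreover have "f \<otimes>\<^bsub>poly_ring R\<^esub> g = X\<^bsub>R\<^esub> [^]\<^bsub>poly_ring R\<^esub> n \<ominus>\<^bsub>poly_ring R\<^esub> \<one>\<^bsub>poly_ring R\<^esub>"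
    proof (subst residue_polynomial_eq_iff[OF p, folded R_def], unfold f_def g_def, rule cc, rule cc, rule allI)
      fix i
      have "[(\<Sum>k\<le>i. Polynomial.coeff (red F) k * Polynomial.coeff (red G) (i - k)) =
             (\<Sum>k\<le>i. Polynomial.coeff F k * Polynomial.coeff G (i - k))] (mod int p)"
        by (intro cong_sum cong_mult) (auto simp: cr cong_def)
      also have "(\<Sum>k\<le>i. Polynomial.coeff F k * Polynomial.coeff G (i - k)) = Polynomial.coeff (F * G) i"
        by (simp add: coeff_mult)
      also have "[Polynomial.coeff (F * G) i = Polynomial.coeff (unity_poly n) i] (mod int p)"
        using FG by (simp add: const_dvd_diff_iff_cong)
      finally show "[(\<Sum>k\<le>i. R.coeff (rev (coeffs (red F))) k * R.coeff (rev (coeffs (red G))) (i - k)) =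
             Polynomial.coeff (unity_poly n) i] (mod int p)"
        by (simp add: coeff_rev_coeffs)
    qed
    ultimately show ?L
      using cc[of F] cc[of G] unfolding f_def[symmetric] g_def[symmetric] factor_def by metis
  qed
  show ?thesis
    unfolding p_practical_def Let_def R_def[symmetric] using eq by auto
qed

section \<open>Divisors of small degree\<close>

lemma unity_poly_dvd_mult: "(unity_poly a :: 'a :: comm_ring_1 poly) dvd unity_poly (a * k)"
proof -
  have "Polynomial.monom (1 :: 'a) (a * k) = Polynomial.monom 1 a ^ k"
    by (simp add: monom_power)
  thus ?thesis using power_diff_1_eq[of "Polynomial.monom (1 :: 'a) a" k] by simp
qed

lemma dvd_unity_poly_gcd:
  fixes q :: "'a :: comm_ring_1 poly"
  assumes a: "q dvd unity_poly a" and b: "q dvd unity_poly b" and "a > 0"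
  shows "q dvd unity_poly (gcd a b)"
proof -
  obtain x y where xy: "a * x = b * y + gcd a b"
    using bezout_nat[of a b] \<open>a > 0\<close> by auto
  have 1: "q dvd unity_poly (a * x)" using a unity_poly_dvd_mult dvd_trans by blast
  have 2: "q dvd unity_poly (b * y)" using b unity_poly_dvd_mult dvd_trans by blast
  have "unity_poly (a * x) = Polynomial.monom 1 (gcd a b) * (unity_poly (b * y) :: 'a poly) + unity_poly (gcd a b)"
    unfolding xy by (simp add: algebra_simps mult_monom)
  thus ?thesis
    using 1 2 by (metis dvd_add_right_iff dvd_mult)
qed

text \<open>q divides the derivative n x^(n-1), hence n x^n = n (x^n - 1) + n, hence n. This one
  form of separability serves both over the integers and over a prime field.\<close>

lemma square_dvd_unity_poly:
  fixes q :: "'a :: idom poly"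
  assumes "q * q dvd unity_poly n"
  shows "q dvd [:of_nat n:]"
proof (cases "n = 0")
  case False
  obtain h where h: "unity_poly n = q * q * h" using assms by (elim dvdE)
  have "Polynomial.monom (of_nat n) (n - 1) = pderiv (unity_poly n :: 'a poly)"
    by (simp add: pderiv_diff pderiv_monom)
  also have "\<dots> = q * (2 * pderiv q * h + q * pderiv h)"
    unfolding h by (simp add: pderiv_mult algebra_simps)
  finally have "q dvd Polynomial.monom (of_nat n) (n - 1)" by simp
  hence "q dvd Polynomial.monom 1 1 * Polynomial.monom (of_nat n) (n - 1)" by (rule dvd_mult)
  also have "Polynomial.monom 1 1 * Polynomial.monom (of_nat n) (n - 1) = (Polynomial.monom (of_nat n) n :: 'a poly)"
    using False by (simp add: mult_monom)
  also have "\<dots> = [:of_nat n:] * unity_poly n + [:of_nat n:]"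
    by (simp add: algebra_simps smult_monom)
  finally show ?thesis
    using assms by (metis dvd_add_right_iff dvd_mult dvd_mult_right h)
qed auto

text \<open>A prime factor q of f of degree e divides x^(p^e) - x but not x, so it divides x^g - 1
  with g = gcd(n, p^e - 1), and therefore x^c - 1. If the cofactor k of gcd(f, x^c - 1) in f were
  not a unit, a prime factor of k would also divide that gcd, so its square would divide x^n - 1,
  which is separable as p does not divide n.\<close>

lemma dvd_unity_poly_small_degree:
  fixes f :: "'a :: prime_card mod_ring poly"
  assumes f: "f dvd unity_poly n" and n: "\<not> CARD('a) dvd n" and n0: "n > 0"
    and c: "\<And>e. 1 \<le> e \<Longrightarrow> e \<le> Polynomial.degree f \<Longrightarrow> gcd n (CARD('a) ^ e - 1) dvd c"
  shows "f dvd unity_poly c"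
proof -
  define h where "h = gcd f (unity_poly c)"
  obtain k where k: "f = h * k" using gcd_dvd1[of f "unity_poly c"] unfolding h_def by (elim dvdE)
  have un0: "(unity_poly n :: 'a mod_ring poly) \<noteq> 0"
  proof
    assume "(unity_poly n :: 'a mod_ring poly) = 0"
    hence "Polynomial.coeff (unity_poly n :: 'a mod_ring poly) n = 0" by simp
    thus False using n0 by simp
  qed
  have f0: "f \<noteq> 0" using f un0 by auto
  have "is_unit k"
  proof (rule ccontr)
    assume "\<not> is_unit k"
    then obtain q where q: "q dvd k" "prime q" using prime_divisor_exists[of k] f0 k by auto
    have qf: "q dvd f" using q k by simp
    have irr: "irreducible q" using prime_elem_imp_irreducible[OF prime_imp_prime_elem[OF q(2)]] .
    have deg: "Polynomial.degree q \<le> Polynomial.degree f" using qf f0 by (rule dvd_imp_degree_le)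
    have deg1: "Polynomial.degree q \<ge> 1"
    proof (rule ccontr)
      assume "\<not> Polynomial.degree q \<ge> 1"
      hence "Polynomial.degree q = 0" by simp
      then obtain a where a: "q = [:a:]" by (rule degree_eq_zeroE)
      have "q \<noteq> 0" using q(2) by auto
      hence "is_unit q" using a by (simp add: is_unit_const_poly_iff dvd_field_iff)
      thus False using q(2) not_prime_unit by blast
    qed
    define e where "e = Polynomial.degree q"
    have qn: "q dvd unity_poly n" using qf f dvd_trans by blast
    have "q dvd Polynomial.monom 1 1 ^ (CARD('a) ^ e) - Polynomial.monom 1 1"
      using degree_divisor1[OF irr] by (simp add: e_def)
    also have "Polynomial.monom 1 1 ^ (CARD('a) ^ e) - Polynomial.monom 1 1
        = Polynomial.monom (1 :: 'a mod_ring) 1 * unity_poly (CARD('a) ^ e - 1)"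
      by (simp add: monom_power algebra_simps mult_monom)
    finally have "q dvd Polynomial.monom (1 :: 'a mod_ring) 1 \<or> q dvd unity_poly (CARD('a) ^ e - 1)"
      using q(2) prime_dvd_mult_iff by blast
    moreover have "\<not> q dvd Polynomial.monom (1 :: 'a mod_ring) 1"
    proof
      assume "q dvd Polynomial.monom (1 :: 'a mod_ring) 1"
      hence "q dvd Polynomial.monom (1 :: 'a mod_ring) 1 ^ n" using n0 by (simp add: dvd_power_le dvd_trans)
      hence "q dvd Polynomial.monom (1 :: 'a mod_ring) n" by (simp add: monom_power)
      from dvd_diff[OF this qn] have "q dvd 1" by simp
      thus False using q(2) not_prime_unit by blast
    qed
    ultimately have "q dvd unity_poly (CARD('a) ^ e - 1)" by blast
    hence "q dvd unity_poly (gcd n (CARD('a) ^ e - 1))"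
      using qn n0 by (intro dvd_unity_poly_gcd)
    moreover have "gcd n (CARD('a) ^ e - 1) dvd c" using c deg deg1 by (simp add: e_def)
    ultimately have "q dvd unity_poly c"
      by (metis dvd_trans dvdE unity_poly_dvd_mult)
    hence "q dvd h" using qf by (simp add: h_def)
    hence "q * q dvd f" unfolding k using q(1) by (rule mult_dvd_mono)
    hence "q * q dvd unity_poly n" using f dvd_trans by blast
    hence "q dvd [:of_nat n:]" by (rule square_dvd_unity_poly)
    moreover have "of_nat n \<noteq> (0 :: 'a mod_ring)" using n of_nat_0_mod_ring_dvd by blast
    ultimately have "is_unit q"
      by (metis dvd_trans is_unit_const_poly_iff dvd_field_iff)
    thus False using q(2) not_prime_unit by blast
  qed
  hence "f dvd h" unfolding k by simp
  thus ?thesis by (simp add: h_def)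
qed

lemma of_int_mod_ring_eq_0_iff: "(of_int x :: 'a :: prime_card mod_ring) = 0 \<longleftrightarrow> int CARD('a) dvd x"
proof -
  have "(of_int x :: 'a mod_ring) = 0 \<longleftrightarrow> x mod int CARD('a) = 0"
    unfolding of_int_of_int_mod_ring by (transfer, simp)
  thus ?thesis by (simp add: dvd_eq_mod_eq_0)
qed

text \<open>A divisor of degree c + 1 would have to divide x^c - 1. The prime enters as the
  cardinality of a type because the finite field is \<open>mod_ring\<close> over that type.\<close>

lemma not_p_practical:
  fixes n c :: nat
  assumes n: "\<not> CARD('a :: prime_card) dvd n" and cn: "c < n" "0 < c"
    and c: "\<And>e. 1 \<le> e \<Longrightarrow> e \<le> c + 1 \<Longrightarrow> gcd n (CARD('a) ^ e - 1) dvd c"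
  shows "\<not> p_practical (CARD('a)) n"
proof
  assume "p_practical (CARD('a)) n"
  then obtain f g :: "int poly" where fg: "[:int CARD('a):] dvd f * g - unity_poly n"
    and deg: "Polynomial.degree f = c + 1" and lc: "\<not> int CARD('a) dvd Polynomial.lead_coeff f"
    using p_practical_iff_int_poly[OF prime_card[where ?'a = 'a], of n] bspec[of "{1..n}" _ "c + 1"] cn
    by (metis One_nat_def Suc_leI add.commute atLeastAtMost_iff le_add1 plus_1_eq_Suc)
  interpret of_int_poly_hom: map_poly_comm_ring_hom "of_int :: int \<Rightarrow> 'a mod_ring" ..
  define F :: "'a mod_ring poly" where "F = map_poly of_int f"
  define G :: "'a mod_ring poly" where "G = map_poly of_int g"
  obtain h where h: "f * g = [:int CARD('a):] * h + unity_poly n"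
    using fg by (metis diff_eq_eq dvdE)
  have p0: "of_int (int CARD('a)) = (0 :: 'a mod_ring)"
    by (subst of_int_mod_ring_eq_0_iff) simp
  have "F * G = map_poly of_int (f * g)" by (simp add: F_def G_def of_int_poly_hom.hom_mult)
  also have "\<dots> = unity_poly n"
    unfolding h of_int_poly_hom.hom_add of_int_poly_hom.hom_mult of_int_poly_hom.hom_minus using p0 by (simp add: map_poly_monom of_int_poly_hom.hom_minus)
  finally have "F dvd unity_poly n" by (metis dvd_triv_left)
  moreover have dF: "Polynomial.degree F = c + 1"
    unfolding F_def deg[symmetric] using lc
    by (intro antisym degree_map_poly_le le_degree) (simp add: coeff_map_poly of_int_mod_ring_eq_0_iff)
  moreover have "0 < n" using cn by linarith
  moreover have "gcd n (CARD('a) ^ e - 1) dvd c" if "1 \<le> e" "e \<le> Polynomial.degree F" for e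
    using that(2) unfolding dF by (rule c[OF that(1)])
  ultimately have "F dvd unity_poly c"
    using dvd_unity_poly_small_degree[OF _ n] by blast
  moreover have "unity_poly c \<noteq> (0 :: 'a mod_ring poly)"
  proof
    assume "(unity_poly c :: 'a mod_ring poly) = 0"
    hence "Polynomial.coeff (unity_poly c :: 'a mod_ring poly) c = 0" by simp
    thus False using cn by simp
  qed
  ultimately have "Polynomial.degree F \<le> Polynomial.degree (unity_poly c :: 'a mod_ring poly)"
    by (rule dvd_imp_degree_le)
  also have "\<dots> \<le> c" by (intro degree_diff_le) (auto simp: degree_monom_le)
  finally show False using dF by simp
qed

text \<open>A type of cardinality 17, so that F_17 becomes an instance of \<open>mod_ring\<close>;
  for F_2 the type \<open>bool\<close> serves.\<close>

typedef residue17 = "{..<17 :: nat}" by (auto intro: exI[of _ 0])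

lemma card_residue17: "CARD(residue17) = 17"
  using type_definition.card[OF type_definition_residue17] by simp

instance residue17 :: prime_card
  by standard (simp add: card_residue17)

section \<open>Cyclotomic polynomials and attainable degrees\<close>

text \<open>The division is exact by \<open>prod_cyclotomic\<close>, so these are the usual
  cyclotomic polynomials. Degree and leading coefficient then follow from the product formula,
  without complex roots of unity; irreducibility is nowhere at issue.\<close>

fun cyclotomic :: "nat \<Rightarrow> int poly" where
  "cyclotomic n = unity_poly n div (\<Prod>d\<in>{d. d dvd n \<and> d < n}. cyclotomic d)"

declare cyclotomic.simps [simp del]

lemma degree_unity_poly: "n > 0 \<Longrightarrow> Polynomial.degree (unity_poly n :: int poly) = n"
  by (intro antisym degree_diff_le le_degree) (auto simp: degree_monom_le)

lemma lead_coeff_unity_poly: "n > 0 \<Longrightarrow> Polynomial.lead_coeff (unity_poly n :: int poly) = 1"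
  by (simp add: degree_unity_poly)

text \<open>By strong induction it suffices that the factors for proper divisors are pairwise
  coprime. A common prime factor q of those for d and e divides x^g - 1 with g = gcd(d, e), which is
  a proper divisor of d, say. Then q divides both factors in a splitting of x^d - 1, so its square
  divides x^d - 1.\<close>

lemma prod_cyclotomic: "n > 0 \<Longrightarrow> (\<Prod>d | d dvd n. cyclotomic d) = unity_poly n"
proof (induction n rule: less_induct)
  case (less n)
  define D where "D = {d. d dvd n \<and> d < n}"
  have fin: "finite D" by (simp add: D_def)
  have no_common: False
    if d: "d \<in> D" and g: "g dvd d" "g < d" and q: "prime q" "q dvd cyclotomic d" "q dvd unity_poly g" for d g q
  proof -
    have d0: "d > 0" using g by simp
    hence g0: "g > 0" using g by (auto intro: Nat.gr0I)
    have "unity_poly d = (\<Prod>x | x dvd d. cyclotomic x)"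
      using less d d0 by (auto simp: D_def)
    also have "{x. x dvd d} = insert d {x. x dvd d \<and> x \<noteq> d}" by auto
    also have "(\<Prod>x\<in>\<dots>. cyclotomic x) = cyclotomic d * (\<Prod>x | x dvd d \<and> x \<noteq> d. cyclotomic x)"
      using d0 by (subst prod.insert) auto
    finally have 1: "unity_poly d = cyclotomic d * (\<Prod>x | x dvd d \<and> x \<noteq> d. cyclotomic x)" .
    have "unity_poly g = (\<Prod>x | x dvd g. cyclotomic x)"
      using less d g g0 by (auto simp: D_def)
    also have "\<dots> dvd (\<Prod>x | x dvd d \<and> x \<noteq> d. cyclotomic x)"
      using d0 g g0 by (intro prod_dvd_prod_subset) (auto dest: dvd_imp_le)
    finally have "q * q dvd unity_poly d"
      unfolding 1 using q by (intro mult_dvd_mono) (auto intro: dvd_trans)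
    hence "q dvd [:of_nat d:]" by (rule square_dvd_unity_poly)
    hence "Polynomial.degree q \<le> Polynomial.degree [:of_nat d :: int:]"
      using d0 by (intro dvd_imp_degree_le) auto
    then obtain c where c: "q = [:c:]" by (auto elim: degree_eq_zeroE)
    \<comment> \<open>Over the integers q could still be a constant prime dividing d; this is
      excluded because x^d - 1 is monic.\<close>
    have "q dvd unity_poly d" unfolding 1 using q by simp
    hence "c dvd Polynomial.coeff (unity_poly d) d" unfolding c const_poly_dvd_iff by blast
    hence "is_unit c" using d0 by simp
    hence "is_unit q" by (simp add: c is_unit_const_poly_iff)
    thus False using q(1) not_prime_unit by blast
  qed
  have cop: "Rings.coprime (cyclotomic d) (cyclotomic e)" if de: "d \<in> D" "e \<in> D" "d \<noteq> e" for d e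
  proof (rule ccontr)
    assume nc: "\<not> Rings.coprime (cyclotomic d) (cyclotomic e)"
    have dvd: "cyclotomic x dvd unity_poly x" and pos: "x > 0" if "x \<in> D" for x
    proof -
      show x0: "x > 0" using that less.prems by (auto simp: D_def intro: Nat.gr0I)
      have "unity_poly x = (\<Prod>d | d dvd x. cyclotomic d)" using less that x0 by (auto simp: D_def)
      thus "cyclotomic x dvd unity_poly x" using x0 by (simp add: dvd_prodI)
    qed
    have "(unity_poly d :: int poly) \<noteq> 0"
      using lead_coeff_unity_poly[OF pos[OF de(1)]] by (metis leading_coeff_0_iff zero_neq_one)
    hence "cyclotomic d \<noteq> 0" using dvd[OF de(1)] by (metis dvd_0_left)
    hence "gcd (cyclotomic d) (cyclotomic e) \<noteq> 0" by simp
    moreover have "\<not> is_unit (gcd (cyclotomic d) (cyclotomic e))"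
      using nc is_unit_gcd by blast
    ultimately obtain q where q: "prime q" "q dvd gcd (cyclotomic d) (cyclotomic e)"
      using prime_divisor_exists by blast
    hence qd: "q dvd cyclotomic d" "q dvd cyclotomic e" by auto
    hence qg: "q dvd unity_poly (gcd d e)"
      using dvd[OF de(1)] dvd[OF de(2)] pos[OF de(1)]
      by (intro dvd_unity_poly_gcd) (auto intro: dvd_trans)
    show False
    proof (cases "gcd d e < d")
      case True
      thus False using no_common[OF de(1) _ _ q(1) qd(1) qg] by simp
    next
      case False
      hence "gcd d e = d" using pos[OF de(1)] by (metis gcd_le1_nat le_neq_implies_less neq0_conv)
      hence "gcd d e < e" using de(3) pos[OF de(2)]
        by (metis gcd_le2_nat le_neq_implies_less neq0_conv)
      thus False using no_common[OF de(2) _ _ q(1) qd(2) qg] by simp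
    qed
  qed
  have "(\<Prod>d\<in>D. cyclotomic d) dvd unity_poly n"
  proof (rule prod_dvd_pairwise_coprime[OF fin cop])
    fix d assume d: "d \<in> D"
    have d0: "d > 0" using d less.prems by (auto simp: D_def intro: Nat.gr0I)
    have "cyclotomic d dvd (\<Prod>x | x dvd d. cyclotomic x)" using d0 by (simp add: dvd_prodI)
    also have "\<dots> = unity_poly d" using less d d0 by (auto simp: D_def)
    also have "\<dots> dvd unity_poly n" using d unity_poly_dvd_mult by (auto simp: D_def elim!: dvdE)
    finally show "cyclotomic d dvd unity_poly n" .
  qed
  hence "cyclotomic n * (\<Prod>d\<in>D. cyclotomic d) = unity_poly n"
    by (subst cyclotomic.simps) (simp add: D_def)
  moreover have "{d. d dvd n} = insert n D" using less.prems by (auto simp: D_def dest: dvd_imp_le)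
  moreover have "n \<notin> D" by (simp add: D_def)
  ultimately show ?case using fin by simp
qed

lemma lead_coeff_cyclotomic: "n > 0 \<Longrightarrow> Polynomial.lead_coeff (cyclotomic n) = 1"
proof (induction n rule: less_induct)
  case (less n)
  define D where "D = {d. d dvd n \<and> d < n}"
  have "{d. d dvd n} = insert n D" using less.prems by (auto simp: D_def dest: dvd_imp_le)
  hence "unity_poly n = cyclotomic n * (\<Prod>d\<in>D. cyclotomic d)"
    using prod_cyclotomic[OF less.prems] by (simp add: D_def)
  hence "1 = Polynomial.lead_coeff (cyclotomic n) * (\<Prod>d\<in>D. Polynomial.lead_coeff (cyclotomic d))"
    using lead_coeff_unity_poly[OF less.prems] by (metis lead_coeff_mult lead_coeff_prod)
  also have "(\<Prod>d\<in>D. Polynomial.lead_coeff (cyclotomic d)) = 1"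
    using less by (intro prod.neutral) (auto simp: D_def intro: Nat.gr0I)
  finally show ?case by simp
qed

lemma cyclotomic_nonzero: "n > 0 \<Longrightarrow> cyclotomic n \<noteq> 0"
  using lead_coeff_cyclotomic[of n] by auto

lemma degree_cyclotomic: "n > 0 \<Longrightarrow> Polynomial.degree (cyclotomic n) = totient n"
proof (induction n rule: less_induct)
  case (less n)
  define D where "D = {d. d dvd n \<and> d < n}"
  have div: "{d. d dvd n} = insert n D" using less.prems by (auto simp: D_def dest: dvd_imp_le)
  have fin: "finite D" and nD: "n \<notin> D" by (auto simp: D_def)
  have pos: "d > 0" if "d dvd n" for d using that less.prems by (auto intro: Nat.gr0I)
  have "n = Polynomial.degree (\<Prod>d | d dvd n. cyclotomic d)"
    using less.prems by (simp add: prod_cyclotomic degree_unity_poly)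
  also have "\<dots> = (\<Sum>d | d dvd n. Polynomial.degree (cyclotomic d))"
    using pos cyclotomic_nonzero by (intro degree_prod_eq_sum_degree) auto
  also have "\<dots> = Polynomial.degree (cyclotomic n) + (\<Sum>d\<in>D. Polynomial.degree (cyclotomic d))"
    unfolding div using fin nD by simp
  also have "(\<Sum>d\<in>D. Polynomial.degree (cyclotomic d)) = (\<Sum>d\<in>D. totient d)"
    using less pos by (intro sum.cong) (auto simp: D_def)
  finally have "n = Polynomial.degree (cyclotomic n) + (\<Sum>d\<in>D. totient d)" .
  moreover have "n = totient n + (\<Sum>d\<in>D. totient d)"
    using totient_divisor_sum[of n] fin nD unfolding div by simp
  ultimately show ?case by linarith
qed

section \<open>Congruences modulo a prime and attainable degrees\<close>

definition poly_cong :: "nat \<Rightarrow> int poly \<Rightarrow> int poly \<Rightarrow> bool" where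
  "poly_cong l f g \<longleftrightarrow> [:int l:] dvd f - g"

lemma poly_cong_refl [simp]: "poly_cong l f f"
  by (simp add: poly_cong_def)

lemma poly_cong_trans [trans]: "poly_cong l f g \<Longrightarrow> poly_cong l g h \<Longrightarrow> poly_cong l f h"
  unfolding poly_cong_def by (drule (1) dvd_add) (simp only: diff_add_cancel add_diff_eq)

lemma poly_cong_mult: "poly_cong l f g \<Longrightarrow> poly_cong l f' g' \<Longrightarrow> poly_cong l (f * f') (g * g')"
proof -
  assume "poly_cong l f g" "poly_cong l f' g'"
  hence "[:int l:] dvd (f - g) * f' + g * (f' - g')"
    unfolding poly_cong_def by (intro dvd_add dvd_mult dvd_mult2)
  thus ?thesis by (simp add: poly_cong_def algebra_simps)
qed

lemma poly_cong_power: "poly_cong l f g \<Longrightarrow> poly_cong l (f ^ n) (g ^ n)"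
  by (induction n) (simp_all add: poly_cong_mult)

lemma poly_cong_sym: "poly_cong l f g \<Longrightarrow> poly_cong l g f"
  unfolding poly_cong_def by (drule iffD2[OF dvd_minus_iff]) (simp only: minus_diff_eq)

lemma poly_cong_minus_one_power:
  assumes l: "prime l"
  shows "poly_cong l ((f - 1) ^ l) (f ^ l - 1)"
proof -
  have l1: "l > 1" using l prime_gt_1_nat by simp
  have mid: "[:int l:] dvd of_nat (l choose k) * f ^ k * (- 1) ^ (l - k)" if "0 < k" "k < l" for k
  proof -
    have "l dvd l choose k" using l that by (intro dvd_choose_prime) auto
    hence "int l dvd int (l choose k)" by simp
    hence "[:int l:] dvd [:int (l choose k):]" by (simp add: const_poly_dvd)
    also have "[:int (l choose k):] = of_nat (l choose k)" by (simp add: of_nat_poly)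
    finally show ?thesis by simp
  qed
  have "(f - 1) ^ l = (\<Sum>k\<le>l. of_nat (l choose k) * f ^ k * (- 1) ^ (l - k))"
    using binomial_ring[of f "-1" l] by simp
  also have "{..l} = insert 0 (insert l {0<..<l})" using l1 by auto
  also have "(\<Sum>k\<in>\<dots>. of_nat (l choose k) * f ^ k * (- 1) ^ (l - k)) =
      (- 1) ^ l + f ^ l + (\<Sum>k\<in>{0<..<l}. of_nat (l choose k) * f ^ k * (- 1) ^ (l - k))"
    using l1 by simp
  finally have eq: "(f - 1) ^ l - (f ^ l - 1) =
      ((- 1) ^ l + 1) + (\<Sum>k\<in>{0<..<l}. of_nat (l choose k) * f ^ k * (- 1) ^ (l - k))"
    by simp
  have 1: "[:int l:] dvd (\<Sum>k\<in>{0<..<l}. of_nat (l choose k) * f ^ k * (- 1) ^ (l - k))"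
    using mid by (intro dvd_sum) auto
  \<comment> \<open>The sign of the constant term is right for odd l, and for l = 2 because 1 and -1
    agree modulo 2.\<close>
  have 2: "[:int l:] dvd (- 1) ^ l + 1"
  proof (cases "l = 2")
    case True
    thus ?thesis by (simp add: numeral_poly)
  next
    case False
    hence "odd l" using l prime_odd_nat l1 by (metis One_nat_def Suc_1 Suc_lessI)
    thus ?thesis by simp
  qed
  show ?thesis unfolding poly_cong_def eq by (rule dvd_add[OF 2 1])
qed

lemma unity_poly_power_cong:
  assumes l: "prime l"
  shows "poly_cong l (unity_poly n ^ (l ^ k)) (unity_poly (l ^ k * n))"
proof (induction k)
  case (Suc k)
  have "unity_poly n ^ (l ^ Suc k) = ((unity_poly n ^ (l ^ k)) ^ l :: int poly)"
    by (simp only: power_Suc2 power_mult)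
  also have "poly_cong l \<dots> (unity_poly (l ^ k * n) ^ l)"
    by (rule poly_cong_power[OF Suc])
  also have "poly_cong l \<dots> (Polynomial.monom 1 (l ^ k * n) ^ l - 1)"
    by (rule poly_cong_minus_one_power[OF l])
  also have "\<dots> = unity_poly (l ^ Suc k * n)"
    by (simp add: monom_power algebra_simps)
  finally show ?case .
qed simp

text \<open>These are the degrees of the products of cyclotomic polynomials dividing (x^a - 1)^M
  over the integers. For M a power of l, this power is congruent to x^(M a) - 1 modulo l.\<close>

definition cyc_degrees :: "nat \<Rightarrow> nat \<Rightarrow> nat set" where
  "cyc_degrees M a = {(\<Sum>d | d dvd a. c d * totient d) | c. \<forall>d. c d \<le> M}"

text \<open>The defect of 1 is forced by the base 28: the available degrees i + 6k with i, k <= 4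
  miss the residue 5 modulo 6. The second summand in the extension step absorbs it.\<close>

definition nearly_covers :: "nat set \<Rightarrow> nat \<Rightarrow> bool" where
  "nearly_covers S N \<longleftrightarrow> (\<forall>m\<le>N. \<exists>A\<in>S. A \<le> m \<and> m \<le> A + 1)"

definition has_all_degrees :: "nat \<Rightarrow> nat \<Rightarrow> bool" where
  "has_all_degrees l n \<longleftrightarrow> (\<forall>m\<le>n. \<exists>f g. poly_cong l (f * g) (unity_poly n) \<and>
     Polynomial.degree f = m \<and> Polynomial.lead_coeff f = 1)"

lemma has_all_degrees_imp_p_practical:
  assumes "prime l" "n > 0" "has_all_degrees l n"
  shows "p_practical l n"
proof -
  have "\<not> int l dvd 1" using prime_gt_1_nat[OF assms(1)] by simp
  thus ?thesis
    using assms unfolding p_practical_iff_int_poly[OF assms(1)] has_all_degrees_def poly_cong_def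
    by (metis atLeastAtMost_iff)
qed

section \<open>Extension by a prime power\<close>

lemma max_mem_cyc_degrees: "M * b \<in> cyc_degrees M b"
proof -
  have "M * b = (\<Sum>d | d dvd b. M * totient d)"
    by (simp add: sum_distrib_left[symmetric] totient_divisor_sum)
  thus ?thesis unfolding cyc_degrees_def by (intro CollectI exI[of _ "\<lambda>_. M"]) auto
qed

text \<open>Below K F the quotient m div F is A or A + 1 for some A in S, so the remainder m - A F
  is below 2 F <= N. From K F on, A = K leaves at most N.\<close>

lemma quotient_remainder_choice:
  fixes K F N m :: nat
  assumes S: "nearly_covers S K" "K \<in> S" and F: "2 * F \<le> N" "F > 0" and m: "m \<le> K * F + N"
  obtains A where "A \<in> S" "A * F \<le> m" "m - A * F \<le> N"
proof (cases "K * F \<le> m")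
  case True
  thus ?thesis using that[of K] S m by auto
next
  case False
  hence lt: "m div F < K" using F by (simp add: div_less_iff_less_mult)
  then obtain A where A: "A \<in> S" "A \<le> m div F" "m div F \<le> A + 1"
    using S unfolding nearly_covers_def by (meson less_imp_le)
  have 1: "A * F \<le> m" using A(2) F by (metis div_times_less_eq_dividend le_trans mult_le_mono1)
  have "m < (m div F + 1) * F" using F by (metis Suc_eq_plus1 dividend_less_div_times mult.commute mult_Suc_right add.commute)
  also have "\<dots> \<le> (A + 2) * F" using A(3) by (intro mult_le_mono1) simp
  finally have "m - A * F \<le> N" using F by (simp add: algebra_simps)
  thus ?thesis using that A(1) 1 by blast
qed

lemma divisors_prime_power_Suc:
  fixes b q :: nat
  assumes q: "prime q" "\<not> q dvd b" and b: "b > 0"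
  shows "{d. d dvd b * q ^ Suc e} = {d. d dvd b * q ^ e} \<union> (\<lambda>d. d * q ^ Suc e) ` {d. d dvd b}"
    and "{d. d dvd b * q ^ e} \<inter> (\<lambda>d. d * q ^ Suc e) ` {d. d dvd b} = {}"
    and "inj_on (\<lambda>d. d * q ^ Suc e) {d. d dvd b}"
proof -
  have q0: "q > 0" using q prime_gt_0_nat by blast
  show "inj_on (\<lambda>d. d * q ^ Suc e) {d. d dvd b}" using q0 by (auto simp: inj_on_def)
  have nd: "\<not> q ^ Suc e dvd b * q ^ e"
  proof
    assume "q ^ Suc e dvd b * q ^ e"
    hence "q * q ^ e dvd b * q ^ e" by simp
    hence "q dvd b" using dvd_times_right_cancel_iff[of "q ^ e" q b] q0 by simp
    thus False using q by simp
  qed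
  show "{d. d dvd b * q ^ e} \<inter> (\<lambda>d. d * q ^ Suc e) ` {d. d dvd b} = {}"
  proof (rule ccontr)
    assume "{d. d dvd b * q ^ e} \<inter> (\<lambda>d. d * q ^ Suc e) ` {d. d dvd b} \<noteq> {}"
    then obtain d where "d * q ^ Suc e dvd b * q ^ e" by blast
    thus False using nd dvd_mult_right by blast
  qed
  show "{d. d dvd b * q ^ Suc e} = {d. d dvd b * q ^ e} \<union> (\<lambda>d. d * q ^ Suc e) ` {d. d dvd b}"
  proof (intro equalityI subsetI)
    fix d assume "d \<in> {d. d dvd b * q ^ Suc e}"
    hence "d dvd b * q ^ Suc e" by simp
    then obtain x y where xy: "d = x * y" "x dvd b" "y dvd q ^ Suc e" by (rule dvd_productE)
    obtain i where i: "y = q ^ i" "i \<le> Suc e" using divides_primepow_nat[OF q(1)] xy(3) by blast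
    show "d \<in> {d. d dvd b * q ^ e} \<union> (\<lambda>d. d * q ^ Suc e) ` {d. d dvd b}"
    proof (cases "i \<le> e")
      case True
      thus ?thesis using xy i by (auto intro!: mult_dvd_mono le_imp_power_dvd)
    next
      case False
      hence "i = Suc e" using i by simp
      thus ?thesis using xy i by auto
    qed
  next
    fix d assume "d \<in> {d. d dvd b * q ^ e} \<union> (\<lambda>d. d * q ^ Suc e) ` {d. d dvd b}"
    moreover have "b * q ^ e dvd b * q ^ Suc e" by (simp add: mult_dvd_mono)
    moreover have "x * q ^ Suc e dvd b * q ^ Suc e" if "x dvd b" for x
      using that by (rule mult_dvd_mono) simp
    ultimately show "d \<in> {d. d dvd b * q ^ Suc e}" using dvd_trans by blast
  qed
qed

lemma totient_mult_prime_power: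
  fixes d q :: nat
  assumes "prime q" "\<not> q dvd b" "d dvd b"
  shows "totient (d * q ^ Suc e) = totient d * (q ^ e * (q - 1))"
proof -
  have "\<not> q dvd d" using assms dvd_trans by blast
  hence "Rings.coprime d (q ^ Suc e)"
    using Factorial_Ring.prime_imp_coprime[OF assms(1)] by (simp add: ac_simps)
  hence "totient (d * q ^ Suc e) = totient d * totient (q ^ Suc e)" by (rule totient_mult_coprime)
  also have "totient (q ^ Suc e) = q ^ e * (q - 1)" by (rule totient_prime_power_Suc[OF assms(1)])
  finally show ?thesis .
qed

text \<open>The divisors of b q^(e+1) that do not divide b q^e are d q^(e+1) with d dividing b, and
  their totients are those of d times q^e (q - 1). The multiplicities on these new divisors encode
  A, those on the old ones B.\<close>

lemma cyc_degrees_mult: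
  assumes q: "prime q" "\<not> q dvd b" and b: "b > 0"
    and A: "A \<in> cyc_degrees M b" and B: "B \<in> cyc_degrees M (b * q ^ e)"
  shows "A * (q ^ e * (q - 1)) + B \<in> cyc_degrees M (b * q ^ Suc e)"
proof -
  obtain cA where cA: "A = (\<Sum>d | d dvd b. cA d * totient d)" "\<And>d. cA d \<le> M"
    using A by (auto simp: cyc_degrees_def)
  obtain cB where cB: "B = (\<Sum>d | d dvd b * q ^ e. cB d * totient d)" "\<And>d. cB d \<le> M"
    using B by (auto simp: cyc_degrees_def)
  have q0: "q > 0" using q prime_gt_0_nat by blast
  define c where "c = (\<lambda>d. if d dvd b * q ^ e then cB d else cA (d div q ^ Suc e))"
  note D = divisors_prime_power_Suc[OF q b, of e]
  have fin: "finite {d. d dvd b * q ^ e}" "finite {d. d dvd b}" using b q0 by auto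
  have "(\<Sum>d | d dvd b * q ^ Suc e. c d * totient d) = (\<Sum>d | d dvd b * q ^ e. c d * totient d) +
      (\<Sum>d\<in>(\<lambda>d. d * q ^ Suc e) ` {d. d dvd b}. c d * totient d)"
    unfolding D(1) using fin D(2) by (intro sum.union_disjoint) auto
  also have "(\<Sum>d | d dvd b * q ^ e. c d * totient d) = B"
    unfolding cB by (intro sum.cong) (auto simp: c_def)
  also have "(\<Sum>d\<in>(\<lambda>d. d * q ^ Suc e) ` {d. d dvd b}. c d * totient d) =
      (\<Sum>d | d dvd b. c (d * q ^ Suc e) * totient (d * q ^ Suc e))"
    by (subst sum.reindex[OF D(3)]) simp
  also have "\<dots> = (\<Sum>d | d dvd b. cA d * totient d * (q ^ e * (q - 1)))"
  proof (intro sum.cong refl)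
    fix d assume d: "d \<in> {d. d dvd b}"
    hence "\<not> d * q ^ Suc e dvd b * q ^ e" using D(2) by blast
    hence "c (d * q ^ Suc e) = cA d" using q0 by (simp add: c_def)
    thus "c (d * q ^ Suc e) * totient (d * q ^ Suc e) = cA d * totient d * (q ^ e * (q - 1))"
      using totient_mult_prime_power[OF q, of d e] d by simp
  qed
  also have "\<dots> = A * (q ^ e * (q - 1))" unfolding cA by (simp add: sum_distrib_right)
  finally have "(\<Sum>d | d dvd b * q ^ Suc e. c d * totient d) = A * (q ^ e * (q - 1)) + B" by simp
  moreover have "c d \<le> M" for d using cA cB by (simp add: c_def)
  ultimately show ?thesis unfolding cyc_degrees_def by (intro CollectI exI[of _ c]) auto
qed

lemma prime_power_degree_bounds:
  fixes b q M e :: nat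
  assumes "prime q" and "2 * (q - 1) \<le> M * b"
  shows "2 * (q ^ e * (q - 1)) \<le> M * (b * q ^ e)" "0 < q ^ e * (q - 1)"
    "M * (b * q ^ Suc e) = M * b * (q ^ e * (q - 1)) + M * (b * q ^ e)"
proof -
  have q: "q > 1" using assms prime_gt_1_nat by blast
  show "0 < q ^ e * (q - 1)" using q by simp
  have "q ^ e * (2 * (q - 1)) \<le> q ^ e * (M * b)" using assms by (intro mult_le_mono2)
  thus "2 * (q ^ e * (q - 1)) \<le> M * (b * q ^ e)" by (simp add: algebra_simps)
  obtain r where "q = Suc r" using q by (cases q) auto
  thus "M * (b * q ^ Suc e) = M * b * (q ^ e * (q - 1)) + M * (b * q ^ e)" by (simp add: algebra_simps)
qed

text \<open>A is chosen for the part b prime to q, and B for b q^e. New primes of a chain use e = 0;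
  general e builds up the powers of 11 in the base.\<close>

lemma nearly_covers_step:
  assumes q: "prime q" "\<not> q dvd b" and b: "b > 0" and le: "2 * (q - 1) \<le> M * b"
    and c1: "nearly_covers (cyc_degrees M b) (M * b)"
    and c2: "nearly_covers (cyc_degrees M (b * q ^ e)) (M * (b * q ^ e))"
  shows "nearly_covers (cyc_degrees M (b * q ^ Suc e)) (M * (b * q ^ Suc e))"
  unfolding nearly_covers_def
proof (intro allI impI)
  note pd = prime_power_degree_bounds[OF q(1) le, of e]
  fix m assume "m \<le> M * (b * q ^ Suc e)"
  hence m: "m \<le> M * b * (q ^ e * (q - 1)) + M * (b * q ^ e)" unfolding pd(3) .
  obtain A where A: "A \<in> cyc_degrees M b" "A * (q ^ e * (q - 1)) \<le> m" "m - A * (q ^ e * (q - 1)) \<le> M * (b * q ^ e)"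
    by (rule quotient_remainder_choice[OF c1 max_mem_cyc_degrees pd(1,2) m])
  obtain B where B: "B \<in> cyc_degrees M (b * q ^ e)" "B \<le> m - A * (q ^ e * (q - 1))" "m - A * (q ^ e * (q - 1)) \<le> B + 1"
    using c2 A(3) unfolding nearly_covers_def by blast
  have "A * (q ^ e * (q - 1)) + B \<in> cyc_degrees M (b * q ^ Suc e)"
    by (rule cyc_degrees_mult[OF q b A(1) B(1)])
  moreover have "A * (q ^ e * (q - 1)) + B \<le> m" "m \<le> A * (q ^ e * (q - 1)) + B + 1" using A B by linarith+
  ultimately show "\<exists>A\<in>cyc_degrees M (b * q ^ Suc e). A \<le> m \<and> m \<le> A + 1" by blast
qed

lemma unity_poly_prime_power_Suc:
  assumes q: "prime q" "\<not> q dvd b" and b: "b > 0"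
  shows "unity_poly (b * q ^ Suc e) = unity_poly (b * q ^ e) * (\<Prod>d | d dvd b. cyclotomic (d * q ^ Suc e))"
proof -
  have q0: "q > 0" using q prime_gt_0_nat by blast
  note D = divisors_prime_power_Suc[OF q b, of e]
  have fin: "finite {d. d dvd b * q ^ e}" "finite {d. d dvd b}" using b q0 by auto
  have "unity_poly (b * q ^ Suc e) = (\<Prod>d | d dvd b * q ^ Suc e. cyclotomic d)"
    by (rule prod_cyclotomic[symmetric]) (use b q0 in simp)
  also have "\<dots> = (\<Prod>d | d dvd b * q ^ e. cyclotomic d) * (\<Prod>d\<in>(\<lambda>d. d * q ^ Suc e) ` {d. d dvd b}. cyclotomic d)"
    unfolding D(1) using fin D(2) by (intro prod.union_disjoint) auto
  also have "(\<Prod>d | d dvd b * q ^ e. cyclotomic d) = unity_poly (b * q ^ e)"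
    by (rule prod_cyclotomic) (use b q0 in simp)
  also have "(\<Prod>d\<in>(\<lambda>d. d * q ^ Suc e) ` {d. d dvd b}. cyclotomic d) = (\<Prod>d | d dvd b. cyclotomic (d * q ^ Suc e))"
    by (subst prod.reindex[OF D(3)]) simp
  finally show ?thesis .
qed

text \<open>Only A has to be cyclotomic, since it is realised by replacing each d by d q^(e+1). The
  remainder is realised by an arbitrary divisor modulo l, so it can have any degree and no defect
  arises. Passing between (x^n - 1)^M and x^(M n) - 1 modulo l merges both factors.\<close>

lemma has_all_degrees_step:
  assumes l: "prime l" and M: "M = l ^ k"
    and q: "prime q" "\<not> q dvd b" and b: "b > 0" and le: "2 * (q - 1) \<le> M * b"
    and c1: "nearly_covers (cyc_degrees M b) (M * b)"
    and h: "has_all_degrees l (M * (b * q ^ e))"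
  shows "has_all_degrees l (M * (b * q ^ Suc e))"
  unfolding has_all_degrees_def
proof (intro allI impI)
  note pd = prime_power_degree_bounds[OF q(1) le, of e]
  have q0: "q > 0" using q prime_gt_0_nat by blast
  fix m assume "m \<le> M * (b * q ^ Suc e)"
  hence m: "m \<le> M * b * (q ^ e * (q - 1)) + M * (b * q ^ e)" unfolding pd(3) .
  obtain A where A: "A \<in> cyc_degrees M b" "A * (q ^ e * (q - 1)) \<le> m" "m - A * (q ^ e * (q - 1)) \<le> M * (b * q ^ e)"
    by (rule quotient_remainder_choice[OF c1 max_mem_cyc_degrees pd(1,2) m])
  obtain c where c: "A = (\<Sum>d | d dvd b. c d * totient d)" "\<And>d. c d \<le> M"
    using A(1) by (auto simp: cyc_degrees_def)
  obtain f g where fg: "poly_cong l (f * g) (unity_poly (M * (b * q ^ e)))"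
      "Polynomial.degree f = m - A * (q ^ e * (q - 1))" "Polynomial.lead_coeff f = 1"
    using h A(3) unfolding has_all_degrees_def by blast
  define C where "C = (\<lambda>d. cyclotomic (d * q ^ Suc e))"
  define f1 where "f1 = (\<Prod>d | d dvd b. C d ^ c d)"
  define g1 where "g1 = (\<Prod>d | d dvd b. C d ^ (M - c d))"
  have pos: "d * q ^ Suc e > 0" if "d dvd b" for d using that b q0 by (auto intro: Nat.gr0I)
  have lcC: "Polynomial.lead_coeff (C d) = 1" if "d dvd b" for d
    unfolding C_def by (rule lead_coeff_cyclotomic[OF pos[OF that]])
  have C0: "C d \<noteq> 0" if "d dvd b" for d using lcC[OF that] by auto
  have "f1 * g1 = (\<Prod>d | d dvd b. C d ^ c d * C d ^ (M - c d))"
    unfolding f1_def g1_def by (rule prod.distrib[symmetric])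
  also have "\<dots> = (\<Prod>d | d dvd b. C d ^ M)"
    using c(2) by (intro prod.cong refl) (simp add: power_add[symmetric])
  also have "\<dots> = (\<Prod>d | d dvd b. C d) ^ M" by (rule prod_power_distrib[symmetric])
  finally have f1g1: "f1 * g1 = (\<Prod>d | d dvd b. C d) ^ M" .
  have "poly_cong l (f * g * (f1 * g1)) (unity_poly (M * (b * q ^ e)) * (f1 * g1))"
    by (rule poly_cong_mult[OF fg(1) poly_cong_refl])
  also have "poly_cong l \<dots> (unity_poly (b * q ^ e) ^ M * (f1 * g1))"
    unfolding M by (rule poly_cong_mult[OF poly_cong_sym[OF unity_poly_power_cong[OF l]] poly_cong_refl])
  also have "\<dots> = unity_poly (b * q ^ Suc e) ^ M"
    unfolding f1g1 C_def unity_poly_prime_power_Suc[OF q b] by (rule power_mult_distrib[symmetric])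
  also have "poly_cong l \<dots> (unity_poly (M * (b * q ^ Suc e)))"
    unfolding M by (rule unity_poly_power_cong[OF l])
  finally have cong: "poly_cong l (f * f1 * (g * g1)) (unity_poly (M * (b * q ^ Suc e)))"
    by (simp add: mult_ac)
  have "Polynomial.degree f1 = (\<Sum>d | d dvd b. Polynomial.degree (C d ^ c d))"
    unfolding f1_def using C0 by (intro degree_prod_eq_sum_degree) auto
  also have "\<dots> = (\<Sum>d | d dvd b. c d * totient d * (q ^ e * (q - 1)))"
  proof (intro sum.cong refl)
    fix d assume "d \<in> {d. d dvd b}"
    hence d: "d dvd b" by simp
    have "Polynomial.degree (C d ^ c d) = c d * Polynomial.degree (C d)"
      using C0[OF d] by (rule Polynomial.degree_power_eq)
    also have "Polynomial.degree (C d) = totient (d * q ^ Suc e)"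
      unfolding C_def by (rule degree_cyclotomic[OF pos[OF d]])
    also have "\<dots> = totient d * (q ^ e * (q - 1))" by (rule totient_mult_prime_power[OF q d])
    finally show "Polynomial.degree (C d ^ c d) = c d * totient d * (q ^ e * (q - 1))" by simp
  qed
  also have "\<dots> = A * (q ^ e * (q - 1))" unfolding c by (rule sum_distrib_right[symmetric])
  finally have df1: "Polynomial.degree f1 = A * (q ^ e * (q - 1))" .
  have lf1: "Polynomial.lead_coeff f1 = 1"
    unfolding f1_def lead_coeff_prod using lcC by (intro prod.neutral) (auto simp: lead_coeff_power)
  have "f \<noteq> 0" "f1 \<noteq> 0" using fg(3) lf1 by auto
  hence "Polynomial.degree (f * f1) = m" using df1 fg(2) A(2) by (simp add: degree_mult_eq)
  moreover have "Polynomial.lead_coeff (f * f1) = 1" using fg(3) lf1 by (simp only: lead_coeff_mult mult_1)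
  ultimately show "\<exists>f g. poly_cong l (f * g) (unity_poly (M * (b * q ^ Suc e))) \<and>
      Polynomial.degree f = m \<and> Polynomial.lead_coeff f = 1" using cong by blast
qed

section \<open>Chains of primes\<close>

locale prime_chain =
  fixes t T :: nat
  assumes t_pos: "t \<ge> 1" and T_pos: "T \<ge> 1"
begin

definition primes_between :: "nat \<Rightarrow> nat set" where
  "primes_between Z = {p. prime p \<and> t < p \<and> p \<le> Z}"

text \<open>T plays the role of half the base: as soon as 2 T <= a, the bound on q yields the
  inequality required by the extension step.\<close>

definition dense :: "nat set \<Rightarrow> bool" where
  "dense S \<longleftrightarrow> finite S \<and> (\<forall>q\<in>S. prime q \<and> t < q \<and> q \<le> T * \<Prod>{p\<in>S. p < q})"

definition dense_upto :: "nat \<Rightarrow> nat set set" where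
  "dense_upto Z = {S. dense S \<and> S \<subseteq> {..Z}}"

lemma finite_primes_between [simp]: "finite (primes_between Z)"
  by (rule finite_subset[of _ "{..Z}"]) (auto simp: primes_between_def)

lemma finite_dense_upto [simp]: "finite (dense_upto Z)"
  by (rule finite_subset[of _ "Pow {..Z}"]) (auto simp: dense_upto_def)

lemma dense_prod_pos: "dense S \<Longrightarrow> \<Prod>S > 0"
  by (auto simp: dense_def intro!: prod_pos prime_gt_0_nat)

lemma dense_finite: "dense S \<Longrightarrow> finite S"
  by (simp add: dense_def)

lemma dense_prime: "dense S \<Longrightarrow> p \<in> S \<Longrightarrow> prime p"
  by (simp add: dense_def)

text \<open>The new prime need not be the largest. If larger primes exist in S, the smallest of
  them, m, already obeys a bound with the same product over primes below q, and q < m. The bounds of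
  the larger primes only gain.\<close>

lemma dense_insert:
  assumes S: "dense S" and q: "prime q" "t < q" "q \<le> T * \<Prod>S" "q \<notin> S"
  shows "dense (insert q S)"
  unfolding dense_def
proof (intro conjI ballI)
  show "finite (insert q S)" using S by (simp add: dense_def)
  have fin: "finite S" using S by (simp add: dense_def)
  have pos: "p \<in> insert q S \<Longrightarrow> p > 0" for p using S q by (auto simp: dense_def prime_gt_0_nat)
  fix r assume r: "r \<in> insert q S"
  show "prime r" "t < r" using S q r by (auto simp: dense_def)
  have mono: "\<Prod>{p \<in> S. p < r} \<le> \<Prod>{p \<in> insert q S. p < r}"
  proof (rule dvd_imp_le)
    show "\<Prod>{p \<in> S. p < r} dvd \<Prod>{p \<in> insert q S. p < r}"
      using fin by (intro prod_dvd_prod_subset) auto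
    show "0 < \<Prod>{p \<in> insert q S. p < r}" using pos by (intro prod_pos) auto
  qed
  have "r \<le> T * \<Prod>{p \<in> S. p < r}"
  proof (cases "r = q")
    case False
    thus ?thesis using r S by (auto simp: dense_def)
  next
    case True
    show ?thesis
    proof (cases "\<exists>p\<in>S. p > q")
      case False
      hence "p < q" if "p \<in> S" for p using that q(4) by (metis linorder_neqE_nat)
      hence "{p \<in> S. p < r} = S" using True by auto
      thus ?thesis using q True by simp
    next
      case ex: True
      define m where "m = Min {p\<in>S. p > q}"
      have m: "m \<in> {p\<in>S. p > q}" unfolding m_def using ex fin by (intro Min_in) auto
      have le: "m \<le> p" if "p \<in> S" "p > q" for p
        unfolding m_def using that fin by (intro Min_le) auto
      have "p < m \<longleftrightarrow> p < q" if "p \<in> S" for p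
        using le[OF that] m q(4) that by (cases p q rule: linorder_cases) auto
      hence "{p \<in> S. p < m} = {p \<in> S. p < r}" using True by auto
      moreover have "m \<le> T * \<Prod>{p \<in> S. p < m}" using S m by (auto simp: dense_def)
      ultimately show ?thesis using m True by simp
    qed
  qed
  also have "\<dots> \<le> T * \<Prod>{p \<in> insert q S. p < r}" using mono by simp
  finally show "r \<le> T * \<Prod>{p \<in> insert q S. p < r}" .
qed

text \<open>The product contains q and everything below it. Consequently a dense set of product e^v
  uses only primes up to about e^(v/2), so a cutoff of the primes at a slightly higher power loses
  nothing.\<close>

lemma dense_square_le: "dense S \<Longrightarrow> q \<in> S \<Longrightarrow> q * q \<le> T * \<Prod>S"
proof -
  assume S: "dense S" and q: "q \<in> S"
  have fin: "finite S" using S by (simp add: dense_def)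
  have "\<Prod>(insert q {p\<in>S. p < q}) dvd \<Prod>S"
    using fin q by (intro prod_dvd_prod_subset) auto
  hence "\<Prod>(insert q {p\<in>S. p < q}) \<le> \<Prod>S"
    using dense_prod_pos[OF S] by (rule dvd_imp_le)
  hence "q * \<Prod>{p\<in>S. p < q} \<le> \<Prod>S" using fin by simp
  hence 1: "T * (q * \<Prod>{p\<in>S. p < q}) \<le> T * \<Prod>S" by (rule mult_le_mono2)
  have "q * q \<le> q * (T * \<Prod>{p\<in>S. p < q})" using S q by (intro mult_le_mono2) (simp add: dense_def)
  also have "\<dots> = T * (q * \<Prod>{p\<in>S. p < q})" by (simp only: mult.left_commute)
  finally show ?thesis using 1 by (rule order_trans)
qed

lemma dense_upto_step_trivial:
  assumes "\<not> (prime (Suc Z) \<and> t < Suc Z)"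
  shows "dense_upto (Suc Z) = dense_upto Z" "primes_between (Suc Z) = primes_between Z"
proof -
  have "S \<subseteq> {..Z}" if "dense S" "S \<subseteq> {..Suc Z}" for S
  proof
    fix p assume p: "p \<in> S"
    hence "prime p" "t < p" "p \<le> Suc Z" using that by (auto simp: dense_def)
    thus "p \<in> {..Z}" using assms by (cases "p = Suc Z") auto
  qed
  thus "dense_upto (Suc Z) = dense_upto Z" by (auto simp: dense_upto_def)
  show "primes_between (Suc Z) = primes_between Z"
    using assms unfolding primes_between_def by (metis le_Suc_eq)
qed

lemma dense_upto_step:
  assumes Q: "prime (Suc Z)" "t < Suc Z"
  shows "dense_upto (Suc Z) = dense_upto Z \<union> insert (Suc Z) ` {A \<in> dense_upto Z. Suc Z \<le> T * \<Prod>A}"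
proof (intro equalityI subsetI)
  fix S assume S: "S \<in> dense_upto (Suc Z)"
  show "S \<in> dense_upto Z \<union> insert (Suc Z) ` {A \<in> dense_upto Z. Suc Z \<le> T * \<Prod>A}"
  proof (cases "Suc Z \<in> S")
    case False
    hence "S \<subseteq> {..Z}" using S by (auto simp: dense_upto_def le_Suc_eq subset_iff)
    thus ?thesis using S by (auto simp: dense_upto_def)
  next
    case True
    define A where "A = S - {Suc Z}"
    have sub: "A \<subseteq> {..Z}" using S by (auto simp: A_def dense_upto_def le_Suc_eq subset_iff)
    have eq: "{p \<in> A. p < q} = {p \<in> S. p < q}" if "q \<le> Suc Z" for q using that by (auto simp: A_def)
    have "dense A"
      unfolding dense_def
    proof (intro conjI ballI)
      fix q assume q: "q \<in> A"
      hence "q \<in> S" "q \<le> Suc Z" using sub by (auto simp: A_def)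
      thus "prime q" "t < q" "q \<le> T * \<Prod>{p \<in> A. p < q}" using S by (auto simp: dense_upto_def dense_def eq)
    qed (use S in \<open>auto simp: A_def dense_upto_def dense_def\<close>)
    moreover have "Suc Z \<le> T * \<Prod>A"
    proof -
      have "{p \<in> S. p < Suc Z} = A"
        using sub by (auto simp: A_def subset_iff less_Suc_eq_le)
      thus ?thesis using S True by (auto simp: dense_upto_def dense_def)
    qed
    moreover have "S = insert (Suc Z) A" using True by (auto simp: A_def)
    ultimately show ?thesis using sub by (auto simp: dense_upto_def)
  qed
next
  fix S assume "S \<in> dense_upto Z \<union> insert (Suc Z) ` {A \<in> dense_upto Z. Suc Z \<le> T * \<Prod>A}"
  thus "S \<in> dense_upto (Suc Z)"
  proof
    assume "S \<in> dense_upto Z"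
    thus ?thesis by (auto simp: dense_upto_def)
  next
    assume "S \<in> insert (Suc Z) ` {A \<in> dense_upto Z. Suc Z \<le> T * \<Prod>A}"
    then obtain A where A: "S = insert (Suc Z) A" "dense A" "A \<subseteq> {..Z}" "Suc Z \<le> T * \<Prod>A"
      by (auto simp: dense_upto_def)
    have "Suc Z \<notin> A" using A by auto
    hence "dense S" using A Q by (auto intro: dense_insert)
    thus ?thesis using A by (auto simp: dense_upto_def)
  qed
qed

text \<open>
  Optional stopping: the primes are revealed in increasing order, each new prime \<open>Q\<close> being added to
  the chains \<open>A\<close> that can still be extended by it, and an invariant functional splits accordingly.
\<close>

lemma sum_dense_upto_invariant:
  fixes F :: "nat \<Rightarrow> nat set \<Rightarrow> real"
  assumes triv: "\<And>Z A. primes_between (Suc Z) = primes_between Z \<Longrightarrow> F (Suc Z) A = F Z A"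
    and stop: "\<And>Z A. prime (Suc Z) \<Longrightarrow> t < Suc Z \<Longrightarrow> A \<in> dense_upto Z \<Longrightarrow> T * \<Prod>A < Suc Z \<Longrightarrow> F (Suc Z) A = F Z A"
    and split: "\<And>Z A. prime (Suc Z) \<Longrightarrow> t < Suc Z \<Longrightarrow> A \<in> dense_upto Z \<Longrightarrow> Suc Z \<le> T * \<Prod>A \<Longrightarrow>
        F (Suc Z) A + F (Suc Z) (insert (Suc Z) A) = F Z A"
  shows "(\<Sum>A\<in>dense_upto Z. F Z A) = F 0 {}"
proof (induction Z)
  case 0
  have "dense_upto 0 = {{}}" by (auto simp: dense_upto_def dense_def)
  thus ?case by simp
next
  case (Suc Z)
  show ?case
  proof (cases "prime (Suc Z) \<and> t < Suc Z")
    case False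
    thus ?thesis using Suc triv dense_upto_step_trivial[OF False] by simp
  next
    case True
    define E where "E = {A \<in> dense_upto Z. Suc Z \<le> T * \<Prod>A}"
    have fE: "finite E" by (simp add: E_def)
    have nZ: "Suc Z \<notin> A" if "A \<in> dense_upto Z" for A using that by (auto simp: dense_upto_def)
    have inj: "inj_on (insert (Suc Z)) E"
      using nZ by (auto simp: inj_on_def E_def) (metis insert_eq_iff insert_ident)+
    have disj: "dense_upto Z \<inter> insert (Suc Z) ` E = {}" using nZ by auto
    have "(\<Sum>A\<in>dense_upto (Suc Z). F (Suc Z) A) =
        (\<Sum>A\<in>dense_upto Z. F (Suc Z) A) + (\<Sum>A\<in>insert (Suc Z) ` E. F (Suc Z) A)"
      using True disj fE by (subst dense_upto_step) (auto simp: E_def[symmetric] sum.union_disjoint)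
    also have "(\<Sum>A\<in>insert (Suc Z) ` E. F (Suc Z) A) = (\<Sum>A\<in>E. F (Suc Z) (insert (Suc Z) A))"
      by (simp add: sum.reindex[OF inj])
    also have "(\<Sum>A\<in>dense_upto Z. F (Suc Z) A) = (\<Sum>A\<in>dense_upto Z - E. F (Suc Z) A) + (\<Sum>A\<in>E. F (Suc Z) A)"
      by (rule sum.subset_diff) (auto simp: E_def)
    also have "(\<Sum>A\<in>dense_upto Z - E. F (Suc Z) A) = (\<Sum>A\<in>dense_upto Z - E. F Z A)"
      using True stop by (intro sum.cong) (auto simp: E_def not_le)
    also have "\<dots> + (\<Sum>A\<in>E. F (Suc Z) A) + (\<Sum>A\<in>E. F (Suc Z) (insert (Suc Z) A)) =
        (\<Sum>A\<in>dense_upto Z - E. F Z A) + (\<Sum>A\<in>E. F (Suc Z) A + F (Suc Z) (insert (Suc Z) A))"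
      by (simp add: sum.distrib)
    also have "(\<Sum>A\<in>E. F (Suc Z) A + F (Suc Z) (insert (Suc Z) A)) = (\<Sum>A\<in>E. F Z A)"
      using True split by (intro sum.cong) (auto simp: E_def)
    also have "(\<Sum>A\<in>dense_upto Z - E. F Z A) + (\<Sum>A\<in>E. F Z A) = (\<Sum>A\<in>dense_upto Z. F Z A)"
      by (rule sum.subset_diff[symmetric]) (auto simp: E_def)
    finally show ?thesis using Suc by simp
  qed
qed

section \<open>The stopped process and its martingale\<close>

definition avail :: "nat \<Rightarrow> nat set \<Rightarrow> nat set" where
  "avail Z A = {p \<in> primes_between Z. p \<le> T * \<Prod>A}"

text \<open>\<open>avail Z A\<close> consists of the primes decided upon before the process stops or
  reaches Z. Each is accepted with probability x / (1 + x) and rejected with probability 1 / (1 +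
  x), so for a dense A up to Z this is the probability that exactly A has been accepted.\<close>

definition weight :: "(nat \<Rightarrow> real) \<Rightarrow> nat \<Rightarrow> nat set \<Rightarrow> real" where
  "weight x Z A = (\<Prod>p\<in>A. x p) / (\<Prod>p\<in>avail Z A. 1 + x p)"

text \<open>The logarithm of the product minus its compensator, the sum of the conditional means of
  the increments.\<close>

definition drift :: "(nat \<Rightarrow> real) \<Rightarrow> nat \<Rightarrow> nat set \<Rightarrow> real" where
  "drift x Z A = (\<Sum>p\<in>A. ln (real p)) - (\<Sum>p\<in>avail Z A. ln (real p) * x p / (1 + x p))"

lemma finite_avail [simp]: "finite (avail Z A)"
  by (simp add: avail_def)

lemma avail_stop: "T * \<Prod>A < Suc Z \<Longrightarrow> avail (Suc Z) A = avail Z A"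
  by (auto simp: avail_def primes_between_def)

lemma avail_trivial: "primes_between (Suc Z) = primes_between Z \<Longrightarrow> avail (Suc Z) A = avail Z A"
  by (simp add: avail_def)

lemma avail_split:
  assumes Q: "prime (Suc Z)" "t < Suc Z" "A \<in> dense_upto Z" "Suc Z \<le> T * \<Prod>A"
  shows "avail (Suc Z) A = insert (Suc Z) (primes_between Z)" "avail Z A = primes_between Z"
    "avail (Suc Z) (insert (Suc Z) A) = insert (Suc Z) (primes_between Z)"
    "Suc Z \<notin> primes_between Z" "Suc Z \<notin> A" "finite A"
proof -
  show nin: "Suc Z \<notin> A" and fin: "finite A" using Q by (auto simp: dense_upto_def dense_def)
  have "\<Prod>(insert (Suc Z) A) = Suc Z * \<Prod>A" using nin fin by simp
  also have "\<dots> \<ge> \<Prod>A" by simp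
  finally have "T * \<Prod>A \<le> T * \<Prod>(insert (Suc Z) A)" by simp
  hence ge: "Suc Z \<le> T * \<Prod>(insert (Suc Z) A)" using Q(4) by linarith
  show "avail (Suc Z) A = insert (Suc Z) (primes_between Z)" "avail Z A = primes_between Z"
    "Suc Z \<notin> primes_between Z"
    using Q by (auto simp: avail_def primes_between_def)
  show "avail (Suc Z) (insert (Suc Z) A) = insert (Suc Z) (primes_between Z)"
    using Q(1,2) ge unfolding avail_def primes_between_def by (auto simp del: prod.insert)
qed

lemma sum_weight:
  assumes x: "\<And>p. x p \<ge> 0"
  shows "(\<Sum>A\<in>dense_upto Z. weight x Z A) = 1"
proof -
  have pos: "0 < 1 + x p" for p using x[of p] by linarith
  have "(\<Sum>A\<in>dense_upto Z. weight x Z A) = weight x 0 {}"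
  proof (rule sum_dense_upto_invariant)
    fix Z A assume Q: "prime (Suc Z)" "t < Suc Z" "A \<in> dense_upto Z" "Suc Z \<le> T * \<Prod>A"
    define P where "P = (\<Prod>p\<in>primes_between Z. 1 + x p)"
    define W where "W = (\<Prod>p\<in>A. x p)"
    define y where "y = x (Suc Z)"
    have y: "1 + y \<noteq> 0" using pos[of "Suc Z"] by (simp add: y_def)
    have "weight x (Suc Z) A = W / (P * (1 + y))" "weight x (Suc Z) (insert (Suc Z) A) = W * y / (P * (1 + y))"
      "weight x Z A = W / P"
      using avail_split[OF Q] by (simp_all add: weight_def P_def W_def y_def mult.commute)
    hence "weight x (Suc Z) A + weight x (Suc Z) (insert (Suc Z) A) = W * (1 + y) / (P * (1 + y))"
      by (simp add: add_divide_distrib distrib_left)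
    thus "weight x (Suc Z) A + weight x (Suc Z) (insert (Suc Z) A) = weight x Z A"
      using y \<open>weight x Z A = W / P\<close> by simp
  qed (simp_all add: weight_def avail_trivial avail_stop)
  also have "\<dots> = 1" by (simp add: weight_def avail_def primes_between_def cong: conj_cong)
  finally show ?thesis .
qed

text \<open>Optional stopping. With u the mean increment, revealing a prime Q changes the value by
  ln Q - u with probability y / (1 + y) and by -u otherwise, which averages to 0; stopped sets do
  not change.\<close>

lemma sum_weight_drift:
  assumes x: "\<And>p. x p \<ge> 0"
  shows "(\<Sum>A\<in>dense_upto Z. weight x Z A * drift x Z A) = 0"
proof -
  have pos: "0 < 1 + x p" for p using x[of p] by linarith
  have "(\<Sum>A\<in>dense_upto Z. weight x Z A * drift x Z A) = weight x 0 {} * drift x 0 {}"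
  proof (rule sum_dense_upto_invariant[where F = "\<lambda>Z A. weight x Z A * drift x Z A"])
    fix Z A assume Q: "prime (Suc Z)" "t < Suc Z" "A \<in> dense_upto Z" "Suc Z \<le> T * \<Prod>A"
    define P where "P = (\<Prod>p\<in>primes_between Z. 1 + x p)"
    define Y where "Y = (\<Sum>p\<in>primes_between Z. ln (real p) * x p / (1 + x p))"
    define W where "W = (\<Prod>p\<in>A. x p)"
    define l where "l = (\<Sum>p\<in>A. ln (real p))"
    define y where "y = x (Suc Z)"
    define lq where "lq = ln (real (Suc Z))"
    define u where "u = lq * y / (1 + y)"
    have y: "1 + y \<noteq> 0" using pos[of "Suc Z"] by (simp add: y_def)
    hence u: "u * (1 + y) = lq * y" by (simp add: u_def)
    have eqs: "weight x (Suc Z) A = W / (P * (1 + y))" "weight x (Suc Z) (insert (Suc Z) A) = W * y / (P * (1 + y))"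
      "weight x Z A = W / P" "drift x (Suc Z) A = l - (Y + u)" "drift x Z A = l - Y"
      "drift x (Suc Z) (insert (Suc Z) A) = lq + l - (Y + u)"
      using avail_split[OF Q]
      by (simp_all add: weight_def drift_def P_def Y_def W_def l_def y_def lq_def u_def mult.commute add.commute)
    have "W / (P * (1 + y)) * (l - (Y + u)) + W * y / (P * (1 + y)) * (lq + l - (Y + u)) =
        W / (P * (1 + y)) * ((l - Y) * (1 + y) + (lq * y - u * (1 + y)))"
      by (simp add: algebra_simps add_divide_distrib diff_divide_distrib)
    also have "\<dots> = W * (l - Y) * (1 + y) / (P * (1 + y))" using u by simp
    also have "\<dots> = W / P * (l - Y)" using y by simp
    finally show "weight x (Suc Z) A * drift x (Suc Z) A +
        weight x (Suc Z) (insert (Suc Z) A) * drift x (Suc Z) (insert (Suc Z) A) = weight x Z A * drift x Z A"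
      unfolding eqs .
  qed (simp_all add: weight_def drift_def avail_trivial avail_stop)
  also have "\<dots> = 0" by (simp add: drift_def avail_def primes_between_def cong: conj_cong)
  finally show ?thesis .
qed

end

section \<open>Tilted weights\<close>

text \<open>This is n^(-1 - 1/L). It is comparable with 1/n up to e^L and has total mass at most 1 +
  L, so L acts as a smooth logarithmic cutoff and the bounds become independent of the largest prime
  revealed.\<close>

definition tilt :: "real \<Rightarrow> nat \<Rightarrow> real" where
  "tilt L n = exp (- ln (real n) / L) / real n"

lemma ln_div_prime_nonneg: "prime p \<Longrightarrow> 0 \<le> ln (real p) / real p"
  using prime_ge_1_nat[of p] by simp

lemma tilt_nonneg: "tilt L n \<ge> 0"
  by (simp add: tilt_def)

lemma tilt_mult: "a > 0 \<Longrightarrow> b > 0 \<Longrightarrow> tilt L (a * b) = tilt L a * tilt L b"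
  by (simp add: tilt_def ln_mult add_divide_distrib diff_divide_distrib exp_add[symmetric])

lemma tilt_1 [simp]: "tilt L 1 = 1" "tilt L (Suc 0) = 1"
  by (simp_all add: tilt_def)

lemma tilt_prod: "finite A \<Longrightarrow> (\<And>p. p \<in> A \<Longrightarrow> p > 0) \<Longrightarrow> tilt L (\<Prod>A) = (\<Prod>p\<in>A. tilt L p)"
  by (induction A rule: finite_induct) (auto simp: tilt_mult prod_pos)

lemma tilt_le: "L > 0 \<Longrightarrow> n > 0 \<Longrightarrow> tilt L n \<le> 1 / real n"
  unfolding tilt_def by (intro divide_right_mono) (auto simp: divide_nonpos_pos)

lemma tilt_le_1: "L > 0 \<Longrightarrow> tilt L n \<le> 1"
proof (cases "n > 0")
  case True
  assume "L > 0"
  hence "tilt L n \<le> 1 / real n" using True by (rule tilt_le)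
  also have "\<dots> \<le> 1" using True by simp
  finally show ?thesis .
qed (simp add: tilt_def)

lemma tilt_ge:
  assumes "L > 0" "n > 0"
  shows "tilt L n \<ge> 1 / real n - ln (real n) / (real n * L)"
proof -
  have "1 + (- ln (real n) / L) \<le> exp (- ln (real n) / L)" by (rule exp_ge_add_one_self)
  hence "(1 + (- ln (real n) / L)) / real n \<le> tilt L n"
    unfolding tilt_def by (intro divide_right_mono) auto
  thus ?thesis by (simp add: diff_divide_distrib mult.commute)
qed

lemma inverse_le_tilt:
  assumes "v > 0" "a > 0" "ln (real a) \<le> v"
  shows "1 / real a \<le> 3 * tilt v a"
proof -
  have "- 1 \<le> - ln (real a) / v" using assms by simp
  hence e: "exp (- 1) \<le> exp (- ln (real a) / v)" by (subst exp_le_cancel_iff)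
  have "exp (1 :: real) \<le> 3" by (rule exp_le)
  hence "1 / 3 \<le> 1 / exp (1 :: real)" by (intro divide_left_mono) auto
  hence "1 / 3 \<le> exp (- 1 :: real)" by (simp add: exp_minus inverse_eq_divide)
  with e have "1 \<le> 3 * exp (- ln (real a) / v)" by linarith
  hence "1 / real a \<le> 3 * exp (- ln (real a) / v) / real a" by (intro divide_right_mono) auto
  thus ?thesis by (simp add: tilt_def)
qed

lemma sum_tilt_le:
  assumes "L > 0"
  shows "(\<Sum>n=1..K. tilt L n) \<le> 1 + L"
proof -
  \<comment> \<open>The bound is the term n = 1 plus the integral of u^(-1 - 1/L) from 1 to K. The
    value chosen for K = 0 makes the bracket vanish.\<close>
  have "(\<Sum>n=1..K. tilt L n) \<le> 1 + L * (1 - (if K = 0 then 1 else exp (- ln (real K) / L)))"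
  proof (induction K)
    case (Suc K)
    show ?case
    proof (cases "K = 0")
      case False
      define u where "u = ln (real (Suc K)) - ln (real K)"
      have "ln (real K / real (Suc K)) \<le> real K / real (Suc K) - 1"
        using False by (intro ln_le_minus_one) simp
      hence u: "u \<ge> 1 / real (Suc K)"
        using False by (simp add: u_def ln_div field_simps)
      define E where "E = exp (- ln (real (Suc K)) / L)"
      have "exp (- ln (real K) / L) = E * exp (u / L)"
        by (simp add: E_def u_def exp_add[symmetric] diff_divide_distrib)
      moreover have "tilt L (Suc K) \<le> L * (E * exp (u / L) - E)"
      proof -
        have "tilt L (Suc K) = E * (1 / real (Suc K))" by (simp add: tilt_def E_def)
        also have "\<dots> \<le> E * u" using u by (intro mult_left_mono) (auto simp: E_def)
        also have "\<dots> = L * (E * (1 + u / L) - E)" using assms by (simp add: algebra_simps)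
        also have "\<dots> \<le> L * (E * exp (u / L) - E)"
          using assms by (intro mult_left_mono diff_right_mono exp_ge_add_one_self) (auto simp: E_def)
        finally show ?thesis .
      qed
      ultimately have "tilt L (Suc K) \<le> L * (exp (- ln (real K) / L) - E)" by simp
      moreover have "(\<Sum>n=1..Suc K. tilt L n) = (\<Sum>n=1..K. tilt L n) + tilt L (Suc K)" by simp
      ultimately show ?thesis using Suc False by (simp add: E_def algebra_simps)
    qed simp
  qed (use assms in simp)
  also have "\<dots> \<le> 1 + L" using assms by (auto simp: algebra_simps)
  finally show ?thesis .
qed

lemma ln_Suc_le_harmonic: "ln (real (Suc N)) \<le> (\<Sum>n=1..N. 1 / real n)"
proof (induction N)
  case (Suc N)
  have "ln (real (Suc (Suc N)) / real (Suc N)) \<le> real (Suc (Suc N)) / real (Suc N) - 1"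
    by (intro ln_le_minus_one) simp
  hence "ln (real (Suc (Suc N))) - ln (real (Suc N)) \<le> 1 / real (Suc N)"
    by (simp add: ln_div field_simps)
  thus ?case using Suc by simp
qed simp

lemma sum_inverse_squares_le: "(\<Sum>k=1..N. 1 / (real k)\<^sup>2) \<le> 2"
proof -
  have "(\<Sum>k=1..N. 1 / (real k)\<^sup>2) \<le> 2 - (if N = 0 then 0 else 1 / real N)"
  proof (induction N)
    case (Suc N)
    show ?case
    proof (cases "N = 0")
      case False
      have "1 / (real (Suc N))\<^sup>2 \<le> 1 / (real N * real (Suc N))"
        using False unfolding power2_eq_square by (intro divide_left_mono mult_right_mono) auto
      also have "\<dots> = 1 / real N - 1 / real (Suc N)" using False by (simp add: field_simps)
      finally have "1 / (real (Suc N))\<^sup>2 \<le> 1 / real N - 1 / real (Suc N)" .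
      thus ?thesis using Suc False by simp
    qed simp
  qed simp
  also have "\<dots> \<le> 2" by simp
  finally show ?thesis .
qed

section \<open>Products over primes compared with sums over integers\<close>

lemma prime_factors_prod_primes:
  fixes S :: "nat set"
  assumes "finite S" "\<And>p. p \<in> S \<Longrightarrow> prime p"
  shows "prime_factors (\<Prod>S) = S"
proof -
  have "0 \<notin> S" using assms(2)[of 0] by auto
  thus ?thesis using assms by (subst prime_factors_prod) (auto simp: prime_prime_factors)
qed

lemma inj_on_prod_primes: "inj_on (\<lambda>S :: nat set. \<Prod>S) {S. finite S \<and> (\<forall>p\<in>S. prime p)}"
  by (intro inj_onI) (metis (no_types, lifting) mem_Collect_eq prime_factors_prod_primes)

lemma prod_one_plus_eq_sum_subsets:
  fixes x :: "'a \<Rightarrow> real"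
  assumes "finite P"
  shows "(\<Prod>p\<in>P. 1 + x p) = (\<Sum>S\<in>Pow P. \<Prod>p\<in>S. x p)"
  using prod_add[OF assms, of x "\<lambda>_. 1"] by (simp add: add.commute)

text \<open>Expanding the product gives tilted weights of distinct squarefree integers.\<close>

lemma prod_one_plus_tilt_le:
  assumes "finite P" "\<And>p. p \<in> P \<Longrightarrow> prime p" "L > 0"
  shows "(\<Prod>p\<in>P. 1 + tilt L p) \<le> 1 + L"
proof -
  have sub: "finite S" "\<And>p. p \<in> S \<Longrightarrow> prime p" if "S \<in> Pow P" for S
    using that assms finite_subset by auto
  have inj: "inj_on (\<lambda>S. \<Prod>S) (Pow P)"
    by (rule inj_on_subset[OF inj_on_prod_primes]) (use sub in auto)
  have "(\<Prod>p\<in>P. 1 + tilt L p) = (\<Sum>S\<in>Pow P. \<Prod>p\<in>S. tilt L p)"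
    by (rule prod_one_plus_eq_sum_subsets[OF assms(1)])
  also have "\<dots> = (\<Sum>S\<in>Pow P. tilt L (\<Prod>S))"
    using sub by (intro sum.cong refl tilt_prod[symmetric]) (auto simp: prime_gt_0_nat)
  also have "\<dots> = (\<Sum>n\<in>(\<lambda>S. \<Prod>S) ` Pow P. tilt L n)"
    by (simp add: sum.reindex[OF inj])
  also have "\<dots> \<le> (\<Sum>n=1..\<Prod>P. tilt L n)"
  proof (intro sum_mono2)
    show "(\<lambda>S. \<Prod>S) ` Pow P \<subseteq> {1..\<Prod>P}"
    proof safe
      fix S assume S: "S \<subseteq> P"
      have pos: "\<Prod>P > 0" using assms by (intro prod_pos) (auto simp: prime_gt_0_nat)
      have "\<Prod>S dvd \<Prod>P" using assms S by (intro prod_dvd_prod_subset) auto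
      thus "\<Prod>S \<in> {1..\<Prod>P}" using pos by (auto simp: dvd_imp_le Suc_le_eq dvd_pos_nat)
    qed
  qed (auto simp: tilt_nonneg)
  also have "\<dots> \<le> 1 + L" by (rule sum_tilt_le[OF assms(3)])
  finally show ?thesis .
qed

text \<open>Every \<open>n \<le> N\<close> is a square times a squarefree number, and the latter is encoded by its set of prime factors.\<close>

lemma sum_tilt_le_prod_primes:
  assumes L: "L > 0"
  shows "(\<Sum>n=1..N. tilt L n) \<le> 2 * (\<Prod>p | prime p \<and> p \<le> N. 1 + tilt L p)"
proof -
  let ?P = "{p. prime p \<and> p \<le> N}"
  define \<phi> where "\<phi> = (\<lambda>n :: nat. (square_part n, prime_factors (squarefree_part n)))"
  define g where "g = (\<lambda>(k, S). tilt L k * tilt L k * (\<Prod>p\<in>S. tilt L p))"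
  have fact: "n = squarefree_part n * (square_part n * square_part n)" for n :: nat
    using squarefree_decompose[of n] by (simp add: power2_eq_square)
  have sf: "\<Prod>(prime_factors (squarefree_part n)) = squarefree_part n" for n :: nat
  proof -
    have sq: "squarefree (squarefree_part n)" by (cases "n = 0") auto
    hence sf0: "squarefree_part n \<noteq> 0" by (metis not_squarefree_0)
    have "squarefree_part n = (\<Prod>p\<in>prime_factors (squarefree_part n). p ^ multiplicity p (squarefree_part n))"
      by (rule prime_factorization_nat[OF neq0_conv[THEN iffD1, OF sf0]])
    also have "\<dots> = \<Prod>(prime_factors (squarefree_part n))"
    proof (intro prod.cong refl)
      fix p assume p: "p \<in> prime_factors (squarefree_part n)"
      hence "multiplicity p (squarefree_part n) = 1"
        using squarefree_factorial_semiring'[OF sf0] sq by blast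
      thus "p ^ multiplicity p (squarefree_part n) = p" by simp
    qed
    finally show ?thesis by simp
  qed
  have pos: "squarefree_part n > 0" "square_part n > 0" if "n > 0" for n :: nat
    by (rule Nat.gr0I, use fact[of n] that in simp)+
  have g: "g (\<phi> n) = tilt L n" if n: "n \<in> {1..N}" for n
  proof -
    have "n > 0" using n by simp
    note p = pos[OF this]
    have "tilt L n = tilt L (squarefree_part n) * (tilt L (square_part n) * tilt L (square_part n))"
      by (subst fact) (use p in \<open>simp add: tilt_mult\<close>)
    also have "tilt L (squarefree_part n) = tilt L (\<Prod>(prime_factors (squarefree_part n)))" by (simp add: sf)
    also have "\<dots> = (\<Prod>p\<in>prime_factors (squarefree_part n). tilt L p)"
      by (intro tilt_prod) (auto simp: in_prime_factors_iff prime_gt_0_nat)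
    finally show ?thesis by (simp add: g_def \<phi>_def)
  qed
  have inj: "inj_on \<phi> {1..N}"
    by (intro inj_onI) (metis (no_types, lifting) \<phi>_def fact prod.inject sf)
  have img: "\<phi> ` {1..N} \<subseteq> {1..N} \<times> Pow ?P"
  proof safe
    fix n a S assume n: "n \<in> {1..N}" and aS: "(a, S) = \<phi> n"
    have n0: "n > 0" using n by simp
    have "square_part n dvd n" "squarefree_part n dvd n"
      by (subst (2) fact; simp)+
    hence le: "square_part n \<le> n" "squarefree_part n dvd n" using n0 by (auto simp: dvd_imp_le)
    show "a \<in> {1..N}" using aS le pos[OF n0] n by (auto simp: \<phi>_def)
    fix p assume "p \<in> S"
    hence p: "p \<in> prime_factors (squarefree_part n)" using aS by (auto simp: \<phi>_def)
    show "prime p" using p by (auto simp: in_prime_factors_iff)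
    have "p dvd n" using p le(2) by (auto intro: dvd_trans)
    thus "p \<le> N" using n0 n by (auto dest: dvd_imp_le)
  qed
  have "(\<Sum>n=1..N. tilt L n) = (\<Sum>n=1..N. g (\<phi> n))" by (intro sum.cong refl) (simp add: g)
  also have "\<dots> = (\<Sum>y\<in>\<phi> ` {1..N}. g y)" by (simp only: sum.reindex[OF inj] o_def)
  also have "\<dots> \<le> (\<Sum>y\<in>{1..N} \<times> Pow ?P. g y)"
    by (intro sum_mono2 img) (auto simp: g_def tilt_nonneg prod_nonneg)
  also have "\<dots> = (\<Sum>k=1..N. \<Sum>S\<in>Pow ?P. tilt L k * tilt L k * (\<Prod>p\<in>S. tilt L p))"
    unfolding g_def by (rule sum.cartesian_product[symmetric])
  also have "\<dots> = (\<Sum>k=1..N. tilt L k * tilt L k) * (\<Sum>S\<in>Pow ?P. \<Prod>p\<in>S. tilt L p)"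
    by (simp only: sum_distrib_left[symmetric] sum_distrib_right[symmetric])
  also have "(\<Sum>S\<in>Pow ?P. \<Prod>p\<in>S. tilt L p) = (\<Prod>p\<in>?P. 1 + tilt L p)"
    by (rule prod_one_plus_eq_sum_subsets[symmetric]) simp
  also have "(\<Sum>k=1..N. tilt L k * tilt L k) * (\<Prod>p\<in>?P. 1 + tilt L p) \<le> 2 * (\<Prod>p\<in>?P. 1 + tilt L p)"
  proof (rule mult_right_mono)
    have "(\<Sum>k=1..N. tilt L k * tilt L k) \<le> (\<Sum>k=1..N. 1 / (real k)\<^sup>2)"
    proof (intro sum_mono)
      fix k assume "k \<in> {1..N}"
      hence "tilt L k * tilt L k \<le> (1 / real k) * (1 / real k)"
        using L by (intro mult_mono tilt_le) (auto simp: tilt_nonneg)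
      thus "tilt L k * tilt L k \<le> 1 / (real k)\<^sup>2" by (simp add: power2_eq_square)
    qed
    also have "\<dots> \<le> 2" by (rule sum_inverse_squares_le)
    finally show "(\<Sum>k=1..N. tilt L k * tilt L k) \<le> 2" .
  qed (auto intro!: prod_nonneg simp: tilt_nonneg add_nonneg_nonneg)
  finally show ?thesis .
qed

section \<open>Bounds for weight and drift, and their consequences\<close>

context prime_chain
begin

lemma avail_eq: "avail Z A = primes_between (min Z (T * \<Prod>A))"
  by (auto simp: avail_def primes_between_def)

text \<open>The harmonic sum is taken up to N <= e^L, where 1/n is at most e times the tilt. In the
  constant, 3 bounds e, 2 is the loss from square factors, and 2^t pays for dropping the primes up
  to t.\<close>

lemma prod_one_plus_tilt_ge:
  assumes L: "L > 0" and z: "z \<ge> 1"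
  shows "(\<Prod>p\<in>primes_between z. 1 + tilt L p) \<ge> min (ln (real z)) L / (6 * 2 ^ t)"
proof -
  define N where "N = min z (nat \<lfloor>exp L\<rfloor>)"
  have N: "real n \<le> exp L" if "n \<le> N" for n
    using that unfolding N_def by (simp add: le_nat_iff le_floor_iff)
  have "min (ln (real z)) L \<le> ln (real (Suc N))"
  proof (cases "N = z")
    case True
    have "ln (real z) \<le> ln (real (Suc z))" using z by simp
    thus ?thesis using True by simp
  next
    case False
    hence "N = nat \<lfloor>exp L\<rfloor>" by (auto simp: N_def min_def)
    hence "exp L \<le> real (Suc N)" by linarith
    hence "L \<le> ln (real (Suc N))" by (metis exp_gt_zero less_le_trans ln_exp ln_le_cancel_iff)
    thus ?thesis by simp
  qed
  also have "\<dots> \<le> (\<Sum>n=1..N. 1 / real n)" by (rule ln_Suc_le_harmonic)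
  also have "\<dots> \<le> (\<Sum>n=1..N. 3 * tilt L n)"
  proof (intro sum_mono)
    fix n assume n: "n \<in> {1..N}"
    hence "real n \<le> exp L" using N by simp
    hence "ln (real n) \<le> L" using n by (metis atLeastAtMost_iff exp_gt_zero less_eq_Suc_le ln_exp ln_le_cancel_iff of_nat_0_less_iff One_nat_def)
    thus "1 / real n \<le> 3 * tilt L n" using n L by (intro inverse_le_tilt) auto
  qed
  also have "\<dots> = 3 * (\<Sum>n=1..N. tilt L n)" by (simp add: sum_distrib_left)
  also have "\<dots> \<le> 3 * (2 * (\<Prod>p | prime p \<and> p \<le> N. 1 + tilt L p))"
    by (intro mult_left_mono sum_tilt_le_prod_primes[OF L]) simp
  also have "(\<Prod>p | prime p \<and> p \<le> N. 1 + tilt L p) \<le> (\<Prod>p\<in>{p. prime p \<and> p \<le> t} \<union> primes_between z. 1 + tilt L p)"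
    by (intro prod_mono2) (auto simp: primes_between_def N_def tilt_nonneg add_nonneg_nonneg)
  also have "\<dots> = (\<Prod>p | prime p \<and> p \<le> t. 1 + tilt L p) * (\<Prod>p\<in>primes_between z. 1 + tilt L p)"
    by (intro prod.union_disjoint) (auto simp: primes_between_def)
  also have "\<dots> \<le> 2 ^ t * (\<Prod>p\<in>primes_between z. 1 + tilt L p)"
  proof (rule mult_right_mono)
    have "(\<Prod>p | prime p \<and> p \<le> t. 1 + tilt L p) \<le> (\<Prod>p | prime p \<and> p \<le> t. 2)"
      using tilt_le_1[OF L] by (intro prod_mono) (auto simp: tilt_nonneg add_nonneg_nonneg)
    also have "\<dots> = 2 ^ card {p. prime p \<and> p \<le> t}" by simp
    also have "\<dots> \<le> 2 ^ t"
    proof (rule power_increasing)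
      have "card {p. prime p \<and> p \<le> t} \<le> card {1..t}"
        by (intro card_mono) (auto dest: prime_ge_1_nat)
      thus "card {p. prime p \<and> p \<le> t} \<le> t" by simp
    qed simp
    finally show "(\<Prod>p | prime p \<and> p \<le> t. 1 + tilt L p) \<le> 2 ^ t" .
  qed (auto intro!: prod_nonneg simp: tilt_nonneg add_nonneg_nonneg)
  finally have "min (ln (real z)) L \<le> 3 * (2 * (2 ^ t * (\<Prod>p\<in>primes_between z. 1 + tilt L p)))" by simp
  thus ?thesis by (simp add: field_simps)
qed

lemma sum_drift_terms_le:
  assumes L: "L > 0" and z: "z \<ge> 1"
  shows "(\<Sum>p\<in>primes_between z. ln (real p) * tilt L p / (1 + tilt L p)) \<le> ln (real z) + 10"
proof -
  have "(\<Sum>p\<in>primes_between z. ln (real p) * tilt L p / (1 + tilt L p)) \<le> (\<Sum>p\<in>primes_between z. ln (real p) / real p)"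
  proof (intro sum_mono)
    fix p assume "p \<in> primes_between z"
    hence p: "p > 1" using prime_gt_1_nat[of p] by (simp add: primes_between_def)
    have l: "0 \<le> ln (real p)" using p by simp
    have "ln (real p) * tilt L p / (1 + tilt L p) \<le> ln (real p) * tilt L p / 1"
      using l tilt_nonneg[of L p] by (intro divide_left_mono) (auto intro: mult_nonneg_nonneg)
    also have "\<dots> \<le> ln (real p) * (1 / real p)" 
      unfolding div_by_1 using tilt_le[OF L, of p] p by (intro mult_left_mono l) auto
    finally show "ln (real p) * tilt L p / (1 + tilt L p) \<le> ln (real p) / real p" by simp
  qed
  also have "\<dots> \<le> (\<Sum>p | prime p \<and> p \<le> z. ln (real p) / real p)"
    by (intro sum_mono2) (auto simp: primes_between_def ln_div_prime_nonneg)
  also have "\<dots> \<le> ln (real z) + 4 * ln 2" using z by (intro mertens_upper) simp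
  also have "\<dots> \<le> ln (real z) + 10" using ln_le_minus_one[of "2 :: real"] by simp
  finally show ?thesis .
qed

text \<open>Since x / (1 + x) >= x - x^2 and x >= 1/p - ln p / (p L), the losses are the primes up
  to t, the effect of the tilt, and the sum of ln p / (p (p - 1)). The absolute constants are 9 and
  4 from Mertens and 8 from the last sum, together below 28.\<close>

lemma sum_drift_terms_ge:
  assumes L: "L > 0" and z: "z \<ge> 1"
  shows "(\<Sum>p\<in>primes_between z. ln (real p) * tilt L p / (1 + tilt L p)) \<ge>
    ln (real z) - ln (real t) - 28 - ln (real z) * (ln (real z) + 10) / L"
proof -
  let ?P = "primes_between z"
  have ln2: "4 * ln 2 \<le> (4 :: real)" using ln_le_minus_one[of "2 :: real"] by simp
  have pP: "p \<ge> 2" "p \<le> z" if "p \<in> ?P" for p using that by (auto simp: primes_between_def prime_ge_2_nat)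
  have "ln (real z) - 9 \<le> (\<Sum>p | prime p \<and> p \<le> z. ln (real p) / real p)"
    using z by (intro mertens_lower) simp
  also have "\<dots> \<le> (\<Sum>p\<in>?P \<union> {p. prime p \<and> p \<le> t}. ln (real p) / real p)"
    by (intro sum_mono2) (auto simp: primes_between_def ln_div_prime_nonneg)
  also have "\<dots> = (\<Sum>p\<in>?P. ln (real p) / real p) + (\<Sum>p | prime p \<and> p \<le> t. ln (real p) / real p)"
    by (intro sum.union_disjoint) (auto simp: primes_between_def)
  also have "(\<Sum>p | prime p \<and> p \<le> t. ln (real p) / real p) \<le> ln (real t) + 4 * ln 2"
    using t_pos by (intro mertens_upper) simp
  finally have 1: "(\<Sum>p\<in>?P. ln (real p) / real p) \<ge> ln (real z) - ln (real t) - 13" using ln2 by simp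
  have "(\<Sum>p\<in>?P. (ln (real p))\<^sup>2 / (real p * L)) \<le> (\<Sum>p\<in>?P. (ln (real z) / L) * (ln (real p) / real p))"
  proof (intro sum_mono)
    fix p assume p: "p \<in> ?P"
    have "ln (real p) * ln (real p) \<le> ln (real z) * ln (real p)"
      using pP[OF p] by (intro mult_right_mono) auto
    thus "(ln (real p))\<^sup>2 / (real p * L) \<le> (ln (real z) / L) * (ln (real p) / real p)"
      using pP[OF p] L by (simp add: power2_eq_square field_simps)
  qed
  also have "\<dots> = (ln (real z) / L) * (\<Sum>p\<in>?P. ln (real p) / real p)" by (rule sum_distrib_left[symmetric])
  also have "\<dots> \<le> (ln (real z) / L) * (ln (real z) + 10)"
  proof (rule mult_left_mono)
    have "(\<Sum>p\<in>?P. ln (real p) / real p) \<le> (\<Sum>p | prime p \<and> p \<le> z. ln (real p) / real p)"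
      by (intro sum_mono2) (auto simp: primes_between_def ln_div_prime_nonneg)
    also have "\<dots> \<le> ln (real z) + 4 * ln 2" using z by (intro mertens_upper) simp
    finally show "(\<Sum>p\<in>?P. ln (real p) / real p) \<le> ln (real z) + 10" using ln2 by linarith
    show "0 \<le> ln (real z) / L" using z L by simp
  qed
  finally have 2: "(\<Sum>p\<in>?P. (ln (real p))\<^sup>2 / (real p * L)) \<le> ln (real z) * (ln (real z) + 10) / L" by simp
  have "(\<Sum>p\<in>?P. ln (real p) / (real p * (real p - 1))) \<le> (\<Sum>m=2..z. ln (real m) / (real m * (real m - 1)))"
    by (intro sum_mono2) (auto simp: primes_between_def prime_ge_2_nat)
  also have "\<dots> \<le> 8" by (rule sum_ln_div_le)
  finally have 3: "(\<Sum>p\<in>?P. ln (real p) / (real p * (real p - 1))) \<le> 8" .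
  have "(\<Sum>p\<in>?P. ln (real p) / real p - (ln (real p))\<^sup>2 / (real p * L) - ln (real p) / (real p * (real p - 1)))
      \<le> (\<Sum>p\<in>?P. ln (real p) * tilt L p / (1 + tilt L p))"
  proof (intro sum_mono)
    fix p assume p: "p \<in> ?P"
    define x where "x = tilt L p"
    have p2: "real p \<ge> 2" using pP[OF p] by simp
    have x0: "0 \<le> x" and x1: "x \<le> 1 / real p" and x2: "x \<ge> 1 / real p - ln (real p) / (real p * L)"
      using tilt_nonneg[of L p] tilt_le[OF L, of p] tilt_ge[OF L, of p] pP[OF p] by (auto simp: x_def)
    have l: "0 \<le> ln (real p)" using p2 by simp
    have "x * x \<le> (1 / real p) * (1 / real p)" using x0 x1 by (intro mult_mono) auto
    also have "\<dots> = 1 / (real p * real p)" by simp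
    also have "\<dots> \<le> 1 / (real p * (real p - 1))" using p2 by (intro divide_left_mono mult_left_mono) auto
    finally have xx: "x * x \<le> 1 / (real p * (real p - 1))" .
    have "(x - x * x) * (1 + x) \<le> x"
      using x0 by (simp add: algebra_simps)
    hence "x - x * x \<le> x / (1 + x)" using x0 by (simp add: pos_le_divide_eq)
    hence "ln (real p) * (1 / real p - ln (real p) / (real p * L) - 1 / (real p * (real p - 1))) \<le> ln (real p) * (x / (1 + x))"
      using xx x2 l by (intro mult_left_mono) auto
    thus "ln (real p) / real p - (ln (real p))\<^sup>2 / (real p * L) - ln (real p) / (real p * (real p - 1))
      \<le> ln (real p) * tilt L p / (1 + tilt L p)"
      by (simp add: x_def[symmetric] algebra_simps power2_eq_square)
  qed
  thus ?thesis using 1 2 3 by (simp add: sum_subtractf)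
qed

lemma prod_tilt_dense: "dense A \<Longrightarrow> (\<Prod>p\<in>A. tilt L p) = tilt L (\<Prod>A)"
  by (rule tilt_prod[symmetric]) (auto simp: dense_def prime_gt_0_nat)

lemma sum_ln_dense: "dense A \<Longrightarrow> (\<Sum>p\<in>A. ln (real p)) = ln (real (\<Prod>A))"
  by (simp add: dense_def ln_prod prime_gt_0_nat)

lemma weight_le:
  assumes A: "dense A" and L: "L > 0" and z: "z = min Z (T * \<Prod>A)" "z \<ge> 2"
  shows "weight (tilt L) Z A \<le> tilt L (\<Prod>A) * (6 * 2 ^ t) / min (ln (real z)) L"
proof -
  have "1 < real z" using z(2) by linarith
  hence m: "min (ln (real z)) L > 0" using L ln_gt_zero by simp
  have pp: "(\<Prod>p\<in>primes_between z. 1 + tilt L p) \<ge> min (ln (real z)) L / (6 * 2 ^ t)"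
    using z(2) by (intro prod_one_plus_tilt_ge[OF L]) linarith
  have "weight (tilt L) Z A = tilt L (\<Prod>A) / (\<Prod>p\<in>primes_between z. 1 + tilt L p)"
    unfolding weight_def avail_eq z(1)[symmetric] prod_tilt_dense[OF A] ..
  also have "\<dots> \<le> tilt L (\<Prod>A) / (min (ln (real z)) L / (6 * 2 ^ t))"
  proof (rule divide_left_mono[OF pp tilt_nonneg])
    have "0 < min (ln (real z)) L / (6 * 2 ^ t)" using m by simp
    thus "0 < (\<Prod>p\<in>primes_between z. 1 + tilt L p) * (min (ln (real z)) L / (6 * 2 ^ t))"
      using less_le_trans[OF _ pp] by (intro mult_pos_pos) blast+
  qed
  finally show ?thesis by simp
qed

lemma weight_ge:
  assumes A: "dense A" and L: "L > 0"
  shows "weight (tilt L) Z A \<ge> tilt L (\<Prod>A) / (1 + L)"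
proof -
  have "(\<Prod>p\<in>avail Z A. 1 + tilt L p) \<le> 1 + L"
    using L by (intro prod_one_plus_tilt_le) (auto simp: avail_def primes_between_def)
  moreover have "(\<Prod>p\<in>avail Z A. 1 + tilt L p) > 0"
    by (intro prod_pos) (auto intro: add_pos_nonneg simp: tilt_nonneg)
  ultimately show ?thesis
    unfolding weight_def prod_tilt_dense[OF A] using tilt_nonneg L by (intro divide_left_mono) auto
qed

lemma drift_ge:
  assumes A: "dense A" and L: "L > 0" and Z: "Z \<ge> 1"
  shows "drift (tilt L) Z A \<ge> ln (real (\<Prod>A)) - ln (real (min Z (T * \<Prod>A))) - 10"
proof -
  have "min Z (T * \<Prod>A) \<ge> 1" using Z T_pos dense_prod_pos[OF A] by (simp add: Suc_le_eq)
  from sum_drift_terms_le[OF L this] show ?thesis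
    unfolding drift_def avail_eq sum_ln_dense[OF A] by linarith
qed

text \<open>The hypothesis on Z says that the process has stopped at A. The compensator then runs up
  to T times the product, so ln T is lost; by the choice of T this outweighs ln t + 28 by 1, and the
  value is at most -1 up to the error of the tilt.\<close>

lemma drift_le:
  assumes A: "dense A" and L: "L > 0" and Z: "T * \<Prod>A \<le> Z" and T: "ln (real T) \<ge> ln (real t) + 29"
  shows "drift (tilt L) Z A + 1 \<le> 2 * (ln (real (T * \<Prod>A)))\<^sup>2 / L"
proof -
  define u where "u = ln (real (T * \<Prod>A))"
  have a: "\<Prod>A > 0" by (rule dense_prod_pos[OF A])
  have "T * \<Prod>A \<ge> 1" using T_pos a by (simp add: Suc_le_eq)
  from sum_drift_terms_ge[OF L this] have "drift (tilt L) Z A \<le> ln (real (\<Prod>A)) - (u - ln (real t) - 28 - u * (u + 10) / L)"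
    unfolding drift_def avail_eq sum_ln_dense[OF A] u_def using Z by (simp add: min_absorb2)
  moreover have u: "u = ln (real T) + ln (real (\<Prod>A))"
    unfolding u_def using T_pos a by (simp add: ln_mult del: of_nat_prod)
  ultimately have "drift (tilt L) Z A + 1 \<le> u * (u + 10) / L" using T by linarith
  also have "\<dots> \<le> u * (2 * u) / L"
  proof -
    have "ln (real t) \<ge> 0" "ln (real (\<Prod>A)) \<ge> 0" using t_pos a by (auto simp del: of_nat_prod)
    hence "u \<ge> 10" using u T by linarith
    thus ?thesis using L by (intro divide_right_mono mult_left_mono) auto
  qed
  also have "u * (2 * u) / L = 2 * u\<^sup>2 / L" by (simp add: power2_eq_square)
  finally show ?thesis unfolding u_def .
qed

lemma drift_le_ln:
  assumes A: "dense A" and L: "L > 0"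
  shows "drift (tilt L) Z A \<le> ln (real (\<Prod>A))"
  unfolding drift_def sum_ln_dense[OF A]
  by (auto intro!: sum_nonneg divide_nonneg_nonneg mult_nonneg_nonneg add_nonneg_nonneg tilt_nonneg
      simp: avail_def primes_between_def prime_ge_1_nat)

text \<open>The mean of drift + 1 is 1. With u = ln (T a): if u <= L the process has stopped, the
  weight is O(tilt / u) and drift + 1 <= 2 u^2 / L; if u > L the weight is O(tilt / L) and drift + 1
  <= 2 u. Both cases give the same bound \<open>12 * 2 ^ t / L\<close> times tilt times u, so the
  mean 1 forces the sum to be large.\<close>

lemma sum_tilt_ln_lower:
  assumes T: "ln (real T) \<ge> ln (real t) + 29" and L: "L \<ge> 1" and Z: "real Z \<ge> exp L"
  shows "(\<Sum>A\<in>dense_upto Z. tilt L (\<Prod>A) * ln (real (T * \<Prod>A))) \<ge> L / (12 * 2 ^ t)"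
proof -
  have L0: "L > 0" using L by simp
  have T2: "real T \<ge> 2"
  proof -
    have "ln (real t) \<ge> 0" using t_pos by simp
    hence "ln (real T) \<ge> 1" using T by linarith
    hence "ln (real T) \<ge> ln 2" using ln_le_minus_one[of "2 :: real"] by linarith
    thus ?thesis using T_pos by simp
  qed
  have main: "weight (tilt L) Z A * (drift (tilt L) Z A + 1) \<le> 12 * 2 ^ t / L * (tilt L (\<Prod>A) * ln (real (T * \<Prod>A)))"
    if A: "A \<in> dense_upto Z" for A
  proof -
    have dA: "dense A" using A by (simp add: dense_upto_def)
    define a where "a = \<Prod>A"
    have a: "a \<ge> 1" using dense_prod_pos[OF dA] by (simp add: a_def Suc_le_eq)
    define u where "u = ln (real (T * a))"
    have Ta: "T * a \<ge> 2" using T2 a by (metis mult_le_mono nat_mult_1_right of_nat_le_iff of_nat_numeral)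
    have "1 < real (T * a)" using Ta by linarith
    hence u0: "u > 0" unfolding u_def by (rule ln_gt_zero)
    have w0: "weight (tilt L) Z A \<ge> 0"
      unfolding weight_def by (intro divide_nonneg_nonneg prod_nonneg) (auto simp: tilt_nonneg add_nonneg_nonneg)
    show ?thesis
    proof (cases "u \<le> L")
      case True
      have "real (T * a) \<le> exp L" using True Ta unfolding u_def
        by (metis exp_le_cancel_iff exp_ln of_nat_0_less_iff less_le_trans zero_less_numeral)
      hence Z': "T * a \<le> Z" using Z by linarith
      have w: "weight (tilt L) Z A \<le> tilt L a * (6 * 2 ^ t) / u"
        using weight_le[OF dA L0, of "T * a" Z] Z' Ta True by (simp add: a_def u_def min_absorb2 min_absorb1)
      have "weight (tilt L) Z A * (drift (tilt L) Z A + 1) \<le> weight (tilt L) Z A * (2 * u\<^sup>2 / L)"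
        using drift_le[OF dA L0 _ T] Z' w0 by (intro mult_left_mono) (auto simp: a_def u_def)
      also have "\<dots> \<le> tilt L a * (6 * 2 ^ t) / u * (2 * u\<^sup>2 / L)"
        using w L0 by (intro mult_right_mono) auto
      also have "\<dots> = 12 * 2 ^ t / L * (tilt L a * u)"
        using u0 by (simp add: power2_eq_square)
      finally show ?thesis by (simp add: a_def u_def)
    next
      case False
      define z where "z = min Z (T * a)"
      have "L \<le> ln (real Z)" using Z by (metis exp_gt_zero less_le_trans ln_exp ln_le_cancel_iff)
      hence lz: "min (ln (real z)) L = L" using False unfolding z_def u_def by (simp add: min_def)
      have "real Z \<ge> 2" using Z exp_ge_add_one_self[of L] L by linarith
      hence z2: "z \<ge> 2" using Ta unfolding z_def by simp
      have w: "weight (tilt L) Z A \<le> tilt L a * (6 * 2 ^ t) / L"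
        using weight_le[OF dA L0, of z Z] z2 lz by (simp add: a_def z_def)
      have "u = ln (real T) + ln (real a)" unfolding u_def using T_pos a by (simp add: ln_mult)
      moreover have "ln (real t) \<ge> 0" using t_pos by simp
      ultimately have "drift (tilt L) Z A + 1 \<le> 2 * u"
        using drift_le_ln[OF dA L0, of Z] T u0 unfolding a_def by linarith
      hence "weight (tilt L) Z A * (drift (tilt L) Z A + 1) \<le> weight (tilt L) Z A * (2 * u)"
        using w0 by (intro mult_left_mono) auto
      also have "\<dots> \<le> tilt L a * (6 * 2 ^ t) / L * (2 * u)" using w u0 by (intro mult_right_mono) auto
      also have "\<dots> = 12 * 2 ^ t / L * (tilt L a * u)" by simp
      finally show ?thesis by (simp add: a_def u_def)
    qed
  qed
  have "1 = (\<Sum>A\<in>dense_upto Z. weight (tilt L) Z A * (drift (tilt L) Z A + 1))"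
    using sum_weight[of "tilt L" Z] sum_weight_drift[of "tilt L" Z] tilt_nonneg
    by (simp add: distrib_left sum.distrib)
  also have "\<dots> \<le> (\<Sum>A\<in>dense_upto Z. 12 * 2 ^ t / L * (tilt L (\<Prod>A) * ln (real (T * \<Prod>A))))"
    by (intro sum_mono main)
  also have "\<dots> = 12 * 2 ^ t / L * (\<Sum>A\<in>dense_upto Z. tilt L (\<Prod>A) * ln (real (T * \<Prod>A)))"
    by (rule sum_distrib_left[symmetric])
  finally show ?thesis using L0 by (simp add: field_simps)
qed

text \<open>Adding C = ln T + 10 makes the drift nonnegative, so large products can be bounded by
  the mean C. Beyond Z^(3/2) the compensator, at most ln Z + 10, takes away no more than two thirds
  of the logarithm up to the constant, and the weight is at least the tilt divided by 1 + L.\<close>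

lemma sum_tilt_ln_upper:
  assumes L: "L > 0" and Z: "Z \<ge> 1"
  shows "(\<Sum>A | A \<in> dense_upto Z \<and> real (\<Prod>A) > real Z powr (3/2). tilt L (\<Prod>A) * ln (real (\<Prod>A)))
    \<le> 3 * (ln (real T) + 10) * (1 + L)"
proof -
  let ?B = "{A. A \<in> dense_upto Z \<and> real (\<Prod>A) > real Z powr (3/2)}"
  define C where "C = ln (real T) + 10"
  have lnT: "ln (real T) \<ge> 0" using T_pos by simp
  have nonneg: "drift (tilt L) Z A + C \<ge> 0" if "A \<in> dense_upto Z" for A
  proof -
    have dA: "dense A" using that by (simp add: dense_upto_def)
    have a: "\<Prod>A > 0" by (rule dense_prod_pos[OF dA])
    have m: "0 < min Z (T * \<Prod>A)" using Z T_pos a by auto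
    have "real (min Z (T * \<Prod>A)) \<le> real (T * \<Prod>A)" by (simp del: of_nat_prod of_nat_mult)
    hence "ln (real (min Z (T * \<Prod>A))) \<le> ln (real (T * \<Prod>A))"
      using m by (subst ln_le_cancel_iff) (auto simp del: of_nat_prod of_nat_mult)
    also have "\<dots> = ln (real T) + ln (real (\<Prod>A))" using T_pos a by (simp add: ln_mult del: of_nat_prod)
    finally show ?thesis using drift_ge[OF dA L Z] unfolding C_def by linarith
  qed
  have w0: "weight (tilt L) Z A \<ge> 0" for A
    unfolding weight_def by (intro divide_nonneg_nonneg prod_nonneg) (auto simp: tilt_nonneg add_nonneg_nonneg)
  have main: "tilt L (\<Prod>A) * ln (real (\<Prod>A)) \<le> 3 * (1 + L) * (weight (tilt L) Z A * (drift (tilt L) Z A + C))"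
    if A: "A \<in> ?B" for A
  proof -
    have dA: "dense A" using A by (simp add: dense_upto_def)
    have a: "\<Prod>A > 0" by (rule dense_prod_pos[OF dA])
    have m: "0 < min Z (T * \<Prod>A)" using Z T_pos a by auto
    have "ln (real (min Z (T * \<Prod>A))) \<le> ln (real Z)"
      using m Z by (subst ln_le_cancel_iff) (auto simp del: of_nat_prod of_nat_mult)
    hence "drift (tilt L) Z A + C \<ge> ln (real (\<Prod>A)) - ln (real Z)"
      using drift_ge[OF dA L Z] lnT unfolding C_def by linarith
    moreover have "ln (real (\<Prod>A)) \<ge> ln (real Z powr (3/2))"
      using A Z a by (subst ln_le_cancel_iff) (auto simp del: of_nat_prod)
    hence "ln (real (\<Prod>A)) \<ge> 3/2 * ln (real Z)" using Z by (simp add: ln_powr)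
    ultimately have d: "drift (tilt L) Z A + C \<ge> ln (real (\<Prod>A)) / 3" by linarith
    have l: "ln (real (\<Prod>A)) \<ge> 0" using a by (simp del: of_nat_prod)
    have "tilt L (\<Prod>A) / (1 + L) * (ln (real (\<Prod>A)) / 3) \<le> weight (tilt L) Z A * (drift (tilt L) Z A + C)"
      using weight_ge[OF dA L, of Z] d l w0 by (intro mult_mono) auto
    thus ?thesis using L by (simp add: field_simps)
  qed
  have "(\<Sum>A\<in>?B. tilt L (\<Prod>A) * ln (real (\<Prod>A))) \<le> (\<Sum>A\<in>?B. 3 * (1 + L) * (weight (tilt L) Z A * (drift (tilt L) Z A + C)))"
    by (intro sum_mono main)
  also have "\<dots> \<le> (\<Sum>A\<in>dense_upto Z. 3 * (1 + L) * (weight (tilt L) Z A * (drift (tilt L) Z A + C)))"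
    using L nonneg w0 by (intro sum_mono2) (auto intro!: mult_nonneg_nonneg)
  also have "\<dots> = 3 * (1 + L) * (\<Sum>A\<in>dense_upto Z. weight (tilt L) Z A * (drift (tilt L) Z A + C))"
    by (rule sum_distrib_left[symmetric])
  also have "(\<Sum>A\<in>dense_upto Z. weight (tilt L) Z A * (drift (tilt L) Z A + C)) = C"
    using sum_weight[of "tilt L" Z] sum_weight_drift[of "tilt L" Z] tilt_nonneg
    by (simp add: distrib_left sum.distrib sum_distrib_right[symmetric])
  finally show ?thesis by (simp add: C_def algebra_simps)
qed

end

section \<open>Reciprocal sums over dense sets\<close>

lemma card_large_mult_le_ln_prod:
  fixes B :: "nat set" and y :: real
  assumes "finite B" "\<And>p. p \<in> B \<Longrightarrow> p \<ge> 1" "y > 0"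
  shows "real (card {q \<in> B. real q > exp y}) * y \<le> ln (real (\<Prod>B))"
proof -
  let ?Q = "{q \<in> B. real q > exp y}"
  have "real (card ?Q) * y = (\<Sum>q\<in>?Q. y)" by simp
  also have "\<dots> \<le> (\<Sum>q\<in>?Q. ln (real q))"
  proof (intro sum_mono)
    fix q assume "q \<in> ?Q"
    hence "exp y \<le> real q" by simp
    thus "y \<le> ln (real q)" by (metis exp_gt_zero less_le_trans ln_exp ln_le_cancel_iff)
  qed
  also have "\<dots> \<le> (\<Sum>q\<in>B. ln (real q))"
    using assms by (intro sum_mono2) auto
  also have "\<dots> = ln (\<Prod>q\<in>B. real q)"
    using assms by (intro ln_prod[symmetric]) (auto simp: Suc_le_eq)
  finally show ?thesis by simp
qed

text \<open>Double counting: a pair is recovered from B = insert q A and q, and q is one of at most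
  m elements of B with property R.\<close>

lemma sum_insert_pairs_le:
  fixes f :: "'a set \<Rightarrow> real" and P :: "('a set \<times> 'a) set"
  assumes fin: "finite P" and nin: "\<And>A q. (A, q) \<in> P \<Longrightarrow> q \<notin> A \<and> R q"
    and f: "\<And>B. f B \<ge> 0" and U: "finite U" "\<And>A q. (A, q) \<in> P \<Longrightarrow> insert q A \<in> U"
    and m: "\<And>B. B \<in> U \<Longrightarrow> finite B \<and> real (card {q \<in> B. R q}) \<le> m"
  shows "(\<Sum>(A, q)\<in>P. f (insert q A)) \<le> m * (\<Sum>B\<in>U. f B)"
proof -
  let ?g = "\<lambda>(A, q). insert q A"
  have "(\<Sum>(A, q)\<in>P. f (insert q A)) = (\<Sum>x\<in>P. f (?g x))" by (simp add: case_prod_unfold)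
  also have "\<dots> = (\<Sum>B\<in>U. \<Sum>x\<in>{x \<in> P. ?g x = B}. f (?g x))"
    using fin U by (intro sum.group[symmetric]) auto
  also have "\<dots> \<le> (\<Sum>B\<in>U. m * f B)"
  proof (intro sum_mono)
    fix B assume B: "B \<in> U"
    let ?F = "{x \<in> P. ?g x = B}"
    have inj: "inj_on snd ?F"
    proof (rule inj_onI, clarsimp)
      fix A q A' assume "(A, q) \<in> P" "(A', q) \<in> P" "insert q A' = insert q A"
      moreover from this have "q \<notin> A" "q \<notin> A'" using nin by auto
      ultimately show "A = A'" by (metis insert_ident)
    qed
    have "card ?F = card (snd ` ?F)" by (simp add: card_image[OF inj])
    also have "\<dots> \<le> card {q \<in> B. R q}"
      using m[OF B] nin by (intro card_mono) auto
    finally have "real (card ?F) \<le> m" using m[OF B] by linarith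
    hence "real (card ?F) * f B \<le> m * f B" using f by (intro mult_right_mono) auto
    moreover have "(\<Sum>x\<in>?F. f (?g x)) = (\<Sum>x\<in>?F. f B)" by (intro sum.cong) auto
    ultimately show "(\<Sum>x\<in>?F. f (?g x)) \<le> m * f B" by simp
  qed
  also have "\<dots> = m * (\<Sum>B\<in>U. f B)" by (rule sum_distrib_left[symmetric])
  finally show ?thesis .
qed

lemma sum_primes_between_ge:
  assumes "1 \<le> u" "u \<le> v"
  shows "(\<Sum>p | prime p \<and> u < real p \<and> real p \<le> v. ln (real p) / real p) \<ge> ln v - ln u - 20"
proof -
  have eq: "{p. prime p \<and> real p \<le> v} = {p. prime p \<and> real p \<le> u} \<union> {p. prime p \<and> u < real p \<and> real p \<le> v}"
    using assms by auto
  have "(\<Sum>p | prime p \<and> real p \<le> v. ln (real p) / real p) = (\<Sum>p | prime p \<and> real p \<le> u. ln (real p) / real p) +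
      (\<Sum>p | prime p \<and> u < real p \<and> real p \<le> v. ln (real p) / real p)"
    unfolding eq by (rule sum.union_disjoint)
      (auto intro: finite_subset[OF _ finite_primes_real_le[of v]])
  thus ?thesis using mertens_first[of u] mertens_first[of v] assms by (simp add: abs_le_iff)
qed

section \<open>Linear growth of the logarithmic mass\<close>

context prime_chain
begin

lemma dense_mem_le_prod: "dense A \<Longrightarrow> p \<in> A \<Longrightarrow> p \<le> \<Prod>A"
  by (rule dvd_imp_le[OF dvd_prodI dense_prod_pos]) (auto simp: dense_def)

definition dense_le :: "real \<Rightarrow> nat set set" where
  "dense_le v = {A. dense A \<and> real (\<Prod>A) \<le> exp v}"

lemma finite_dense_le [simp]: "finite (dense_le v)"
proof (rule finite_subset)
  show "dense_le v \<subseteq> Pow {..nat \<lfloor>exp v\<rfloor>}"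
  proof safe
    fix A p assume A: "A \<in> dense_le v" "p \<in> A"
    hence "p \<le> \<Prod>A" using dense_mem_le_prod by (auto simp: dense_le_def)
    hence "real p \<le> real (\<Prod>A)" by (subst of_nat_le_iff)
    also have "\<dots> \<le> exp v" using A by (simp add: dense_le_def del: of_nat_prod)
    finally have "real p \<le> exp v" .
    thus "p \<le> nat \<lfloor>exp v\<rfloor>" by (simp add: le_nat_iff le_floor_iff)
  qed
qed simp

definition log_mass :: "real \<Rightarrow> real" where
  "log_mass v = (\<Sum>A\<in>dense_le v. ln (real (T * \<Prod>A)) / real (\<Prod>A))"

lemma ln_T_prod: "dense A \<Longrightarrow> ln (real (T * \<Prod>A)) = ln (real T) + ln (real (\<Prod>A))"
  using T_pos dense_prod_pos[of A] by (simp add: ln_mult del: of_nat_prod)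

lemma ln_T_nonneg: "ln (real T) \<ge> 0"
  using T_pos by simp

lemma ln_prod_dense_nonneg: "dense A \<Longrightarrow> ln (real (\<Prod>A)) \<ge> 0"
  using dense_prod_pos[of A] by (simp del: of_nat_prod)

lemma real_prod_dense_pos: "dense A \<Longrightarrow> real (\<Prod>A) > 0"
  using dense_prod_pos[of A] by (simp del: of_nat_prod)

lemma ln_prod_le_iff: "dense A \<Longrightarrow> ln (real (\<Prod>A)) \<le> v \<longleftrightarrow> real (\<Prod>A) \<le> exp v"
  using real_prod_dense_pos[of A] by (metis exp_le_cancel_iff exp_ln)

lemma log_mass_mono: "u \<le> v \<Longrightarrow> log_mass u \<le> log_mass v"
  unfolding log_mass_def
proof (intro sum_mono2 finite_dense_le)
  assume uv: "u \<le> v"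
  hence "exp u \<le> exp v" by simp
  thus "dense_le u \<subseteq> dense_le v" unfolding dense_le_def using order_trans by blast
  fix A assume "A \<in> dense_le v - dense_le u"
  hence "dense A" by (simp add: dense_le_def)
  thus "0 \<le> ln (real (T * \<Prod>A)) / real (\<Prod>A)"
    using ln_T_prod ln_T_nonneg ln_prod_dense_nonneg real_prod_dense_pos
    by (intro divide_nonneg_nonneg) (auto simp del: of_nat_prod of_nat_mult intro: less_imp_le)
qed

text \<open>Let the product lie between e^(0.9 v) and e^v. By \<open>dense_square_le\<close> and ln
  T <= v/10 its primes are at most e^(0.55 v), hence at most Z, about e^(0.6 v); and Z^(3/2) <=
  e^(0.9 v). So the upper bound for large products applies with L = v. In the factor 18, ln (T a) <=
  2 ln a and 1/a <= 3 tilt contribute 6, and the upper bound 3.\<close>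

lemma log_mass_step:
  assumes v: "v \<ge> 10 * ln (real T) + 10"
  shows "log_mass v \<le> log_mass (9/10 * v) + 18 * (ln (real T) + 10) * (1 + v)"
proof -
  have v0: "v > 0" "v \<ge> 10" using v ln_T_nonneg by linarith+
  define Z where "Z = nat \<lfloor>exp (6/10 * v)\<rfloor>"
  have "exp (6/10 * v) \<ge> 1" using v0 by simp
  hence Z1: "Z \<ge> 1" unfolding Z_def by (simp add: le_nat_iff le_floor_iff)
  have ZZ: "real Z \<le> exp (6/10 * v)" unfolding Z_def by simp
  have "real Z powr (3/2) \<le> exp (6/10 * v) powr (3/2)" using ZZ by (intro powr_mono2) auto
  hence Zp: "real Z powr (3/2) \<le> exp (9/10 * v)" by (simp add: powr_def)
  define M where "M = {A. dense A \<and> exp (9/10 * v) < real (\<Prod>A) \<and> real (\<Prod>A) \<le> exp v}"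
  let ?B = "{A. A \<in> dense_upto Z \<and> real (\<Prod>A) > real Z powr (3/2)}"
  have MB: "M \<subseteq> ?B"
  proof
    fix A assume "A \<in> M"
    hence A: "dense A" "exp (9/10 * v) < real (\<Prod>A)" "real (\<Prod>A) \<le> exp v" by (auto simp: M_def)
    have "q \<le> Z" if q: "q \<in> A" for q
    proof -
      have q0: "q > 0" using A q by (auto simp: dense_def prime_gt_0_nat)
      have "real (q * q) \<le> real (T * \<Prod>A)" using dense_square_le[OF A(1) q] by (subst of_nat_le_iff)
      hence "ln (real (q * q)) \<le> ln (real (T * \<Prod>A))"
        using q0 T_pos dense_prod_pos[OF A(1)] by (subst ln_le_cancel_iff) (auto simp del: of_nat_prod of_nat_mult)
      also have "\<dots> = ln (real T) + ln (real (\<Prod>A))" by (rule ln_T_prod[OF A(1)])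
      also have "\<dots> \<le> ln (real T) + v" using A(3) ln_prod_le_iff[OF A(1)] by (intro add_left_mono) blast
      finally have "2 * ln (real q) \<le> ln (real T) + v" using q0 by (simp add: ln_mult)
      hence "ln (real q) \<le> 6/10 * v" using v v0 by linarith
      hence "real q \<le> exp (6/10 * v)" using q0 by (metis exp_le_cancel_iff exp_ln of_nat_0_less_iff)
      thus ?thesis unfolding Z_def by (simp add: le_nat_iff le_floor_iff)
    qed
    thus "A \<in> ?B" using A Zp by (auto simp: dense_upto_def simp del: of_nat_prod)
  qed
  have finB: "finite ?B" by (rule finite_subset[OF _ finite_dense_upto[of Z]]) auto
  have eqv: "dense_le v = dense_le (9/10 * v) \<union> M"
  proof -
    define E where "E = exp (9/10 * v)"
    have "E \<le> exp v" using v0 by (simp add: E_def)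
    thus ?thesis unfolding dense_le_def M_def E_def[symmetric] by (auto simp del: of_nat_prod)
  qed
  have disj: "dense_le (9/10 * v) \<inter> M = {}" by (auto simp: dense_le_def M_def simp del: of_nat_prod)
  have "log_mass v = log_mass (9/10 * v) + (\<Sum>A\<in>M. ln (real (T * \<Prod>A)) / real (\<Prod>A))"
    unfolding log_mass_def eqv by (rule sum.union_disjoint[OF finite_dense_le finite_subset[OF MB finB] disj])
  also have "(\<Sum>A\<in>M. ln (real (T * \<Prod>A)) / real (\<Prod>A)) \<le> (\<Sum>A\<in>M. 6 * (tilt v (\<Prod>A) * ln (real (\<Prod>A))))"
  proof (intro sum_mono)
    fix A assume "A \<in> M"
    hence A: "dense A" "exp (9/10 * v) < real (\<Prod>A)" "real (\<Prod>A) \<le> exp v" by (auto simp: M_def)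
    have "\<not> ln (real (\<Prod>A)) \<le> 9/10 * v" using A(2) unfolding ln_prod_le_iff[OF A(1)] by (simp only: not_le)
    hence "ln (real T) \<le> ln (real (\<Prod>A))" using v v0 by linarith
    hence l: "ln (real (T * \<Prod>A)) \<le> 2 * ln (real (\<Prod>A))" unfolding ln_T_prod[OF A(1)] by linarith
    have i: "1 / real (\<Prod>A) \<le> 3 * tilt v (\<Prod>A)"
      by (rule inverse_le_tilt[OF v0(1) dense_prod_pos[OF A(1)]]) (use A(3) ln_prod_le_iff[OF A(1)] in blast)
    have "ln (real (T * \<Prod>A)) * (1 / real (\<Prod>A)) \<le> 2 * ln (real (\<Prod>A)) * (3 * tilt v (\<Prod>A))"
      using l i ln_prod_dense_nonneg[OF A(1)] by (intro mult_mono) (auto simp del: of_nat_prod)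
    thus "ln (real (T * \<Prod>A)) / real (\<Prod>A) \<le> 6 * (tilt v (\<Prod>A) * ln (real (\<Prod>A)))"
      by (simp del: of_nat_prod of_nat_mult add: mult_ac)
  qed
  also have "\<dots> \<le> (\<Sum>A\<in>?B. 6 * (tilt v (\<Prod>A) * ln (real (\<Prod>A))))"
    using MB finB ln_prod_dense_nonneg
    by (intro sum_mono2) (auto simp: tilt_nonneg dense_upto_def intro!: mult_nonneg_nonneg simp del: of_nat_prod)
  also have "\<dots> = 6 * (\<Sum>A\<in>?B. tilt v (\<Prod>A) * ln (real (\<Prod>A)))" by (rule sum_distrib_left[symmetric])
  also have "\<dots> \<le> 6 * (3 * (ln (real T) + 10) * (1 + v))"
    by (intro mult_left_mono sum_tilt_ln_upper[OF v0(1) Z1]) simp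
  also have "6 * (3 * (ln (real T) + 10) * (1 + v)) = 18 * (ln (real T) + 10) * (1 + v)"
    by (simp add: algebra_simps)
  finally show ?thesis by linarith
qed

lemma log_mass_linear: "\<exists>C>0. \<forall>v\<ge>1. log_mass v \<le> C * v"
proof -
  define v0 where "v0 = 10 * ln (real T) + 10"
  have v0: "v0 \<ge> 10" using ln_T_nonneg by (simp add: v0_def)
  \<comment> \<open>One step costs at most 36 (ln T + 10) v = K v / 10, exactly what is freed by
    passing from v to 9/10 v.\<close>
  define K where "K = 360 * (ln (real T) + 10)"
  have K: "K > 0" using ln_T_nonneg by (simp add: K_def)
  have G0: "log_mass v \<ge> 0" for v
    unfolding log_mass_def using ln_T_prod ln_T_nonneg ln_prod_dense_nonneg real_prod_dense_pos
    by (intro sum_nonneg divide_nonneg_nonneg) (auto simp: dense_le_def simp del: of_nat_prod of_nat_mult intro: less_imp_le)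
  have claim: "log_mass v \<le> log_mass v0 + K * v" if "0 \<le> v" "v \<le> v0 * (10/9) ^ n" for v n
    using that
  proof (induction n arbitrary: v)
    case 0
    have "log_mass v \<le> log_mass v0" using 0 by (intro log_mass_mono) simp
    thus ?case using K 0 by (simp add: add_increasing2)
  next
    case (Suc n)
    show ?case
    proof (cases "v \<le> v0")
      case True
      hence "log_mass v \<le> log_mass v0" by (rule log_mass_mono)
      thus ?thesis using K Suc by (simp add: add_increasing2)
    next
      case False
      have "log_mass v \<le> log_mass (9/10 * v) + 18 * (ln (real T) + 10) * (1 + v)"
        using False by (intro log_mass_step) (simp add: v0_def)
      also have "log_mass (9/10 * v) \<le> log_mass v0 + K * (9/10 * v)"
        using Suc.prems by (intro Suc.IH) auto
      also have "18 * (ln (real T) + 10) * (1 + v) \<le> 18 * (ln (real T) + 10) * (2 * v)"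
        using False v0 ln_T_nonneg by (intro mult_left_mono) auto
      finally show ?thesis by (simp add: K_def algebra_simps)
    qed
  qed
  have bound: "log_mass v \<le> log_mass v0 + K * v" if "v \<ge> 0" for v
  proof -
    obtain n where "v / v0 < (10/9) ^ n" using real_arch_pow[of "10/9" "v / v0"] by auto
    hence "v \<le> v0 * (10/9) ^ n" using v0 by (simp add: field_simps)
    thus ?thesis using claim that by blast
  qed
  have "log_mass v \<le> (log_mass v0 + K) * v" if "v \<ge> 1" for v
  proof -
    have "log_mass v \<le> log_mass v0 * 1 + K * v" using bound[of v] that by simp
    also have "\<dots> \<le> log_mass v0 * v + K * v" using that G0[of v0] by (intro add_right_mono mult_left_mono) auto
    finally show ?thesis by (simp add: algebra_simps)
  qed
  moreover have "log_mass v0 + K > 0" using G0[of v0] K by linarith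
  ultimately show ?thesis by blast
qed

section \<open>Positive reciprocal mass in a window\<close>

definition mid_dense :: "real \<Rightarrow> real \<Rightarrow> real \<Rightarrow> nat set set" where
  "mid_dense \<alpha> \<beta> l = {A. dense A \<and> exp (\<alpha> * l) < real (\<Prod>A) \<and> real (\<Prod>A) \<le> exp (\<beta> * l)}"

definition mass :: "real \<Rightarrow> real \<Rightarrow> real \<Rightarrow> real" where
  "mass \<alpha> \<beta> l = (\<Sum>A\<in>mid_dense \<alpha> \<beta> l. 1 / real (\<Prod>A))"

lemma finite_mid_dense [simp]: "finite (mid_dense \<alpha> \<beta> l)"
  by (rule finite_subset[OF _ finite_dense_le[of "\<beta> * l"]]) (auto simp: mid_dense_def dense_le_def)

text \<open>The lower bound c2 L for the tilted sum is split by the size of the product. Products up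
  to e^(\<delta> L) contribute O(\<delta> L) by linear growth. Products beyond e^(K L) gain a factor
  e^(-K/2) when the tilt with L is compared with the tilt with 2 L. Each part is made at most c2 L /
  4, so the middle carries c2 L / 2; there the logarithm is at most 2 K L.\<close>

lemma mass_lower:
  assumes T: "ln (real T) \<ge> ln (real t) + 29"
  shows "\<exists>c \<delta> K l0. 0 < c \<and> 0 < \<delta> \<and> \<delta> \<le> 1 \<and> 1 \<le> K \<and> (\<forall>l\<ge>l0. mass \<delta> K l \<ge> c)"
proof -
  define c2 where "c2 = (1 / (12 * 2 ^ t) :: real)"
  have c2: "c2 > 0" by (simp add: c2_def)
  obtain C where C: "C > 0" "\<And>v. v \<ge> 1 \<Longrightarrow> log_mass v \<le> C * v" using log_mass_linear by blast
  define C5 where "C5 = ln (real T) + 10"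
  have C5: "C5 > 0" using ln_T_nonneg by (simp add: C5_def)
  define \<delta> where "\<delta> = min 1 (c2 / (4 * C))"
  have \<delta>: "0 < \<delta>" "\<delta> \<le> 1" "C * \<delta> \<le> c2 / 4"
  proof -
    show "0 < \<delta>" "\<delta> \<le> 1" using c2 C by (auto simp: \<delta>_def)
    have "C * \<delta> \<le> C * (c2 / (4 * C))" using C by (intro mult_left_mono) (auto simp: \<delta>_def)
    thus "C * \<delta> \<le> c2 / 4" using C by simp
  qed
  \<comment> \<open>With Z about e^L one has Z^(3/2) <= e^(3 L), so K >= 3 puts the large products
    into the range of \<open>sum_tilt_ln_upper\<close>. The other bound yields 18 C5 e^(-K/2) <= c2
    / 4 by way of e^x >= x.\<close>
  define K where "K = max 3 (144 * C5 / c2)"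
  have K: "K \<ge> 3" "144 * C5 / c2 \<le> K" by (auto simp: K_def)
  have expK: "18 * C5 * exp (- K / 2) \<le> c2 / 4"
  proof -
    have "144 * C5 \<le> c2 * K" using K(2) c2 by (simp add: field_simps)
    moreover have "c2 * (K / 2) \<le> c2 * exp (K / 2)"
    proof (rule mult_left_mono)
      show "K / 2 \<le> exp (K / 2)" using exp_ge_add_one_self[of "K / 2"] by linarith
    qed (use c2 in simp)
    ultimately have "72 * C5 \<le> c2 * exp (K / 2)" by linarith
    thus ?thesis by (simp add: exp_minus field_simps)
  qed
  define l0 where "l0 = max (1 / \<delta>) (ln (real T))"
  have "mass \<delta> K L \<ge> c2 / (4 * K)" if L: "L \<ge> l0" for L
  proof -
    have dL: "\<delta> * L \<ge> 1" using L \<delta> by (simp add: l0_def field_simps)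
    have "1 / \<delta> \<ge> 1" using \<delta> by simp
    hence L1: "L \<ge> 1" using L by (simp add: l0_def)
    have LT: "L \<ge> ln (real T)" using L by (simp add: l0_def)
    have L0: "L > 0" using L1 by simp
    define Z where "Z = nat \<lceil>exp L\<rceil>"
    have Z: "real Z \<ge> exp L" unfolding Z_def by simp
    have Zle: "real Z \<le> exp L + 1" unfolding Z_def using exp_gt_zero[of L] by linarith
    have e2: "exp L \<ge> 2" using exp_ge_add_one_self[of L] L1 by linarith
    have Z1: "Z \<ge> 1" using Z e2 by linarith
    have "exp L + 1 \<le> 2 * exp L" using e2 by linarith
    also have "\<dots> \<le> exp L * exp L" using e2 by (intro mult_right_mono) auto
    also have "\<dots> = exp (2 * L)" by (simp add: exp_add[symmetric])
    finally have "real Z \<le> exp (2 * L)" using Zle by linarith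
    hence "real Z powr (3/2) \<le> exp (2 * L) powr (3/2)" by (intro powr_mono2) auto
    hence Zp: "real Z powr (3/2) \<le> exp (3 * L)" by (simp add: powr_def)
    let ?f = "\<lambda>A. tilt L (\<Prod>A) * ln (real (T * \<Prod>A))"
    define U1 where "U1 = {A\<in>dense_upto Z. real (\<Prod>A) \<le> exp (\<delta> * L)}"
    define U2 where "U2 = {A\<in>dense_upto Z. exp (\<delta> * L) < real (\<Prod>A) \<and> real (\<Prod>A) \<le> exp (K * L)}"
    define U3 where "U3 = {A\<in>dense_upto Z. exp (K * L) < real (\<Prod>A)}"
    have fin: "finite U1" "finite U2" "finite U3" by (simp_all add: U1_def U2_def U3_def)
    define E1 where "E1 = exp (\<delta> * L)"
    define E2 where "E2 = exp (K * L)"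
    have "E1 \<le> E2" unfolding E1_def E2_def using \<delta> K L0 by (simp add: mult_right_mono)
    hence U: "dense_upto Z = U1 \<union> (U2 \<union> U3)" and disj: "U1 \<inter> (U2 \<union> U3) = {}" "U2 \<inter> U3 = {}"
      unfolding U1_def U2_def U3_def E1_def[symmetric] E2_def[symmetric] by (auto simp del: of_nat_prod)
    have dU: "dense A" if "A \<in> U1 \<union> (U2 \<union> U3)" for A
      using that unfolding U[symmetric] by (simp add: dense_upto_def)
    have lTA: "ln (real (T * \<Prod>A)) \<ge> 0" if "dense A" for A
      unfolding ln_T_prod[OF that] using ln_T_nonneg ln_prod_dense_nonneg[OF that] by linarith
    have ftilt: "?f A \<le> ln (real (T * \<Prod>A)) / real (\<Prod>A)" if "dense A" for A
    proof -
      have "tilt L (\<Prod>A) * ln (real (T * \<Prod>A)) \<le> 1 / real (\<Prod>A) * ln (real (T * \<Prod>A))"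
        using tilt_le[OF L0 dense_prod_pos[OF that]] lTA[OF that] by (rule mult_right_mono)
      thus ?thesis by (simp del: of_nat_prod of_nat_mult)
    qed
    have S1: "(\<Sum>A\<in>U1. ?f A) \<le> c2 / 4 * L"
    proof -
      have "(\<Sum>A\<in>U1. ?f A) \<le> (\<Sum>A\<in>U1. ln (real (T * \<Prod>A)) / real (\<Prod>A))"
        using dU by (intro sum_mono ftilt) auto
      also have "\<dots> \<le> log_mass (\<delta> * L)"
        unfolding log_mass_def using lTA
        by (intro sum_mono2 finite_dense_le) (auto simp: U1_def dense_le_def dense_upto_def simp del: of_nat_prod of_nat_mult)
      also have "\<dots> \<le> C * (\<delta> * L)" by (rule C(2)[OF dL])
      also have "\<dots> = C * \<delta> * L" by simp
      also have "\<dots> \<le> c2 / 4 * L" using \<delta>(3) L0 by (intro mult_right_mono) auto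
      finally show ?thesis .
    qed
    have S3: "(\<Sum>A\<in>U3. ?f A) \<le> c2 / 4 * L"
    proof -
      let ?B = "{A. A \<in> dense_upto Z \<and> real (\<Prod>A) > real Z powr (3/2)}"
      have sub: "U3 \<subseteq> ?B"
      proof
        fix A assume A: "A \<in> U3"
        have "exp (3 * L) \<le> exp (K * L)" using K L0 by simp
        with Zp have "real Z powr (3/2) \<le> exp (K * L)" by (rule order_trans)
        moreover have "exp (K * L) < real (\<Prod>A)" "A \<in> dense_upto Z" using A by (auto simp: U3_def)
        ultimately show "A \<in> ?B" using le_less_trans by blast
      qed
      have finB: "finite ?B" by (rule finite_subset[OF _ finite_dense_upto[of Z]]) auto
      have "(\<Sum>A\<in>U3. ?f A) \<le> (\<Sum>A\<in>U3. 2 * exp (- K / 2) * (tilt (2 * L) (\<Prod>A) * ln (real (\<Prod>A))))"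
      proof (intro sum_mono)
        fix A assume A: "A \<in> U3"
        have dA: "dense A" using A dU by auto
        have "\<not> ln (real (\<Prod>A)) \<le> K * L" using A ln_prod_le_iff[OF dA] by (simp add: U3_def del: of_nat_prod)
        hence lA: "ln (real (\<Prod>A)) \<ge> K * L" by simp
        have "1 * L \<le> K * L" using K L0 by (intro mult_right_mono) auto
        hence l: "ln (real (T * \<Prod>A)) \<le> 2 * ln (real (\<Prod>A))" unfolding ln_T_prod[OF dA] using lA LT by linarith
        have "- ln (real (\<Prod>A)) / (2 * L) \<le> - K / 2" using lA L0 by (simp add: field_simps)
        hence e: "exp (- ln (real (\<Prod>A)) / (2 * L)) \<le> exp (- K / 2)" by (subst exp_le_cancel_iff)
        have "tilt L (\<Prod>A) = tilt (2 * L) (\<Prod>A) * exp (- ln (real (\<Prod>A)) / (2 * L))"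
        proof -
          have "- ln (real (\<Prod>A)) / L = - ln (real (\<Prod>A)) / (2 * L) + - ln (real (\<Prod>A)) / (2 * L)"
            by (simp del: of_nat_prod)
          hence "exp (- ln (real (\<Prod>A)) / L) = exp (- ln (real (\<Prod>A)) / (2 * L)) * exp (- ln (real (\<Prod>A)) / (2 * L))"
            by (simp only: exp_add)
          thus ?thesis unfolding tilt_def by (simp del: of_nat_prod)
        qed
        also have "\<dots> \<le> tilt (2 * L) (\<Prod>A) * exp (- K / 2)"
          using e tilt_nonneg by (intro mult_left_mono) auto
        finally have tl: "tilt L (\<Prod>A) \<le> tilt (2 * L) (\<Prod>A) * exp (- K / 2)" .
        have "?f A \<le> tilt (2 * L) (\<Prod>A) * exp (- K / 2) * (2 * ln (real (\<Prod>A)))"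
          using tl l lTA[OF dA] tilt_nonneg by (intro mult_mono) (auto simp del: of_nat_prod of_nat_mult)
        thus "?f A \<le> 2 * exp (- K / 2) * (tilt (2 * L) (\<Prod>A) * ln (real (\<Prod>A)))"
          by (simp del: of_nat_prod of_nat_mult add: mult_ac)
      qed
      also have "\<dots> = 2 * exp (- K / 2) * (\<Sum>A\<in>U3. tilt (2 * L) (\<Prod>A) * ln (real (\<Prod>A)))"
        by (rule sum_distrib_left[symmetric])
      also have "\<dots> \<le> 2 * exp (- K / 2) * (\<Sum>A\<in>?B. tilt (2 * L) (\<Prod>A) * ln (real (\<Prod>A)))"
        using sub finB ln_prod_dense_nonneg
        by (intro mult_left_mono sum_mono2) (auto simp: tilt_nonneg dense_upto_def intro!: mult_nonneg_nonneg simp del: of_nat_prod)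
      also have "\<dots> \<le> 2 * exp (- K / 2) * (3 * (ln (real T) + 10) * (1 + 2 * L))"
        using L0 by (intro mult_left_mono sum_tilt_ln_upper[OF _ Z1]) auto
      also have "\<dots> \<le> 2 * exp (- K / 2) * (3 * C5 * (3 * L))"
        unfolding C5_def using L1 ln_T_nonneg by (intro mult_left_mono) auto
      also have "\<dots> = 18 * C5 * exp (- K / 2) * L" by simp
      also have "\<dots> \<le> c2 / 4 * L" using expK L0 by (intro mult_right_mono) auto
      finally show ?thesis .
    qed
    have S2: "(\<Sum>A\<in>U2. ?f A) \<le> 2 * K * L * mass \<delta> K L"
    proof -
      have "(\<Sum>A\<in>U2. ?f A) \<le> (\<Sum>A\<in>U2. 2 * K * L * (1 / real (\<Prod>A)))"
      proof (intro sum_mono)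
        fix A assume A: "A \<in> U2"
        have dA: "dense A" using A dU by auto
        have "ln (real (\<Prod>A)) \<le> K * L" using A ln_prod_le_iff[OF dA] by (simp add: U2_def del: of_nat_prod)
        moreover have "1 * L \<le> K * L" using K L0 by (intro mult_right_mono) auto
        ultimately have l: "ln (real (T * \<Prod>A)) \<le> 2 * K * L" unfolding ln_T_prod[OF dA] using LT by linarith
        have "?f A \<le> ln (real (T * \<Prod>A)) / real (\<Prod>A)" by (rule ftilt[OF dA])
        also have "\<dots> \<le> 2 * K * L / real (\<Prod>A)"
          using l real_prod_dense_pos[OF dA] by (intro divide_right_mono) (auto simp del: of_nat_prod)
        finally show "?f A \<le> 2 * K * L * (1 / real (\<Prod>A))" by (simp del: of_nat_prod of_nat_mult)
      qed
      also have "\<dots> = 2 * K * L * (\<Sum>A\<in>U2. 1 / real (\<Prod>A))" by (rule sum_distrib_left[symmetric])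
      also have "\<dots> \<le> 2 * K * L * mass \<delta> K L"
        unfolding mass_def using K L0
        by (intro mult_left_mono sum_mono2 finite_mid_dense) (auto simp: U2_def mid_dense_def dense_upto_def simp del: of_nat_prod)
      finally show ?thesis .
    qed
    have "c2 * L \<le> (\<Sum>A\<in>dense_upto Z. ?f A)"
      using sum_tilt_ln_lower[OF T L1 Z] by (simp add: c2_def del: of_nat_prod of_nat_mult)
    also have "\<dots> = (\<Sum>A\<in>U1. ?f A) + ((\<Sum>A\<in>U2. ?f A) + (\<Sum>A\<in>U3. ?f A))"
      unfolding U using fin disj by (simp only: sum.union_disjoint finite_Un)
    also have "\<dots> \<le> c2 / 4 * L + (2 * K * L * mass \<delta> K L + c2 / 4 * L)" using S1 S2 S3 by linarith
    finally have "c2 / 2 * L \<le> 2 * K * mass \<delta> K L * L" by (simp add: algebra_simps)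
    hence "c2 / 2 \<le> 2 * K * mass \<delta> K L" using L0 by simp
    thus ?thesis using K by (simp add: field_simps)
  qed
  moreover have "c2 / (4 * K) > 0" using c2 K by simp
  ultimately show ?thesis using \<delta> K by (intro exI[of _ "c2 / (4 * K)"] exI[of _ \<delta>] exI[of _ K] exI[of _ l0]) auto
qed

end

section \<open>From reciprocal mass to a count\<close>

context prime_chain
begin

lemma card_large_le:
  assumes A: "dense A" and l: "l > 0" "y > 0" and le: "real (\<Prod>A) \<le> exp (\<beta> * l)"
  shows "real (card {q \<in> A. real q > exp (y * l)}) \<le> \<beta> / y"
proof -
  have "real (card {q \<in> A. real q > exp (y * l)}) * (y * l) \<le> ln (real (\<Prod>A))"
    using A l by (intro card_large_mult_le_ln_prod) (auto simp: dense_def prime_ge_1_nat)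
  also have "\<dots> \<le> \<beta> * l" using le ln_prod_le_iff[OF A] by blast
  finally have "(real (card {q \<in> A. real q > exp (y * l)}) * y) * l \<le> \<beta> * l" by (simp only: mult.assoc)
  hence "real (card {q \<in> A. real q > exp (y * l)}) * y \<le> \<beta>" using l by simp
  thus ?thesis using l by (simp add: field_simps)
qed

lemma real_prod_insert: "dense A \<Longrightarrow> q \<notin> A \<Longrightarrow> real (\<Prod>(insert q A)) = real q * real (\<Prod>A)"
  by (simp add: dense_def)

text \<open>Append a prime q with e^(4/5 \<eta> l) < q <= e^(\<eta> l). Since \<eta> <= \<alpha>, q
  is at most the product and the enlarged set stays dense. By Mertens the sum of 1/q is bounded
  below, and every enlarged set arises from at most m pairs.\<close>

lemma mass_amplify:
  assumes \<eta>: "0 < \<eta>" "\<eta> \<le> \<alpha>" and \<beta>: "0 \<le> \<beta>" and c: "c > 0" "\<And>l. l \<ge> l0 \<Longrightarrow> mass \<alpha> \<beta> l \<ge> c"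
  shows "\<exists>c>0. \<exists>l0. \<forall>l\<ge>l0. mass (\<alpha> + 4/5 * \<eta>) (\<beta> + \<eta>) l \<ge> c"
proof -
  define y where "y = 4/5 * \<eta>"
  have y: "y > 0" "y \<le> \<eta>" using \<eta> by (auto simp: y_def)
  define m where "m = (\<beta> + \<eta>) / y"
  have m: "m > 0" using \<beta> \<eta> y by (simp add: m_def)
  \<comment> \<open>The term 400 / \<eta> makes the Mertens error 20 at most \<eta> l / 20, so the
    sum of 1/q is at least 1/5 - 1/20. The term 20 m / y keeps the primes already in A below 1/20 of
    that sum, and t / y forces q > t.\<close>
  define l1 where "l1 = max l0 (max (400 / \<eta>) (max (20 * m / y) (real t / y)))"
  have "mass (\<alpha> + y) (\<beta> + \<eta>) l \<ge> c / (10 * m)" if l: "l \<ge> l1" for l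
  proof -
    have l': "l \<ge> l0" "\<eta> * l \<ge> 400" "y * l \<ge> 20 * m" "y * l \<ge> real t"
      using l \<eta> y by (auto simp: l1_def field_simps)
    have "0 < \<eta> * l" using l'(2) by linarith
    hence lpos: "l > 0" using \<eta> by (simp add: zero_less_mult_iff)
    have ey: "exp (y * l) \<ge> y * l + 1" using exp_ge_add_one_self[of "y * l"] by linarith
    have ey1: "exp (y * l) \<ge> 1" using y lpos by simp
    define Q where "Q = {p. prime p \<and> exp (y * l) < real p \<and> real p \<le> exp (\<eta> * l)}"
    have finQ: "finite Q" unfolding Q_def by (rule finite_subset[OF _ finite_primes_real_le[of "exp (\<eta> * l)"]]) auto
    have sumQ: "(\<Sum>q\<in>Q. 1 / real q) \<ge> 3/20"
    proof -
      have "exp (y * l) \<le> exp (\<eta> * l)" using y lpos by simp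
      from sum_primes_between_ge[OF ey1 this]
      have "\<eta> * l - y * l - 20 \<le> (\<Sum>q\<in>Q. ln (real q) / real q)" unfolding Q_def by simp
      also have "\<dots> \<le> (\<Sum>q\<in>Q. \<eta> * l * (1 / real q))"
      proof (intro sum_mono)
        fix q assume q: "q \<in> Q"
        hence q0: "real q > 0" by (auto simp: Q_def prime_gt_0_nat)
        have "ln (real q) \<le> ln (exp (\<eta> * l))" using q q0 by (subst ln_le_cancel_iff) (auto simp: Q_def)
        hence "ln (real q) / real q \<le> \<eta> * l / real q" using q0 by (intro divide_right_mono) auto
        thus "ln (real q) / real q \<le> \<eta> * l * (1 / real q)" by simp
      qed
      also have "\<dots> = \<eta> * l * (\<Sum>q\<in>Q. 1 / real q)" by (rule sum_distrib_left[symmetric])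
      finally have "\<eta> * l * (3/20) \<le> \<eta> * l * (\<Sum>q\<in>Q. 1 / real q)" using l'(2) by (simp add: y_def)
      thus ?thesis using mult_le_cancel_left_pos[OF \<open>0 < \<eta> * l\<close>] by blast
    qed
    define P where "P = {(A, q). A \<in> mid_dense \<alpha> \<beta> l \<and> q \<in> Q - A}"
    have Peq: "P = (SIGMA A:mid_dense \<alpha> \<beta> l. Q - A)" by (auto simp: P_def)
    have finP: "finite P" unfolding Peq using finQ by auto
    have inner: "(\<Sum>q\<in>Q - A. 1 / real q) \<ge> 1/10" if A: "A \<in> mid_dense \<alpha> \<beta> l" for A
    proof -
      have dA: "dense A" using A by (simp add: mid_dense_def)
      have "(\<Sum>q\<in>Q \<inter> A. 1 / real q) \<le> (\<Sum>q\<in>{q \<in> A. real q > exp (y * l)}. 1 / exp (y * l))"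
      proof (rule order_trans[OF sum_mono])
        show "1 / real q \<le> 1 / exp (y * l)" if "q \<in> Q \<inter> A" for q
          using that by (intro divide_left_mono) (auto simp: Q_def prime_gt_0_nat)
        show "(\<Sum>q\<in>Q \<inter> A. 1 / exp (y * l)) \<le> (\<Sum>q\<in>{q \<in> A. real q > exp (y * l)}. 1 / exp (y * l))"
          using dense_finite[OF dA] by (intro sum_mono2) (auto simp: Q_def)
      qed
      also have "\<dots> = real (card {q \<in> A. real q > exp (y * l)}) / exp (y * l)" by simp
      also have "\<dots> \<le> (\<beta> / y) / exp (y * l)"
        using A by (intro divide_right_mono card_large_le[OF dA lpos y(1)]) (auto simp: mid_dense_def)
      also have "\<dots> \<le> m / exp (y * l)"
        unfolding m_def using y \<eta> by (intro divide_right_mono) auto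
      also have "\<dots> \<le> 1/20"
      proof -
        have "20 * m \<le> exp (y * l)" using ey l'(3) by linarith
        thus ?thesis by (simp add: field_simps)
      qed
      finally have "(\<Sum>q\<in>Q \<inter> A. 1 / real q) \<le> 1/20" .
      moreover have "(\<Sum>q\<in>Q. 1 / real q) = (\<Sum>q\<in>Q \<inter> A. 1 / real q) + (\<Sum>q\<in>Q - A. 1 / real q)"
        by (rule sum.Int_Diff[OF finQ])
      ultimately show ?thesis using sumQ by linarith
    qed
    have "c / 10 \<le> 1/10 * mass \<alpha> \<beta> l" using c(2)[OF l'(1)] by simp
    also have "\<dots> \<le> (\<Sum>A\<in>mid_dense \<alpha> \<beta> l. 1 / real (\<Prod>A) * (\<Sum>q\<in>Q - A. 1 / real q))"
    proof -
      have "(\<Sum>A\<in>mid_dense \<alpha> \<beta> l. 1 / real (\<Prod>A) * (1/10)) \<le> (\<Sum>A\<in>mid_dense \<alpha> \<beta> l. 1 / real (\<Prod>A) * (\<Sum>q\<in>Q - A. 1 / real q))"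
        using inner by (intro sum_mono mult_left_mono) (auto simp del: of_nat_prod)
      thus ?thesis unfolding mass_def sum_distrib_right[symmetric] by (simp only: mult.commute)
    qed
    also have "\<dots> = (\<Sum>A\<in>mid_dense \<alpha> \<beta> l. \<Sum>q\<in>Q - A. 1 / real (\<Prod>(insert q A)))"
    proof (intro sum.cong refl)
      fix A assume "A \<in> mid_dense \<alpha> \<beta> l"
      hence dA: "dense A" by (simp add: mid_dense_def)
      have "1 / real (\<Prod>A) * (\<Sum>q\<in>Q - A. 1 / real q) = (\<Sum>q\<in>Q - A. 1 / real (\<Prod>A) * (1 / real q))"
        by (rule sum_distrib_left)
      also have "\<dots> = (\<Sum>q\<in>Q - A. 1 / real (\<Prod>(insert q A)))"
        using real_prod_insert[OF dA] by (intro sum.cong refl) (simp del: of_nat_prod prod.insert add: mult.commute)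
      finally show "1 / real (\<Prod>A) * (\<Sum>q\<in>Q - A. 1 / real q) = (\<Sum>q\<in>Q - A. 1 / real (\<Prod>(insert q A)))" .
    qed
    also have "\<dots> = (\<Sum>(A, q)\<in>P. 1 / real (\<Prod>(insert q A)))"
      unfolding Peq using finQ by (intro sum.Sigma) auto
    also have "\<dots> \<le> m * (\<Sum>B\<in>mid_dense (\<alpha> + y) (\<beta> + \<eta>) l. 1 / real (\<Prod>B))"
    proof (rule sum_insert_pairs_le[where R = "\<lambda>q. real q > exp (y * l)" and f = "\<lambda>B. 1 / real (\<Prod>B)", OF finP])
      fix A q assume Aq: "(A, q) \<in> P"
      hence A: "dense A" "exp (\<alpha> * l) < real (\<Prod>A)" "real (\<Prod>A) \<le> exp (\<beta> * l)"
        and q: "prime q" "exp (y * l) < real q" "real q \<le> exp (\<eta> * l)" "q \<notin> A"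
        by (auto simp: P_def mid_dense_def Q_def)
      show "q \<notin> A \<and> exp (y * l) < real q" using q by simp
      have "real t < real q" using q ey l'(4) by linarith
      hence tq: "t < q" by simp
      have "exp (\<eta> * l) \<le> exp (\<alpha> * l)" using \<eta> lpos by simp
      hence "real q \<le> real (\<Prod>A)" using q A by linarith
      hence "q \<le> \<Prod>A" by (subst (asm) of_nat_le_iff)
      also have "\<dots> \<le> T * \<Prod>A" using T_pos by simp
      finally have "dense (insert q A)" using dense_insert[OF A(1) q(1) tq _ q(4)] by blast
      moreover have "exp ((\<alpha> + y) * l) < real (\<Prod>(insert q A))"
      proof -
        have "exp ((\<alpha> + y) * l) = exp (y * l) * exp (\<alpha> * l)" by (simp add: distrib_right exp_add)
        also have "\<dots> < real q * real (\<Prod>A)"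
          using less_trans[OF exp_gt_zero q(2)] q A by (intro mult_strict_mono) (auto simp del: of_nat_prod)
        finally show ?thesis unfolding real_prod_insert[OF A(1) q(4)] .
      qed
      moreover have "real (\<Prod>(insert q A)) \<le> exp ((\<beta> + \<eta>) * l)"
      proof -
        have "real q * real (\<Prod>A) \<le> exp (\<eta> * l) * exp (\<beta> * l)"
          using q A by (intro mult_mono) (auto simp del: of_nat_prod)
        also have "\<dots> = exp ((\<beta> + \<eta>) * l)" by (simp add: distrib_right exp_add)
        finally show ?thesis unfolding real_prod_insert[OF A(1) q(4)] .
      qed
      ultimately show "insert q A \<in> mid_dense (\<alpha> + y) (\<beta> + \<eta>) l" unfolding mid_dense_def by blast
    next
      fix B assume "B \<in> mid_dense (\<alpha> + y) (\<beta> + \<eta>) l"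
      hence B: "dense B" "real (\<Prod>B) \<le> exp ((\<beta> + \<eta>) * l)" by (auto simp: mid_dense_def)
      show "finite B \<and> real (card {q \<in> B. exp (y * l) < real q}) \<le> m"
        using card_large_le[OF B(1) lpos y(1) B(2)] dense_finite[OF B(1)] by (simp add: m_def)
    qed (auto simp del: of_nat_prod)
    finally have "c / 10 \<le> m * mass (\<alpha> + y) (\<beta> + \<eta>) l" by (simp only: mass_def)
    thus ?thesis using m by (simp add: field_simps)
  qed
  moreover have "c / (10 * m) > 0" using c m by simp
  ultimately show ?thesis unfolding y_def by blast
qed

text \<open>Rescaling l by 10 K moves the window to (\<eta>, 1/10]. Each amplification raises its
  ends by 4/5 \<eta> and \<eta>. When the lower end reaches 1/2, the upper one is at most 1/10 + 5/4
  * 1/2 = 0.725 < 3/4; the ratio 4/5 has to be this close to 1 for that reason.\<close>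

lemma mass_half:
  assumes T: "ln (real T) \<ge> ln (real t) + 29"
  shows "\<exists>c>0. \<exists>l0. \<forall>l\<ge>l0. mass (1/2) (3/4) l \<ge> c"
proof -
  obtain c \<delta> K l0 where c: "0 < c" "0 < \<delta>" "\<delta> \<le> 1" "1 \<le> K" "\<And>l. l \<ge> l0 \<Longrightarrow> mass \<delta> K l \<ge> c"
    using mass_lower[OF T] by blast
  define \<eta> where "\<eta> = \<delta> / (10 * K)"
  have \<eta>: "0 < \<eta>" "\<eta> \<le> 1/10" using c by (auto simp: \<eta>_def field_simps)
  have base: "mass \<eta> (1/10) l \<ge> c" if "l \<ge> 10 * K * l0" for l
  proof -
    have "l / (10 * K) \<ge> l0" using that c by (simp add: field_simps)
    moreover have "mass \<delta> K (l / (10 * K)) = mass \<eta> (1/10) l"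
      using c(4) by (simp add: mass_def mid_dense_def \<eta>_def)
    ultimately show ?thesis using c(5) by metis
  qed
  have iter: "\<exists>c>0. \<exists>l0. \<forall>l\<ge>l0. mass (\<eta> + 4/5 * \<eta> * real j) (1/10 + \<eta> * real j) l \<ge> c" for j
  proof (induction j)
    case 0
    show ?case using base c(1) by auto
  next
    case (Suc j)
    then obtain c l0 where cl: "c > 0" "\<And>l. l \<ge> l0 \<Longrightarrow> mass (\<eta> + 4/5 * \<eta> * real j) (1/10 + \<eta> * real j) l \<ge> c" by blast
    have "\<exists>c>0. \<exists>l0. \<forall>l\<ge>l0. mass (\<eta> + 4/5 * \<eta> * real j + 4/5 * \<eta>) (1/10 + \<eta> * real j + \<eta>) l \<ge> c"
      by (rule mass_amplify[OF \<eta>(1) _ _ cl]) (use \<eta> in auto)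
    moreover have "\<eta> + 4/5 * \<eta> * real j + 4/5 * \<eta> = \<eta> + 4/5 * \<eta> * real (Suc j)"
      "1/10 + \<eta> * real j + \<eta> = 1/10 + \<eta> * real (Suc j)"
      by (simp_all only: of_nat_Suc distrib_left mult_1_right add_ac)
    ultimately show ?case by (simp only:)
  qed
  define j where "j = nat \<lceil>(1/2 - \<eta>) / (4/5 * \<eta>)\<rceil>"
  have "(1/2 - \<eta>) / (4/5 * \<eta>) \<ge> 0" using \<eta> by simp
  hence j: "real j \<ge> (1/2 - \<eta>) / (4/5 * \<eta>)" "real j \<le> (1/2 - \<eta>) / (4/5 * \<eta>) + 1"
    unfolding j_def by linarith+
  have pos: "4/5 * \<eta> > 0" using \<eta> by simp
  have eq: "real j * (4/5 * \<eta>) = 4/5 * (\<eta> * real j)" "4/5 * \<eta> * real j = 4/5 * (\<eta> * real j)" by simp_all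
  have "1/2 - \<eta> \<le> real j * (4/5 * \<eta>)" using j(1) by (subst (asm) pos_divide_le_eq[OF pos])
  hence a: "\<eta> + 4/5 * \<eta> * real j \<ge> 1/2" unfolding eq by linarith
  have "real j - 1 \<le> (1/2 - \<eta>) / (4/5 * \<eta>)" using j(2) by linarith
  hence "(real j - 1) * (4/5 * \<eta>) \<le> 1/2 - \<eta>" by (subst (asm) pos_le_divide_eq[OF pos])
  hence "4/5 * (\<eta> * real j) - 4/5 * \<eta> \<le> 1/2 - \<eta>" by (simp only: left_diff_distrib mult_1_left eq)
  hence b: "1/10 + \<eta> * real j \<le> 3/4" using \<eta> by linarith
  obtain c' l1 where c': "c' > 0" "\<And>l. l \<ge> l1 \<Longrightarrow> mass (\<eta> + 4/5 * \<eta> * real j) (1/10 + \<eta> * real j) l \<ge> c'"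
    using iter[of j] by blast
  have "mass (1/2) (3/4) l \<ge> c'" if l: "l \<ge> max 0 l1" for l
  proof -
    have "c' \<le> mass (\<eta> + 4/5 * \<eta> * real j) (1/10 + \<eta> * real j) l" using c' l by simp
    also have "\<dots> \<le> mass (1/2) (3/4) l"
      unfolding mass_def
    proof (rule sum_mono2)
      define E1 E2 E3 E4 where E: "E1 = exp (1/2 * l)" "E2 = exp ((\<eta> + 4/5 * \<eta> * real j) * l)"
        "E3 = exp ((1/10 + \<eta> * real j) * l)" "E4 = exp (3/4 * l)"
      have "E1 \<le> E2"
        unfolding E using a l by (subst exp_le_cancel_iff, intro mult_right_mono) auto
      moreover have "E3 \<le> E4"
        unfolding E using b l by (subst exp_le_cancel_iff, intro mult_right_mono) auto
      ultimately show "mid_dense (\<eta> + 4/5 * \<eta> * real j) (1/10 + \<eta> * real j) l \<subseteq> mid_dense (1/2) (3/4) l"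
        unfolding mid_dense_def E[symmetric] by (auto simp del: of_nat_prod)
    qed (auto simp del: of_nat_prod)
    finally show ?thesis .
  qed
  thus ?thesis using c'(1) by blast
qed

text \<open>Each A in the window is completed by a prime q just below y = e^l / a, where a is its
  product. Since a > e^(l/2), y is below a and density is automatic. There are of order y / l
  choices of q, which sums to e^l / l times the reciprocal mass. As q > e^(l/8), a set of product at
  most e^l arises at most 8 times.\<close>

lemma card_dense_le_lower:
  assumes T: "ln (real T) \<ge> ln (real t) + 29"
  shows "\<exists>c>0. \<exists>l0. \<forall>l\<ge>l0. real (card (dense_le l)) \<ge> c * (exp l / l)"
proof -
  obtain c l0 where c: "c > 0" "\<And>l. l \<ge> l0 \<Longrightarrow> mass (1/2) (3/4) l \<ge> c" using mass_half[OF T] by blast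
  \<comment> \<open>21 exceeds by 1 the error 20 of a Mertens sum over an interval, so the primes in
    (y / H, y] have a sum of ln q / q of at least 1.\<close>
  define H where "H = exp (21 :: real)"
  have H: "H > 0" "H \<ge> 1" by (simp_all add: H_def)
  \<comment> \<open>l >= 168 means l/8 + 21 <= l/4, whence y / H >= e^(l/8). With y >= l^2 / 32, the
    bound 512 H gives y / (l H) >= 16, so that discarding 6 primes costs less than half. The last
    bound ensures q > t.\<close>
  define l1 where "l1 = max l0 (max (512 * H) (max 168 (8 * real t)))"
  have "real (card (dense_le l)) \<ge> c / (16 * H) * (exp l / l)" if l: "l \<ge> l1" for l
  proof -
    have l': "l \<ge> l0" "l \<ge> 512 * H" "l \<ge> 168" "l \<ge> 8 * real t" using l by (auto simp: l1_def)
    have lpos: "l > 0" using l' by linarith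
    define Q where "Q = (\<lambda>A. {q. prime q \<and> exp l / real (\<Prod>A) / H < real q \<and> real q \<le> exp l / real (\<Prod>A)})"
    have finQ: "finite (Q A)" for A
      unfolding Q_def by (rule finite_subset[OF _ finite_primes_real_le[of "exp l / real (\<Prod>A)"]]) auto
    define P where "P = (SIGMA A:mid_dense (1/2) (3/4) l. Q A - A)"
    have finP: "finite P" unfolding P_def using finQ by auto
    have yb: "exp (1/4 * l) \<le> exp l / real (\<Prod>A)" "exp l / real (\<Prod>A) < exp (1/2 * l)"
      "exp (1/8 * l) \<le> exp l / real (\<Prod>A) / H"
      if A: "A \<in> mid_dense (1/2) (3/4) l" for A
    proof -
      have dA: "dense A" and lo: "exp (1/2 * l) < real (\<Prod>A)" and hi: "real (\<Prod>A) \<le> exp (3/4 * l)"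
        using A by (auto simp: mid_dense_def)
      note pos = real_prod_dense_pos[OF dA]
      have "exp (1/4 * l) * real (\<Prod>A) \<le> exp (1/4 * l) * exp (3/4 * l)" using hi by (intro mult_left_mono) auto
      also have "\<dots> = exp l" by (simp add: exp_add[symmetric])
      finally show 1: "exp (1/4 * l) \<le> exp l / real (\<Prod>A)" using pos by (subst pos_le_divide_eq)
      have "exp l = exp (1/2 * l) * exp (1/2 * l)" by (simp add: exp_add[symmetric])
      also have "\<dots> < exp (1/2 * l) * real (\<Prod>A)" using lo by (intro mult_strict_left_mono) auto
      finally show "exp l / real (\<Prod>A) < exp (1/2 * l)" using pos by (subst pos_divide_less_eq)
      have "exp (1/8 * l) * H = exp (1/8 * l + 21)" by (simp add: H_def exp_add)
      also have "\<dots> \<le> exp (1/4 * l)" using l'(3) by simp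
      also note 1
      finally show "exp (1/8 * l) \<le> exp l / real (\<Prod>A) / H" using H by (subst pos_le_divide_eq)
    qed
    have cardQ: "real (card (Q A - A)) \<ge> exp l / (2 * H * l) * (1 / real (\<Prod>A))" if A: "A \<in> mid_dense (1/2) (3/4) l" for A
    proof -
      define y where "y = exp l / real (\<Prod>A)"
      have dA: "dense A" and hi: "real (\<Prod>A) \<le> exp (3/4 * l)" using A by (auto simp: mid_dense_def)
      note y = yb[OF A, folded y_def]
      have "exp (1/8 * l) \<ge> 1" using lpos by simp
      hence yH1: "y / H \<ge> 1" using y(3) by linarith
      have "exp (1/4 * l) \<ge> 1" using lpos by simp
      hence y1: "y \<ge> 1" using y(1) by linarith
      have lny: "ln y \<le> l"
      proof -
        have "ln y \<le> ln (exp (1/2 * l))" using y(2) y1 by (subst ln_le_cancel_iff) auto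
        thus ?thesis using lpos by simp
      qed
      have "y / H \<le> y" using H y1 by (simp add: field_simps)
      from sum_primes_between_ge[OF yH1 this]
      have "ln y - ln (y / H) - 20 \<le> (\<Sum>q\<in>Q A. ln (real q) / real q)" unfolding Q_def y_def by simp
      moreover have "ln (y / H) = ln y - 21" using y1 H by (simp add: ln_div H_def)
      ultimately have "1 \<le> (\<Sum>q\<in>Q A. ln (real q) / real q)" by simp
      also have "\<dots> \<le> (\<Sum>q\<in>Q A. l * H / y)"
      proof (intro sum_mono)
        fix q assume q: "q \<in> Q A"
        hence q': "y / H < real q" "real q \<le> y" "real q > 0" by (auto simp: Q_def y_def prime_gt_0_nat)
        have "ln (real q) \<le> ln y" using q' by (subst ln_le_cancel_iff) auto
        hence "ln (real q) \<le> l" using lny by linarith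
        hence "ln (real q) / real q \<le> l / real q" using q' by (intro divide_right_mono) auto
        also have "\<dots> \<le> l / (y / H)"
        proof (rule divide_left_mono)
          have "0 < y / H" using yH1 by linarith
          with q'(3) show "0 < real q * (y / H)" by (rule mult_pos_pos)
        qed (use q' lpos in auto)
        finally show "ln (real q) / real q \<le> l * H / y" by simp
      qed
      also have "\<dots> = real (card (Q A)) * (l * H / y)" by simp
      finally have "y / (l * H) \<le> real (card (Q A))" using y1 lpos H by (simp add: field_simps)
      moreover have "real (card (Q A \<inter> A)) \<le> 6"
      proof -
        have "card (Q A \<inter> A) \<le> card {q \<in> A. real q > exp (1/8 * l)}"
          using dense_finite[OF dA] y(3) by (intro card_mono) (auto simp: Q_def y_def simp del: of_nat_prod)
        also have "real \<dots> \<le> (3/4) / (1/8)" by (rule card_large_le[OF dA lpos _ hi]) simp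
        finally show ?thesis by simp
      qed
      moreover have "card (Q A) = card (Q A \<inter> A) + card (Q A - A)"
        using finQ[of A] by (metis card_Int_Diff)
      ultimately have 1: "real (card (Q A - A)) \<ge> y / (l * H) - 6" by simp
      have "(1/4 * l)\<^sup>2 / 2 \<le> exp (1/4 * l)"
        using exp_lower_Taylor_quadratic[of "1/4 * l"] lpos by simp
      hence "l * l / 32 \<le> y" using y(1) by (simp add: power2_eq_square)
      moreover have "l * (512 * H) \<le> l * l" using l'(2) lpos by (intro mult_left_mono) auto
      ultimately have "16 * (l * H) \<le> y" by linarith
      define z where "z = y / (l * H)"
      have "z \<ge> 16" using \<open>16 * (l * H) \<le> y\<close> lpos H by (simp add: z_def field_simps)
      hence "z - 6 \<ge> z / 2" by simp
      with 1 have "real (card (Q A - A)) \<ge> y / (l * H) / 2" unfolding z_def by linarith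
      thus ?thesis by (simp add: y_def field_simps del: of_nat_prod)
    qed
    have "c * (exp l / (2 * H * l)) \<le> exp l / (2 * H * l) * mass (1/2) (3/4) l"
      using c(2)[OF l'(1)] lpos H by (simp add: mult.commute mult_left_mono divide_right_mono)
    also have "\<dots> = (\<Sum>A\<in>mid_dense (1/2) (3/4) l. exp l / (2 * H * l) * (1 / real (\<Prod>A)))"
      unfolding mass_def by (rule sum_distrib_left)
    also have "\<dots> \<le> (\<Sum>A\<in>mid_dense (1/2) (3/4) l. real (card (Q A - A)))"
      by (intro sum_mono cardQ)
    also have "\<dots> = (\<Sum>(A, q)\<in>P. 1)"
      unfolding P_def using finQ by (subst sum.Sigma[symmetric]) auto
    also have "\<dots> \<le> 8 * (\<Sum>B\<in>dense_le l. 1)"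
    proof (rule sum_insert_pairs_le[where R = "\<lambda>q. real q > exp (1/8 * l)" and f = "\<lambda>_. 1", OF finP])
      fix A q assume Aq: "(A, q) \<in> P"
      hence A: "A \<in> mid_dense (1/2) (3/4) l" and qA: "q \<in> Q A" "q \<notin> A" by (auto simp: P_def)
      have dA: "dense A" and lo: "exp (1/2 * l) < real (\<Prod>A)" using A by (auto simp: mid_dense_def)
      have q: "prime q" "exp (1/8 * l) < real q" "real q \<le> exp l / real (\<Prod>A)"
        using qA yb(3)[OF A] by (auto simp: Q_def simp del: of_nat_prod)
      show "q \<notin> A \<and> exp (1/8 * l) < real q" using q qA by simp
      have "1/8 * l + 1 \<le> exp (1/8 * l)" using exp_ge_add_one_self[of "1/8 * l"] by linarith
      hence "real t < real q" using q(2) l'(4) by linarith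
      hence tq: "t < q" by simp
      have "real q \<le> real (\<Prod>A)" using q(3) yb(2)[OF A] lo by linarith
      hence "q \<le> \<Prod>A" by (subst (asm) of_nat_le_iff)
      also have "\<dots> \<le> T * \<Prod>A" using T_pos by simp
      finally have "dense (insert q A)" using dense_insert[OF dA q(1) tq _ qA(2)] by blast
      moreover have "real (\<Prod>(insert q A)) \<le> exp l"
        unfolding real_prod_insert[OF dA qA(2)] using q(3) real_prod_dense_pos[OF dA]
        by (subst (asm) pos_le_divide_eq) auto
      ultimately show "insert q A \<in> dense_le l" unfolding dense_le_def by blast
    next
      fix B assume "B \<in> dense_le l"
      hence B: "dense B" "real (\<Prod>B) \<le> exp (1 * l)" by (auto simp: dense_le_def)
      have "real (card {q \<in> B. real q > exp (1/8 * l)}) \<le> 1 / (1/8)"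
        by (rule card_large_le[OF B(1) lpos _ B(2)]) simp
      thus "finite B \<and> real (card {q \<in> B. exp (1/8 * l) < real q}) \<le> 8" using dense_finite[OF B(1)] by simp
    qed auto
    finally show ?thesis using H lpos by (simp add: field_simps)
  qed
  moreover have "c / (16 * H) > 0" using c H by simp
  ultimately show ?thesis by blast
qed

end

section \<open>Practical numbers from dense sets\<close>

lemma (in prime_chain) dense_remove_max:
  assumes S: "dense (insert q A)" and q: "\<forall>a\<in>A. a < q"
  shows "dense A" "prime q" "t < q" "q \<le> T * \<Prod>A"
proof -
  have fin: "finite A" using S by (simp add: dense_def)
  show "prime q" "t < q" using S by (auto simp: dense_def)
  have "{p \<in> insert q A. p < q} = A" using q by auto
  thus "q \<le> T * \<Prod>A" using S by (auto simp: dense_def)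
  have "{p \<in> insert q A. p < r} = {p \<in> A. p < r}" if "r \<in> A" for r using q that by auto
  thus "dense A" using S fin unfolding dense_def by (metis insertCI)
qed

lemma prime_not_dvd_prod_primes:
  fixes S :: "nat set"
  assumes "finite S" "\<And>p. p \<in> S \<Longrightarrow> prime p" "prime q" "q \<notin> S"
  shows "\<not> q dvd \<Prod>S"
proof
  assume "q dvd \<Prod>S"
  then obtain p where p: "p \<in> S" "q dvd p" using prime_dvd_prod_iff[OF assms(1,3)] by auto
  hence "q = p" using assms primes_dvd_imp_eq by blast
  thus False using p assms by simp
qed

text \<open>Induction on the largest prime: \<open>2 * T \<le> M * b\<close> turns its density
  condition into the size condition of both extension steps, and t separates the chain from the
  primes of b.\<close>

lemma practical_chain:
  assumes l: "prime l" and M: "M = l ^ k" and b: "b > 0" and chain: "prime_chain t T"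
    and T: "2 * T \<le> M * b" and bt: "\<And>p. prime p \<Longrightarrow> p dvd b \<Longrightarrow> p \<le> t"
    and c: "nearly_covers (cyc_degrees M b) (M * b)" and h: "has_all_degrees l (M * b)"
    and S: "prime_chain.dense t T S"
  shows "nearly_covers (cyc_degrees M (b * \<Prod>S)) (M * (b * \<Prod>S)) \<and> has_all_degrees l (M * (b * \<Prod>S))"
proof -
  interpret prime_chain t T by (rule chain)
  have "finite S" using S by (rule dense_finite)
  thus ?thesis using S
  proof (induction S rule: finite_linorder_max_induct)
    case empty
    thus ?case using c h by simp
  next
    case (insert q A)
    note R = dense_remove_max[OF insert.prems insert.hyps(2)]
    have IH: "nearly_covers (cyc_degrees M (b * \<Prod>A)) (M * (b * \<Prod>A))" "has_all_degrees l (M * (b * \<Prod>A))"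
      using insert.IH R(1) by auto
    have qA: "q \<notin> A" using insert.hyps by auto
    have "\<not> q dvd \<Prod>A"
      by (rule prime_not_dvd_prod_primes[OF dense_finite[OF R(1)] dense_prime[OF R(1)] R(2) qA])
    moreover have "\<not> q dvd b"
    proof
      assume "q dvd b"
      from bt[OF R(2) this] R(3) show False by simp
    qed
    ultimately have nd: "\<not> q dvd b * \<Prod>A" using R(2) by (simp add: prime_dvd_mult_iff)
    have pos: "b * \<Prod>A > 0" using b dense_prod_pos[OF R(1)] by simp
    have "2 * (q - 1) \<le> 2 * (T * \<Prod>A)" using R(4) by simp
    also have "\<dots> = 2 * T * \<Prod>A" by simp
    also have "\<dots> \<le> M * b * \<Prod>A" using T by (rule mult_le_mono1)
    finally have le: "2 * (q - 1) \<le> M * (b * \<Prod>A)" by (simp only: mult.assoc)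
    have eq: "b * \<Prod>(insert q A) = b * \<Prod>A * q ^ Suc 0" using qA dense_finite[OF R(1)] by simp
    have "nearly_covers (cyc_degrees M (b * \<Prod>A * q ^ Suc 0)) (M * (b * \<Prod>A * q ^ Suc 0))"
      by (rule nearly_covers_step[OF R(2) nd pos le IH(1)]) (use IH(1) in simp)
    moreover have "has_all_degrees l (M * (b * \<Prod>A * q ^ Suc 0))"
      by (rule has_all_degrees_step[OF l M R(2) nd pos le IH(1)]) (use IH(2) in simp)
    ultimately show ?case unfolding eq by blast
  qed
qed

text \<open>Unique factorisation makes S -> a * \<Prod>S injective. Counting at x / a instead of x
  costs only the factor 1/a, because ln (x / a) <= ln x.\<close>

lemma count_p_practical_not_lambda:
  assumes l: "prime l" and M: "M = l ^ k" and b: "b > 0" and t: "t \<ge> 1"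
    and T: "2 * T \<le> M * b" "T \<ge> 1" "ln (real T) \<ge> ln (real t) + 29"
    and bt: "\<And>p. prime p \<Longrightarrow> p dvd b \<Longrightarrow> p \<le> t"
    and c: "nearly_covers (cyc_degrees M b) (M * b)" and h: "has_all_degrees l (M * b)"
    and nl: "\<And>S. finite S \<Longrightarrow> (\<And>q. q \<in> S \<Longrightarrow> prime q \<and> t < q) \<Longrightarrow> \<not> lambda_practical (M * b * \<Prod>S)"
  shows "\<exists>c::real. \<exists>x0::real. 0 < c \<and> 0 < x0 \<and>
      (\<forall>x::real. x0 \<le> x \<longrightarrow>
        c * (x / ln x)
          \<le> real (card {n::nat. 0 < n \<and> real n \<le> x \<and> p_practical l n \<and> \<not> lambda_practical n}))"
proof -
  have chain: "prime_chain t T" using t T by unfold_locales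
  interpret prime_chain t T by (rule chain)
  define a where "a = M * b"
  have M0: "M > 0" using M l prime_gt_0_nat by simp
  have a: "a > 0" using M0 b by (simp add: a_def)
  obtain c l0 where c0: "c > 0" "\<And>l. l \<ge> l0 \<Longrightarrow> real (card (dense_le l)) \<ge> c * (exp l / l)"
    using card_dense_le_lower[OF T(3)] by blast
  define x0 where "x0 = real a * exp (max l0 1)"
  have "c / real a * (x / ln x) \<le> real (card {n::nat. 0 < n \<and> real n \<le> x \<and> p_practical l n \<and> \<not> lambda_practical n})"
    if x: "x \<ge> x0" for x
  proof -
    let ?N = "{n::nat. 0 < n \<and> real n \<le> x \<and> p_practical l n \<and> \<not> lambda_practical n}"
    have xa: "exp (max l0 1) \<le> x / real a" using x a by (simp add: x0_def field_simps)
    have xpos: "x / real a > 0" using xa exp_gt_zero[of "max l0 1"] by linarith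
    hence x0': "x > 0" using a by (simp add: zero_less_divide_iff)
    define u where "u = ln (x / real a)"
    have "max l0 1 \<le> u" unfolding u_def using xa xpos by (metis exp_gt_zero ln_exp ln_le_cancel_iff)
    hence u: "u \<ge> l0" "u \<ge> 1" by auto
    have eu: "exp u = x / real a" unfolding u_def using xpos by simp
    have "u \<le> ln x"
    proof -
      have "x / real a \<le> x" using a x0' by (simp add: field_simps)
      thus ?thesis unfolding u_def using xpos x0' by (subst ln_le_cancel_iff)
    qed
    moreover from this have "0 < ln x * u" using u(2) by (intro mult_pos_pos) linarith+
    ultimately have "c / real a * (x / ln x) \<le> c / real a * (x / u)"
      using c0(1) x0' a by (intro mult_left_mono divide_left_mono) auto
    also have "\<dots> = c * (exp u / u)" by (simp add: eu)
    also have "\<dots> \<le> real (card (dense_le u))" by (rule c0(2)[OF u(1)])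
    also have "card (dense_le u) \<le> card ?N"
    proof (rule card_inj_on_le)
      show "inj_on (\<lambda>S. a * \<Prod>S) (dense_le u)"
      proof (rule inj_onI)
        fix S S' assume SS: "S \<in> dense_le u" "S' \<in> dense_le u" "a * \<Prod>S = a * \<Prod>S'"
        hence "\<Prod>S = \<Prod>S'" using a by simp
        thus "S = S'" using SS
          by (intro inj_onD[OF inj_on_prod_primes]) (auto simp: dense_le_def dense_def)
      qed
      show "(\<lambda>S. a * \<Prod>S) ` dense_le u \<subseteq> ?N"
      proof (rule image_subsetI)
        fix S assume "S \<in> dense_le u"
        hence S: "dense S" "real (\<Prod>S) \<le> exp u" by (auto simp: dense_le_def)
        have pos: "a * \<Prod>S > 0" using a dense_prod_pos[OF S(1)] by simp
        have "real (a * \<Prod>S) = real a * real (\<Prod>S)" by (rule of_nat_mult)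
        also have "\<dots> \<le> real a * exp u" using S(2) by (intro mult_left_mono) auto
        also have "\<dots> = x" using a by (simp add: eu)
        finally have "real (a * \<Prod>S) \<le> x" .
        moreover have "has_all_degrees l (a * \<Prod>S)"
          using practical_chain[OF l M b chain T(1) bt c h S(1)] by (simp add: a_def mult.assoc)
        hence "p_practical l (a * \<Prod>S)" by (rule has_all_degrees_imp_p_practical[OF l pos])
        moreover have "\<not> lambda_practical (a * \<Prod>S)"
          unfolding a_def by (rule nl) (use S(1) in \<open>auto simp: dense_def\<close>)
        ultimately show "a * \<Prod>S \<in> ?N" using pos by blast
      qed
      show "finite ?N" by (rule finite_subset[of _ "{..nat \<lfloor>x\<rfloor>}"]) (auto simp: le_nat_iff le_floor_iff)
    qed
    finally show ?thesis by simp
  qed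
  moreover have "c / real a > 0" "x0 > 0" using c0 a by (auto simp: x0_def)
  ultimately show ?thesis by blast
qed

section \<open>Failure over another prime field\<close>

lemma not_dvd_prime_pow_minus_one:
  fixes p q e c :: nat
  assumes "q > p ^ c" "p > 1" "1 \<le> e" "e \<le> c"
  shows "\<not> q dvd p ^ e - 1"
proof
  assume "q dvd p ^ e - 1"
  moreover have "p ^ e > 1" using assms by (intro one_less_power) auto
  ultimately have "q \<le> p ^ e - 1" by (intro dvd_imp_le) auto
  also have "\<dots> < p ^ e" using \<open>p ^ e > 1\<close> by simp
  also have "\<dots> \<le> p ^ c" using assms by (intro power_increasing) auto
  finally show False using assms by simp
qed

lemma gcd_mult_large_primes:
  fixes S :: "nat set" and a N :: nat
  assumes "finite S" "\<And>q. q \<in> S \<Longrightarrow> prime q \<and> \<not> q dvd N"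
  shows "gcd (a * \<Prod>S) N = gcd a N"
proof -
  have "Rings.coprime N q" if "q \<in> S" for q
    using assms(2)[OF that] Factorial_Ring.prime_imp_coprime[of q N] by (simp add: ac_simps)
  hence "Rings.coprime N (\<Prod>S)" by (intro prod_coprime_right)
  thus ?thesis by (rule gcd_mult_left_right_cancel)
qed

text \<open>A prime above \<open>CARD('a) ^ (c + 1)\<close> is too large to divide any
  \<open>CARD('a) ^ e - 1\<close> with 1 <= e <= c + 1, and it differs from the
  characteristic.\<close>

lemma not_lambda_practical_of_gcd:
  fixes a c :: nat
  assumes p: "prime CARD('a :: prime_card)" and c: "0 < c" "c < a" and na: "\<not> CARD('a) dvd a"
    and g: "\<And>e. 1 \<le> e \<Longrightarrow> e \<le> c + 1 \<Longrightarrow> gcd a (CARD('a) ^ e - 1) dvd c"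
    and S: "finite S" "\<And>q. q \<in> S \<Longrightarrow> prime q \<and> CARD('a) ^ (c + 1) < q"
  shows "\<not> lambda_practical (a * \<Prod>S)"
proof -
  have p1: "CARD('a) > 1" using p prime_gt_1_nat by blast
  have "\<not> p_practical CARD('a) (a * \<Prod>S)"
  proof (rule not_p_practical)
    have "CARD('a) \<notin> S"
    proof
      assume "CARD('a) \<in> S"
      hence "CARD('a) ^ (c + 1) < CARD('a)" using S by blast
      moreover have "CARD('a) ^ 1 \<le> CARD('a) ^ (c + 1)" using p1 by (intro power_increasing) auto
      ultimately show False by simp
    qed
    hence "\<not> CARD('a) dvd \<Prod>S" using S p by (intro prime_not_dvd_prod_primes) auto
    thus "\<not> CARD('a) dvd a * \<Prod>S" using na p by (simp add: prime_dvd_mult_iff)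
    have "\<Prod>S > 0" using S by (intro prod_pos) (auto simp: prime_gt_0_nat)
    hence "a * 1 \<le> a * \<Prod>S" by (intro mult_le_mono2) simp
    thus "c < a * \<Prod>S" using c by linarith
    show "0 < c" by (rule c(1))
    fix e assume e: "1 \<le> e" "e \<le> c + 1"
    have "gcd (a * \<Prod>S) (CARD('a) ^ e - 1) = gcd a (CARD('a) ^ e - 1)"
      using S not_dvd_prime_pow_minus_one[OF _ p1 e] by (intro gcd_mult_large_primes) auto
    thus "gcd (a * \<Prod>S) (CARD('a) ^ e - 1) dvd c" using g[OF e] by simp
  qed
  thus ?thesis using p unfolding lambda_practical_def by blast
qed

text \<open>The order of choice matters: t is fixed by the excluded degree, then T of size e^29 t,
  then the exponent, which may be taken crudely because j < 2^j.\<close>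

lemma exists_large_threshold:
  fixes g t :: nat and a0 :: nat
  assumes g: "g \<ge> 2" and t: "t \<ge> 1" and a0: "a0 > 0"
  obtains j T where "j \<ge> 2" "2 * T \<le> a0 * g ^ j" "T \<ge> 1" "ln (real T) \<ge> ln (real t) + 29"
proof -
  define T where "T = nat \<lceil>real t * exp 29\<rceil>"
  define j where "j = 2 * T + 2"
  have "real t * exp 29 > 0" using t by simp
  hence T: "real T \<ge> real t * exp 29" "T \<ge> 1" unfolding T_def by linarith+
  have "ln (real t * exp 29) \<le> ln (real T)"
    using T t by (subst ln_le_cancel_iff) auto
  hence "ln (real t) + 29 \<le> ln (real T)" using t by (simp add: ln_mult)
  moreover have "2 * T \<le> a0 * g ^ j"
  proof -
    have "2 * T \<le> j" by (simp add: j_def)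
    also have "j < 2 ^ j" by (rule less_exp)
    also have "(2 :: nat) ^ j \<le> g ^ j" using g by (intro power_mono) auto
    also have "\<dots> \<le> a0 * g ^ j" using a0 by simp
    finally show ?thesis by simp
  qed
  ultimately show ?thesis using that[of j T] T by (auto simp: j_def)
qed

section \<open>The bases\<close>

lemma nearly_covers_one: "nearly_covers (cyc_degrees M 1) (M * 1)"
  unfolding nearly_covers_def
proof (intro allI impI)
  fix m assume "m \<le> M * 1"
  hence "m \<in> cyc_degrees M 1"
    unfolding cyc_degrees_def by (intro CollectI exI[of _ "\<lambda>_. m"]) auto
  thus "\<exists>A\<in>cyc_degrees M 1. A \<le> m \<and> m \<le> A + 1" by (intro bexI[of _ m]) auto
qed

lemma lead_coeff_power_monic: "Polynomial.lead_coeff (f :: int poly) = 1 \<Longrightarrow> Polynomial.lead_coeff (f ^ n) = 1"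
  by (simp add: lead_coeff_power)

lemma has_all_degrees_prime_power:
  assumes "prime l"
  shows "has_all_degrees l (l ^ k * 1)"
  unfolding has_all_degrees_def
proof (intro allI impI)
  fix m assume m: "m \<le> l ^ k * 1"
  have lc: "Polynomial.lead_coeff (unity_poly 1 :: int poly) = 1" by (rule lead_coeff_unity_poly) simp
  have "(unity_poly 1 ^ m * unity_poly 1 ^ (l ^ k - m) :: int poly) = unity_poly 1 ^ (l ^ k)"
    using m by (simp add: power_add[symmetric])
  hence "poly_cong l (unity_poly 1 ^ m * unity_poly 1 ^ (l ^ k - m)) (unity_poly (l ^ k * 1))"
    using unity_poly_power_cong[OF assms, of 1 k] by simp
  moreover have "Polynomial.degree (unity_poly 1 ^ m :: int poly) = m"
  proof -
    have "(unity_poly 1 :: int poly) \<noteq> 0" using lc by (metis leading_coeff_0_iff zero_neq_one)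
    thus ?thesis using Polynomial.degree_power_eq[of "unity_poly 1 :: int poly" m] degree_unity_poly[of 1] by simp
  qed
  ultimately show "\<exists>f g. poly_cong l (f * g) (unity_poly (l ^ k * 1)) \<and> Polynomial.degree f = m \<and> Polynomial.lead_coeff f = 1"
    using lead_coeff_power_monic[OF lc] by blast
qed

lemma divisors_7: "{d :: nat. d dvd 7} = {1, 7}"
proof -
  have "prime (7 :: nat)" by simp
  thus ?thesis by (auto simp: prime_nat_iff)
qed

text \<open>The totients 1 and 6, each with multiplicity at most 4, give i + 6k; for m = 6k + 5 the
  cap i = 4 leaves the defect 1.\<close>

lemma nearly_covers_28: "nearly_covers (cyc_degrees 4 7) (4 * 7)"
  unfolding nearly_covers_def
proof (intro allI impI)
  have tot: "totient 7 = 6" using totient_prime[of 7] by simp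
  have mem: "i + 6 * k \<in> cyc_degrees 4 7" if "i \<le> 4" "k \<le> 4" for i k
    unfolding cyc_degrees_def divisors_7 using that tot
    by (intro CollectI exI[of _ "\<lambda>d. if d = 1 then i else k"]) auto
  fix m :: nat assume m: "m \<le> 4 * 7"
  define i where "i = min 4 (m mod 6)"
  define k where "k = m div 6"
  have "m = 6 * k + m mod 6" by (simp add: k_def)
  moreover have "m mod 6 < 6" by simp
  ultimately have ik: "i \<le> 4" "k \<le> 4" "i + 6 * k \<le> m" "m \<le> i + 6 * k + 1"
    using m unfolding i_def by linarith+
  show "\<exists>A\<in>cyc_degrees 4 7. A \<le> m \<and> m \<le> A + 1"
    by (rule bexI[OF _ mem[OF ik(1,2)]]) (use ik in simp)
qed

text \<open>Over \<open>\<F>\<^sub>2\<close> the cyclotomic polynomial of order 7 splits into two cubics.\<close>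

lemma has_all_degrees_28: "has_all_degrees 2 (4 * 7)"
  unfolding has_all_degrees_def
proof (intro allI impI)
  define w where "w = ([:-1, 1:] :: int poly)"
  define u where "u = ([:1, 1, 0, 1:] :: int poly)"
  define v where "v = ([:1, 0, 1, 1:] :: int poly)"
  have lc: "Polynomial.lead_coeff w = 1" "Polynomial.lead_coeff u = 1" "Polynomial.lead_coeff v = 1"
    and deg: "Polynomial.degree w = 1" "Polynomial.degree u = 3" "Polynomial.degree v = 3"
    by (simp_all add: w_def u_def v_def)
  have ne: "w \<noteq> 0" "u \<noteq> 0" "v \<noteq> 0" by (simp_all add: w_def u_def v_def)
  have m7: "Polynomial.monom 1 7 = ([:0, 0, 0, 0, 0, 0, 0, 1:] :: int poly)"
    by (simp add: numeral_eq_Suc monom_Suc monom_0)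
  have u7: "unity_poly 7 = ([:-1, 0, 0, 0, 0, 0, 0, 1:] :: int poly)"
    by (simp only: m7 one_pCons diff_pCons diff_0_right diff_0)
  have "w * u * v = [:-1, 0, 0, -2, 2, 0, 0, 1:]"
    unfolding w_def u_def v_def
    by (simp only: mult_pCons_left mult_pCons_right smult_pCons smult_0_right mult_zero_left mult_zero_right
        add_pCons add_0_left add_0_right mult_1_left mult_minus1 minus_pCons) simp
  hence "w * u * v - unity_poly 7 = [:int 2:] * [:0, 0, 0, -1, 1:]"
    unfolding u7 by simp
  hence c7: "poly_cong 2 (w * u * v) (unity_poly 7)"
    unfolding poly_cong_def by (rule dvdI)
  fix m :: nat assume m: "m \<le> 4 * 7"
  \<comment> \<open>Up to 26 the quotient by 3 is at most 8 and splits between the two cubics. For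
    27 and 28 both cubics are exhausted and the rest comes from powers of x - 1.\<close>
  obtain i a b :: nat where iab: "i \<le> 4" "a \<le> 4" "b \<le> 4" "m = i + 3 * (a + b)"
  proof (cases "m \<le> 26")
    case True
    define k where "k = m div 3"
    have m3: "m = 3 * k + m mod 3" "m mod 3 < 3" by (simp_all add: k_def)
    hence "k \<le> 8" using True by linarith
    hence "k - min k 4 \<le> 4" "min k 4 + (k - min k 4) = k" by auto
    thus ?thesis using that[of "m mod 3" "min k 4" "k - min k 4"] m3 by simp
  next
    case False
    hence "m - 24 \<le> 4" "m = m - 24 + 3 * (4 + 4)" using m by auto
    thus ?thesis using that[of "m - 24" 4 4] by blast
  qed
  let ?f = "w ^ i * u ^ a * v ^ b" and ?g = "w ^ (4 - i) * u ^ (4 - a) * v ^ (4 - b)"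
  have "?f * ?g = (w ^ i * w ^ (4 - i)) * (u ^ a * u ^ (4 - a)) * (v ^ b * v ^ (4 - b))" by (simp only: mult_ac)
  also have "\<dots> = (w * u * v) ^ 4"
    using iab by (simp only: power_add[symmetric] le_add_diff_inverse power_mult_distrib)
  also have "poly_cong 2 \<dots> (unity_poly 7 ^ 4)" by (rule poly_cong_power[OF c7])
  also have "poly_cong 2 (unity_poly 7 ^ 4) (unity_poly (4 * 7))"
    using unity_poly_power_cong[of 2 7 2] by simp
  finally have "poly_cong 2 (?f * ?g) (unity_poly (4 * 7))" .
  moreover have "Polynomial.degree ?f = m"
    using ne deg iab(4) by (simp add: degree_mult_eq Polynomial.degree_power_eq)
  moreover have "Polynomial.lead_coeff ?f = 1"
    using lc by (simp only: lead_coeff_mult lead_coeff_power power_one mult_1)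
  ultimately show "\<exists>f g. poly_cong 2 (f * g) (unity_poly (4 * 7)) \<and> Polynomial.degree f = m \<and> Polynomial.lead_coeff f = 1"
    by blast
qed

text \<open>The prime 11 is small enough for the extension step, as 2 * 10 <= 28, and raising its
  exponent again uses the near cover for 7 alone.\<close>

lemma base_28_11:
  "nearly_covers (cyc_degrees 4 (7 * 11 ^ j)) (4 * (7 * 11 ^ j)) \<and> has_all_degrees 2 (4 * (7 * 11 ^ j))"
proof (induction j)
  case 0
  show ?case using nearly_covers_28 has_all_degrees_28 by simp
next
  case (Suc j)
  have q: "prime (11 :: nat)" "\<not> (11 :: nat) dvd 7" by simp_all
  have "nearly_covers (cyc_degrees 4 (7 * 11 ^ Suc j)) (4 * (7 * 11 ^ Suc j))"
    by (rule nearly_covers_step[OF q _ _ nearly_covers_28]) (use Suc in auto)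
  moreover have "has_all_degrees 2 (4 * (7 * 11 ^ Suc j))"
    by (rule has_all_degrees_step[OF _ _ q _ _ nearly_covers_28, of 2 2]) (use Suc in auto)
  ultimately show ?case by blast
qed

theorem theorem1p2:
  shows "\<forall>p::nat. Factorial_Ring.prime p \<longrightarrow>
    (\<exists>c::real. \<exists>x0::real. 0 < c \<and> 0 < x0 \<and>
      (\<forall>x::real. x0 \<le> x \<longrightarrow>
        c * (x / ln x)
          \<le> real (card {n::nat. 0 < n \<and> real n \<le> x \<and> p_practical p n \<and> \<not> lambda_practical n})))"
proof (intro allI impI)
  fix l :: nat assume l: "prime l"
  have cop_pow: "Rings.coprime (l ^ j) q" if "prime q" "l \<noteq> q" for j q
    using primes_coprime[OF l that] by simp
  show "\<exists>c::real. \<exists>x0::real. 0 < c \<and> 0 < x0 \<and>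
      (\<forall>x::real. x0 \<le> x \<longrightarrow>
        c * (x / ln x)
          \<le> real (card {n::nat. 0 < n \<and> real n \<le> x \<and> p_practical l n \<and> \<not> lambda_practical n}))"
  proof (cases "l = 2")
    case False
    have odd: "\<not> 2 dvd l" using primes_dvd_imp_eq[OF two_is_prime_nat l] False by auto
    have l3: "l \<ge> 3" using l False prime_ge_2_nat[of l] by simp
    \<comment> \<open>Over F_2: for l > 3 the power of l is coprime to 2^e - 1 for e <= 2, so degree
      2 is missing. For l = 3 the gcds with 1, 3, 7, 15 are 1, 3, 1, 3, so degree 4 is
      missing.\<close>
    define c :: nat where "c = (if l = 3 then 3 else 1)"
    define t :: nat where "t = 2 ^ (c + 1)"
    have t1: "t \<ge> 1" by (simp add: t_def)
    have l2: "l \<ge> 2" using l3 by simp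
    obtain j T where jT: "j \<ge> 2" "2 * T \<le> 1 * l ^ j" "T \<ge> 1" "ln (real T) \<ge> ln (real t) + 29"
      by (rule exists_large_threshold[OF l2 t1, of 1]) auto
    have T: "2 * T \<le> l ^ j * 1" using jT(2) by simp
    have lj: "l ^ j \<ge> 9"
    proof -
      have "(3 :: nat) ^ 2 \<le> l ^ 2" using l3 by (intro power_mono) auto
      also have "\<dots> \<le> l ^ j" using l3 jT by (intro power_increasing) auto
      finally show ?thesis by simp
    qed
    have g: "gcd (l ^ j * 1) (CARD(bool) ^ e - 1) dvd c" if e: "1 \<le> e" "e \<le> c + 1" for e
    proof (cases "l = 3")
      case True
      have "e = 1 \<or> e = 2 \<or> e = 3 \<or> e = 4" using e True by (auto simp: c_def)
      moreover have "gcd (l ^ j) 7 = 1" "gcd (l ^ j) 5 = 1"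
        using cop_pow[of 7 j] cop_pow[of 5 j] True by (simp_all add: coprime_iff_gcd_eq_1)
      moreover have "gcd (l ^ j) 15 dvd 3"
      proof -
        have "Rings.coprime (l ^ j) 5" using cop_pow[of 5 j] True by simp
        hence "gcd (l ^ j) (3 * 5) = gcd (l ^ j) 3" by (rule gcd_mult_right_right_cancel)
        thus ?thesis by simp
      qed
      ultimately show ?thesis using True by (auto simp: c_def)
    next
      case False
      have "e = 1 \<or> e = 2" using e False by (auto simp: c_def)
      moreover have "gcd (l ^ j) 3 = 1" using cop_pow[of 3 j] False by (simp add: coprime_iff_gcd_eq_1)
      ultimately show ?thesis by (auto simp: c_def)
    qed
    have nl: "\<not> lambda_practical (l ^ j * 1 * \<Prod>S)"
      if S: "finite S" "\<And>q. q \<in> S \<Longrightarrow> prime q \<and> t < q" for S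
    proof (rule not_lambda_practical_of_gcd[where 'a = bool, OF prime_card, of c])
      show "0 < c" "c < l ^ j * 1" using lj by (auto simp: c_def)
      show "\<not> CARD(bool) dvd l ^ j * 1" using odd by simp
      show "prime q \<and> CARD(bool) ^ (c + 1) < q" if "q \<in> S" for q using S(2)[OF that] by (simp add: t_def)
    qed (use g S in auto)
    show ?thesis
    proof (rule count_p_practical_not_lambda[OF l refl _ t1 T jT(3,4)])
      show "nearly_covers (cyc_degrees (l ^ j) 1) (l ^ j * 1)" by (rule nearly_covers_one)
      show "has_all_degrees l (l ^ j * 1)" by (rule has_all_degrees_prime_power[OF l])
    qed (use nl in auto)
  next
    case True
    \<comment> \<open>Here c = 4: for e <= 5 neither 7 nor 11 divides 17^e - 1, so only the factor 4
      of the base can be shared and degree 5 is missing over F_17.\<close>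
    define t :: nat where "t = 17 ^ 5"
    have t1: "t \<ge> 1" by (simp add: t_def)
    obtain j T where jT: "j \<ge> 2" "2 * T \<le> 28 * 11 ^ j" "T \<ge> 1" "ln (real T) \<ge> ln (real t) + 29"
      by (rule exists_large_threshold[OF _ t1, of 11 28]) auto
    have T: "2 * T \<le> 4 * (7 * 11 ^ j)" using jT(2) by simp
    have b: "7 * 11 ^ j > (0 :: nat)" by simp
    have M: "4 = l ^ 2" using True by simp
    have p7: "prime (7 :: nat)" "prime (11 :: nat)" by simp_all
    have bt: "p \<le> t" if p: "prime p" "p dvd 7 * 11 ^ j" for p
    proof -
      have "p dvd 7 \<or> p dvd 11" using p prime_dvd_mult_iff prime_dvd_power by blast
      hence "p \<le> 11" by (auto dest: dvd_imp_le)
      thus ?thesis by (simp add: t_def)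
    qed
    have nl: "\<not> lambda_practical (4 * (7 * 11 ^ j) * \<Prod>S)"
      if S: "finite S" "\<And>q. q \<in> S \<Longrightarrow> prime q \<and> t < q" for S
    proof (rule not_lambda_practical_of_gcd[where 'a = residue17, OF prime_card, of 4])
      have p17: "prime (17 :: nat)" by simp
      show "(0 :: nat) < 4" "4 < 4 * (7 * 11 ^ j :: nat)" by (simp_all add: Suc_lessI)
      show "\<not> CARD(residue17) dvd 4 * (7 * 11 ^ j)"
      proof
        assume "CARD(residue17) dvd 4 * (7 * 11 ^ j)"
        hence "17 dvd 4 * (7 * 11 ^ j :: nat)" by (simp add: card_residue17)
        hence "17 dvd (4 :: nat) \<or> 17 dvd (7 :: nat) \<or> 17 dvd (11 :: nat)"
          using p17 prime_dvd_mult_iff prime_dvd_power by blast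
        thus False by simp
      qed
      show "prime q \<and> CARD(residue17) ^ (4 + 1) < q" if "q \<in> S" for q
        using S(2)[OF that] by (simp add: t_def card_residue17)
      show "gcd (4 * (7 * 11 ^ j)) (CARD(residue17) ^ e - 1) dvd 4" if e: "1 \<le> e" "e \<le> 4 + 1" for e
      proof -
        define N :: nat where "N = 17 ^ e - 1"
        have "e = 1 \<or> e = 2 \<or> e = 3 \<or> e = 4 \<or> e = 5" using e by auto
        hence "\<not> 7 dvd N" "\<not> 11 dvd N" by (auto simp: N_def)
        hence "Rings.coprime 7 N" "Rings.coprime 11 N"
          using Factorial_Ring.prime_imp_coprime p7 by blast+
        hence "Rings.coprime N (7 * 11 ^ j)" by (simp add: ac_simps)
        hence "gcd (4 * (7 * 11 ^ j)) N = gcd 4 N" by (rule gcd_mult_left_right_cancel)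
        thus ?thesis unfolding card_residue17 N_def[symmetric] by simp
      qed
    qed (use S in auto)
    have h: "has_all_degrees l (4 * (7 * 11 ^ j))" using base_28_11 True by blast
    show ?thesis
    proof (rule count_p_practical_not_lambda[OF l M b t1 T jT(3,4)])
      show "nearly_covers (cyc_degrees 4 (7 * 11 ^ j)) (4 * (7 * 11 ^ j))" using base_28_11 by blast
    qed (fact bt h nl)+
  qed
qed

end
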